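(* Let $\Omega\subset\mathbb{C}^n$ be a bounded open set and let $K\subset\subset\Omega$ be a compact subset. The following statements hold, and they are equivalent to each other. (a) There exist constants $A_1>0$ and $\alpha>0$ depending only on $K,\Omega$ such that for every Borel set $E\subset K$, $$V_{2n}(E)\le A_1e^{-\alpha/\mathtt{c}(E)}.$$ (b) There exist constants $A_1>0$ and $\alpha>0$ depending only on $K,\Omega$ such that for every $f\in W^*(\Omega)$ with $f\le 0$, $$V_{2n}(\{f<-1\}\cap K)\le A_1e^{-\alpha/\|f\|_*^2}.$$ (c) There exist constants $A_1>0$ and $\alpha>0$ depending only on $K,\Omega$ such that for every $\kappa>0$ and every $f\in W^*(\Omega)$ with $f\le 0$ and $\|f\|_*\le\kappa$, $$V_{2n}(\{f<-s\}\cap K)\le A_1e^{-\alpha s^2/\kappa^2}\quad\text{for all } s>0.$$ (d) There exist constants $A_1>0$ and $\alpha>0$ depending only on $K,\Omega$ such that for every $f\in W^*(\Omega)$ with $f\le 0$ and $\|f\|_*\le 1$, $$V_{2n}(\{f<-s\}\cap K)\le A_1e^{-\alpha s^2}\quad\text{for all } s>0.$$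
   Context: $V_{2n}$ is Lebesgue measure on $\mathbb{C}^n=\mathbb{R}^{2n}$; conventions $e^{-\alpha/0}=0$. Notation: $d=\partial+\bar\partial$, $d^c=\frac{\sqrt{-1}}{2\pi}(\bar\partial-\partial)$, $\omega=dd^c|z|^2$. For a bounded open set $\Omega\subset\mathbb{C}^n$ and $f\in W^{1,2}(\Omega,\mathbb{R})$, let $\Gamma_f$ be the set of positive closed $(1,1)$-currents $T$ on $\Omega$ with $df\wedge d^cf\le T$ weakly in $\Omega$ (i.e. $T-df\wedge d^cf$ is a positive current), and $\|T\|_\Omega=\int_\Omega T\wedge\omega^{n-1}$. The complex Sobolev space is $W^*(\Omega)=\{f\in W^{1,2}(\Omega,\mathbb{R}):\exists\,T\in\Gamma_f,\ \|T\|_\Omega<\infty\}$ with norm $\|f\|_*^2=\|f\|_{L^2(\Omega)}^2+\inf_{T\in\Gamma_f}\|T\|_\Omega$. For a Borel set $E\subset\Omega$, $\mathtt{c}(E)=\mathtt{c}(E,\Omega)=\inf\{\|v\|_*^2: v\in W^*(\Omega),\ v\le 0,\ v\le -1 \text{ a.e. in a neighborhood of } E\}$. *)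

theory Defs
  imports "HOL-Analysis.Analysis" "HOL-Library.Nonpos_Ints"
begin

section \<open>Test functions and distributions\<close>

definition ddir :: "'a::real_normed_vector \<Rightarrow> ('a \<Rightarrow> 'b::real_normed_vector) \<Rightarrow> 'a \<Rightarrow> 'b" where
  "ddir v \<phi> x = frechet_derivative \<phi> (at x) v"

definition ddirs :: "'a::real_normed_vector list \<Rightarrow> ('a \<Rightarrow> 'b::real_normed_vector) \<Rightarrow> 'a \<Rightarrow> 'b" where
  "ddirs vs \<phi> = foldr ddir vs \<phi>"

text \<open>\<open>C\<^sup>\<infinity>\<close> in the real sense.\<close>
definition smooth :: "('a::real_normed_vector \<Rightarrow> 'b::real_normed_vector) \<Rightarrow> bool" where
  "smooth \<phi> \<longleftrightarrow> (\<forall>vs x. ddirs vs \<phi> differentiable (at x))"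

definition test_on :: "'a::real_normed_vector set \<Rightarrow> ('a \<Rightarrow> complex) set" where
  "test_on C = {\<phi>. smooth \<phi> \<and> (\<forall>x. x \<notin> C \<longrightarrow> \<phi> x = 0)}"

text \<open>\<open>C\<^sub>c\<^sup>\<infinity>(\<Omega>)\<close>, with functions extended by \<open>0\<close> to the whole space.\<close>
definition test_fun :: "'a::real_normed_vector set \<Rightarrow> ('a \<Rightarrow> complex) set" where
  "test_fun \<Omega> = (\<Union>C\<in>{C. compact C \<and> C \<subseteq> \<Omega>}. test_on C)"

text \<open>A distribution is a functional on all functions of which only the values on
  \<open>test_fun \<Omega>\<close> matter; continuity is the usual seminorm estimate on each compact set.\<close>
definition distribution :: "'a::euclidean_space set \<Rightarrow> (('a \<Rightarrow> complex) \<Rightarrow> complex) \<Rightarrow> bool" where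
  "distribution \<Omega> u \<longleftrightarrow>
     (\<forall>\<phi>\<in>test_fun \<Omega>. \<forall>\<psi>\<in>test_fun \<Omega>. \<forall>c. u (\<lambda>x. c * \<phi> x + \<psi> x) = c * u \<phi> + u \<psi>) \<and>
     (\<forall>C. compact C \<and> C \<subseteq> \<Omega> \<longrightarrow>
        (\<exists>M N. \<forall>\<phi>\<in>test_on C. \<forall>B.
           (\<forall>vs x. set vs \<subseteq> Basis \<and> length vs \<le> N \<longrightarrow> norm (ddirs vs \<phi> x) \<le> B)
             \<longrightarrow> norm (u \<phi>) \<le> M * B))"

text \<open>Functions that are real and nonnegative.\<close>
definition nonneg_test :: "'a::real_normed_vector set \<Rightarrow> ('a \<Rightarrow> complex) set" where
  "nonneg_test \<Omega> = {\<phi> \<in> test_fun \<Omega>. \<forall>x. \<phi> x \<in> \<real>\<^sub>\<ge>\<^sub>0}"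

definition nonneg_distribution :: "'a::real_normed_vector set \<Rightarrow> (('a \<Rightarrow> complex) \<Rightarrow> complex) \<Rightarrow> bool" where
  "nonneg_distribution \<Omega> u \<longleftrightarrow> (\<forall>\<phi>\<in>nonneg_test \<Omega>. u \<phi> \<in> \<real>\<^sub>\<ge>\<^sub>0)"

text \<open>Total mass of the measure given by a nonnegative distribution on an open set.\<close>
definition total_mass :: "'a::real_normed_vector set \<Rightarrow> (('a \<Rightarrow> complex) \<Rightarrow> complex) \<Rightarrow> ennreal" where
  "total_mass \<Omega> u = (SUP \<phi>\<in>{\<phi>\<in>nonneg_test \<Omega>. \<forall>x. norm (\<phi> x) \<le> 1}. ennreal (Re (u \<phi>)))"


section \<open>Forms and currents on \<open>\<complex>\<^sup>n\<close>\<close>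

definition d_z :: "'n::finite \<Rightarrow> (complex^'n \<Rightarrow> complex) \<Rightarrow> complex^'n \<Rightarrow> complex" where
  "d_z j \<phi> z = (ddir (axis j 1) \<phi> z - \<i> * ddir (axis j \<i>) \<phi> z) / 2"

definition d_zbar :: "'n::finite \<Rightarrow> (complex^'n \<Rightarrow> complex) \<Rightarrow> complex^'n \<Rightarrow> complex" where
  "d_zbar j \<phi> z = (ddir (axis j 1) \<phi> z + \<i> * ddir (axis j \<i>) \<phi> z) / 2"

text \<open>A pair \<open>(a, b)\<close> stands for the 1-covector \<open>\<Sum>\<^sub>j a\<^sub>j dz\<^sub>j + \<Sum>\<^sub>j b\<^sub>j d\<zbar>\<^sub>j\<close>,
  and a matrix \<open>m\<close> for the (1,1)-covector \<open>\<Sum>\<^sub>j\<^sub>k m\<^sub>j\<^sub>k dz\<^sub>j \<and> d\<zbar>\<^sub>k\<close>.\<close>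
type_synonym 'n covec = "(complex^'n) \<times> (complex^'n)"
type_synonym 'n covec11 = "complex^'n^'n"

text \<open>The (1,1)-part of the wedge product.  In the two uses below, \<open>df \<and> d\<^sup>cf\<close> and
  \<open>\<beta> \<and> \<beta>\<^bold>\<bar>\<close> with \<open>\<beta>\<close> of type (1,0), the other parts vanish.\<close>
definition wedge11 :: "'n::finite covec \<Rightarrow> 'n covec \<Rightarrow> 'n covec11" where
  "wedge11 p q = (\<chi> j k. fst p $ j * snd q $ k - snd p $ k * fst q $ j)"

text \<open>A current of bidegree (1,1) is a (1,1)-form \<open>\<Sum>\<^sub>j\<^sub>k T\<^sub>j\<^sub>k dz\<^sub>j \<and> d\<zbar>\<^sub>k\<close> with distribution coefficients.\<close>
type_synonym 'n current11 = "'n \<Rightarrow> 'n \<Rightarrow> (complex^'n \<Rightarrow> complex) \<Rightarrow> complex"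

definition is_current11 :: "(complex^'n::finite) set \<Rightarrow> 'n current11 \<Rightarrow> bool" where
  "is_current11 \<Omega> T \<longleftrightarrow> (\<forall>j k. distribution \<Omega> (T j k))"

text \<open>\<open>\<partial>T = 0\<close> and \<open>\<partial>\<^bold>\<bar>T = 0\<close>, coefficient by coefficient; the derivative of a distribution is
  \<open>(\<partial>\<^sub>l u)(\<phi>) = - u(\<partial>\<^sub>l \<phi>)\<close>.\<close>
definition closed_current11 :: "(complex^'n::finite) set \<Rightarrow> 'n current11 \<Rightarrow> bool" where
  "closed_current11 \<Omega> T \<longleftrightarrow>
     (\<forall>\<phi>\<in>test_fun \<Omega>. \<forall>j k l.
        - T j k (d_z l \<phi>) = - T l k (d_z j \<phi>) \<and>
        - T j k (d_zbar l \<phi>) = - T j l (d_zbar k \<phi>))"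

text \<open>The current defined by a (1,1)-form with locally integrable coefficients.\<close>
definition form_current :: "(complex^'n::finite) set \<Rightarrow> (complex^'n \<Rightarrow> 'n covec11) \<Rightarrow> 'n current11" where
  "form_current \<Omega> m j k \<phi> = (LINT z|lebesgue_on \<Omega>. m z $ j $ k * \<phi> z)"

text \<open>\<open>T \<and> \<And>\<^sub>j \<gamma>\<^sub>j\<close>, the product over all indices \<open>j \<noteq> j0\<close>, for constant (1,1)-forms \<open>\<gamma>\<^sub>j\<close>; the result is
  identified with a distribution through the volume form \<open>\<And>\<^sub>j dx\<^sub>j \<and> dy\<^sub>j\<close>.
  The 2-forms \<open>dz\<^sub>p \<and> d\<zbar>\<^sub>q\<close> commute, and reordering
  \<open>\<And>\<^sub>j dz\<^sub>\<sigma>\<^sub>(\<^sub>j\<^sub>) \<and> d\<zbar>\<^sub>\<tau>\<^sub>(\<^sub>j\<^sub>)\<close> into \<open>\<And>\<^sub>j dz\<^sub>j \<and> d\<zbar>\<^sub>j = (-2\<i>)\<^sup>n \<And>\<^sub>j dx\<^sub>j \<and> dy\<^sub>j\<close>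
  costs the sign of \<open>\<sigma>\<close> times that of \<open>\<tau>\<close>.\<close>
definition wedge_top :: "'n::finite \<Rightarrow> 'n current11 \<Rightarrow> ('n \<Rightarrow> 'n covec11) \<Rightarrow>
    (complex^'n \<Rightarrow> complex) \<Rightarrow> complex" where
  "wedge_top j0 T \<gamma> \<phi> =
     (- 2 * \<i>) ^ CARD('n) *
     (\<Sum>\<sigma> | \<sigma> permutes UNIV. \<Sum>\<tau> | \<tau> permutes UNIV.
        of_int (sign \<sigma> * sign \<tau>) * (\<Prod>j\<in>UNIV - {j0}. \<gamma> j $ \<sigma> j $ \<tau> j) * T (\<sigma> j0) (\<tau> j0) \<phi>)"

definition conj_vec :: "complex^'n \<Rightarrow> complex^'n::finite" where
  "conj_vec b = (\<chi> j. cnj (b $ j))"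

text \<open>The (1,1)-covector \<open>\<i> \<beta> \<and> \<beta>\<^bold>\<bar>\<close> for \<open>\<beta> = \<Sum>\<^sub>j b\<^sub>j dz\<^sub>j\<close>.\<close>
definition i_beta_betabar :: "complex^'n \<Rightarrow> 'n::finite covec11" where
  "i_beta_betabar b = (\<chi> j k. \<i> * wedge11 (b, 0) (0, conj_vec b) $ j $ k)"

text \<open>\<open>T \<ge> 0\<close> iff \<open>T \<and> \<i>\<beta>\<^sub>1 \<and> \<beta>\<^bold>\<bar>\<^sub>1 \<and> \<dots> \<and> \<i>\<beta>\<^sub>n\<^sub>-\<^sub>1 \<and> \<beta>\<^bold>\<bar>\<^sub>n\<^sub>-\<^sub>1 \<ge> 0\<close> for all constant (1,0)-forms \<open>\<beta>\<^sub>j\<close>.\<close>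
definition positive_current11 :: "(complex^'n::finite) set \<Rightarrow> 'n current11 \<Rightarrow> bool" where
  "positive_current11 \<Omega> T \<longleftrightarrow>
     (\<forall>j0. \<forall>\<beta>::'n \<Rightarrow> complex^'n. nonneg_distribution \<Omega> (wedge_top j0 T (\<lambda>j. i_beta_betabar (\<beta> j))))"

text \<open>\<open>\<omega> = dd\<^sup>c|z|\<^sup>2 = (\<i>/\<pi>) \<Sum>\<^sub>j dz\<^sub>j \<and> d\<zbar>\<^sub>j\<close>; see \<open>kahler_eq_ddc\<close> below.\<close>
definition kahler :: "'n::finite covec11" where
  "kahler = (\<chi> j k. if j = k then \<i> / of_real pi else 0)"

text \<open>\<open>\<parallel>T\<parallel>\<^sub>\<Omega> = \<integral>\<^sub>\<Omega> T \<and> \<omega>\<^sup>n\<^sup>-\<^sup>1\<close>; the position given to \<open>T\<close> is immaterial, see \<open>wedge_top_slot\<close> below.\<close>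
definition mass :: "(complex^'n::finite) set \<Rightarrow> 'n current11 \<Rightarrow> ennreal" where
  "mass \<Omega> T = total_mass \<Omega> (wedge_top (SOME j. True) T (\<lambda>_. kahler))"

text \<open>\<open>d\<^sup>c = \<i>/(2\<pi>) (\<partial>\<^bold>\<bar> - \<partial>)\<close>, applied to a function with differential \<open>(a, b)\<close>.\<close>
definition dc_of :: "'n::finite covec \<Rightarrow> 'n covec" where
  "dc_of p = (- (\<i> / (2 * of_real pi)) *s fst p, (\<i> / (2 * of_real pi)) *s snd p)"


section \<open>Sobolev spaces\<close>

definition L2_on :: "'a::euclidean_space set \<Rightarrow> ('a \<Rightarrow> real) \<Rightarrow> bool" where
  "L2_on \<Omega> f \<longleftrightarrow> f \<in> borel_measurable (lebesgue_on \<Omega>) \<and> integrable (lebesgue_on \<Omega>) (\<lambda>x. (f x)\<^sup>2)"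

definition weak_deriv :: "'a::euclidean_space set \<Rightarrow> ('a \<Rightarrow> real) \<Rightarrow> 'a \<Rightarrow> ('a \<Rightarrow> real) \<Rightarrow> bool" where
  "weak_deriv \<Omega> f v g \<longleftrightarrow> L2_on \<Omega> g \<and>
     (\<forall>\<phi>\<in>test_fun \<Omega>. (LINT x|lebesgue_on \<Omega>. of_real (f x) * ddir v \<phi> x)
                    = - (LINT x|lebesgue_on \<Omega>. of_real (g x) * \<phi> x))"

text \<open>\<open>W\<^sup>1\<^sup>,\<^sup>2(\<Omega>, \<real>)\<close>\<close>
definition W12 :: "'a::euclidean_space set \<Rightarrow> ('a \<Rightarrow> real) set" where
  "W12 \<Omega> = {f. L2_on \<Omega> f \<and> (\<forall>v\<in>Basis. \<exists>g. weak_deriv \<Omega> f v g)}"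

definition wgrad :: "'a::euclidean_space set \<Rightarrow> ('a \<Rightarrow> real) \<Rightarrow> 'a \<Rightarrow> 'a \<Rightarrow> real" where
  "wgrad \<Omega> f v = (SOME g. weak_deriv \<Omega> f v g)"

text \<open>The weak differential \<open>df = \<partial>f + \<partial>\<^bold>\<bar>f\<close>.\<close>
definition wdiff :: "(complex^'n::finite) set \<Rightarrow> (complex^'n \<Rightarrow> real) \<Rightarrow> complex^'n \<Rightarrow> 'n covec" where
  "wdiff \<Omega> f z =
     ((\<chi> j. (of_real (wgrad \<Omega> f (axis j 1) z) - \<i> * of_real (wgrad \<Omega> f (axis j \<i>) z)) / 2),
      (\<chi> j. (of_real (wgrad \<Omega> f (axis j 1) z) + \<i> * of_real (wgrad \<Omega> f (axis j \<i>) z)) / 2))"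

definition df_wedge_dcf :: "(complex^'n::finite) set \<Rightarrow> (complex^'n \<Rightarrow> real) \<Rightarrow> 'n current11" where
  "df_wedge_dcf \<Omega> f = form_current \<Omega> (\<lambda>z. wedge11 (wdiff \<Omega> f z) (dc_of (wdiff \<Omega> f z)))"

definition Gamma_f :: "(complex^'n::finite) set \<Rightarrow> (complex^'n \<Rightarrow> real) \<Rightarrow> 'n current11 set" where
  "Gamma_f \<Omega> f = {T. is_current11 \<Omega> T \<and> closed_current11 \<Omega> T \<and> positive_current11 \<Omega> T \<and>
      positive_current11 \<Omega> (\<lambda>j k \<phi>. T j k \<phi> - df_wedge_dcf \<Omega> f j k \<phi>)}"

definition W_star :: "(complex^'n::finite) set \<Rightarrow> (complex^'n \<Rightarrow> real) set" where
  "W_star \<Omega> = {f \<in> W12 \<Omega>. \<exists>T\<in>Gamma_f \<Omega> f. mass \<Omega> T < \<infinity>}"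

text \<open>Meaningful for \<open>f \<in> W_star \<Omega>\<close> only.\<close>
definition star_norm :: "(complex^'n::finite) set \<Rightarrow> (complex^'n \<Rightarrow> real) \<Rightarrow> real" where
  "star_norm \<Omega> f =
     sqrt ((LINT z|lebesgue_on \<Omega>. (f z)\<^sup>2) + enn2real (INF T\<in>Gamma_f \<Omega> f. mass \<Omega> T))"

text \<open>Elements of \<open>W\<^sup>*(\<Omega>)\<close> are classes modulo null sets, so \<open>f \<le> 0\<close> is meant almost everywhere.\<close>
definition W_star_nonpos :: "(complex^'n::finite) set \<Rightarrow> (complex^'n \<Rightarrow> real) set" where
  "W_star_nonpos \<Omega> = {f \<in> W_star \<Omega>. AE z in lebesgue_on \<Omega>. f z \<le> 0}"

definition capacity :: "(complex^'n::finite) set \<Rightarrow> (complex^'n) set \<Rightarrow> real" where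
  "capacity \<Omega> E = Inf {(star_norm \<Omega> v)\<^sup>2 | v. v \<in> W_star_nonpos \<Omega> \<and>
     (\<exists>U. open U \<and> E \<subseteq> U \<and> U \<subseteq> \<Omega> \<and> (AE z in lebesgue_on U. v z \<le> - 1))}"


section \<open>The four estimates\<close>

text \<open>\<open>e\<^sup>-\<^sup>\<alpha>\<^sup>/\<^sup>t\<close> with the convention \<open>e\<^sup>-\<^sup>\<alpha>\<^sup>/\<^sup>0 = 0\<close>.\<close>
definition exp_neg_div :: "real \<Rightarrow> real \<Rightarrow> real" where
  "exp_neg_div \<alpha> t = (if t = 0 then 0 else exp (- \<alpha> / t))"

definition stmt_a :: "(complex^'n::finite) set \<Rightarrow> (complex^'n) set \<Rightarrow> bool" where
  "stmt_a \<Omega> K \<longleftrightarrow> (\<exists>A1>0. \<exists>\<alpha>>0. \<forall>E. E \<in> sets borel \<and> E \<subseteq> K \<longrightarrow>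
     measure lebesgue E \<le> A1 * exp_neg_div \<alpha> (capacity \<Omega> E))"

definition stmt_b :: "(complex^'n::finite) set \<Rightarrow> (complex^'n) set \<Rightarrow> bool" where
  "stmt_b \<Omega> K \<longleftrightarrow> (\<exists>A1>0. \<exists>\<alpha>>0. \<forall>f\<in>W_star_nonpos \<Omega>.
     measure lebesgue ({z\<in>\<Omega>. f z < - 1} \<inter> K) \<le> A1 * exp_neg_div \<alpha> ((star_norm \<Omega> f)\<^sup>2))"

definition stmt_c :: "(complex^'n::finite) set \<Rightarrow> (complex^'n) set \<Rightarrow> bool" where
  "stmt_c \<Omega> K \<longleftrightarrow> (\<exists>A1>0. \<exists>\<alpha>>0. \<forall>\<kappa>>0. \<forall>f\<in>W_star_nonpos \<Omega>. star_norm \<Omega> f \<le> \<kappa> \<longrightarrow>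
     (\<forall>s>0. measure lebesgue ({z\<in>\<Omega>. f z < - s} \<inter> K) \<le> A1 * exp (- \<alpha> * s\<^sup>2 / \<kappa>\<^sup>2)))"

definition stmt_d :: "(complex^'n::finite) set \<Rightarrow> (complex^'n) set \<Rightarrow> bool" where
  "stmt_d \<Omega> K \<longleftrightarrow> (\<exists>A1>0. \<exists>\<alpha>>0. \<forall>f\<in>W_star_nonpos \<Omega>. star_norm \<Omega> f \<le> 1 \<longrightarrow>
     (\<forall>s>0. measure lebesgue ({z\<in>\<Omega>. f z < - s} \<inter> K) \<le> A1 * exp (- \<alpha> * s\<^sup>2)))"


section \<open>Checks of the conventions\<close>

lemma ddir_normsq:
  "ddir v (\<lambda>w::complex^'n::finite. complex_of_real ((norm w)\<^sup>2)) z = of_real (2 * (z \<bullet> v))"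
proof -
  have "((\<lambda>w::complex^'n. complex_of_real (w \<bullet> w)) has_derivative (\<lambda>h. of_real (z \<bullet> h + h \<bullet> z))) (at z)"
    by (auto intro!: derivative_eq_intros)
  then show ?thesis
    unfolding ddir_def power2_norm_eq_inner
    by (subst frechet_derivative_at[symmetric], assumption) (simp add: inner_commute)
qed

lemma inner_axis_complex:
  fixes z :: "complex^'n::finite"
  shows "z \<bullet> axis j 1 = Re (z $ j)" "z \<bullet> axis j \<i> = Im (z $ j)"
  by (simp_all add: inner_axis inner_complex_def)

lemma d_zbar_normsq: "d_zbar k (\<lambda>w::complex^'n::finite. of_real ((norm w)\<^sup>2)) = (\<lambda>z. z $ k)"
  by (rule ext) (simp add: d_zbar_def ddir_normsq inner_axis_complex complex_eq_iff del: of_real_power)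

lemma d_z_normsq: "d_z k (\<lambda>w::complex^'n::finite. of_real ((norm w)\<^sup>2)) = (\<lambda>z. cnj (z $ k))"
  by (rule ext) (simp add: d_z_def ddir_normsq inner_axis_complex complex_eq_iff del: of_real_power)

text \<open>For \<open>\<eta> = \<Sum>\<^sub>j a\<^sub>j dz\<^sub>j + \<Sum>\<^sub>j b\<^sub>j d\<zbar>\<^sub>j\<close>, the coefficient of \<open>dz\<^sub>j \<and> d\<zbar>\<^sub>k\<close> in \<open>d\<eta>\<close> is
  \<open>\<partial>\<^sub>j b\<^sub>k - \<partial>\<^bold>\<bar>\<^sub>k a\<^sub>j\<close>; here \<open>\<eta> = d\<^sup>c|z|\<^sup>2\<close>.\<close>
lemma kahler_eq_ddc:
  fixes z :: "complex^'n::finite" and \<eta> :: "complex^'n \<Rightarrow> 'n covec"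
  defines "\<eta> \<equiv> (\<lambda>z. dc_of ((\<chi> j. d_z j (\<lambda>w. of_real ((norm w)\<^sup>2)) z), (\<chi> j. d_zbar j (\<lambda>w. of_real ((norm w)\<^sup>2)) z)))"
  shows "kahler $ j $ k = d_z j (\<lambda>z. snd (\<eta> z) $ k) z - d_zbar k (\<lambda>z. fst (\<eta> z) $ j) z"
proof -
  have 1: "ddir v (\<lambda>z::complex^'n. c * z $ k) z = c * v $ k" for v c
  proof -
    have "((\<lambda>z::complex^'n. c * z $ k) has_derivative (\<lambda>h. c * h $ k)) (at z)"
      by (intro bounded_linear_imp_has_derivative bounded_linear_const_mult bounded_linear_vec_nth)
    then show ?thesis unfolding ddir_def by (subst frechet_derivative_at[symmetric]) auto
  qed
  have 2: "ddir v (\<lambda>z::complex^'n. c * cnj (z $ j)) z = c * cnj (v $ j)" for v c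
  proof -
    have "((\<lambda>z::complex^'n. c * cnj (z $ j)) has_derivative (\<lambda>h. c * cnj (h $ j))) (at z)"
      by (intro bounded_linear_imp_has_derivative bounded_linear_const_mult
           bounded_linear_compose[OF bounded_linear_cnj] bounded_linear_vec_nth)
    then show ?thesis unfolding ddir_def by (subst frechet_derivative_at[symmetric]) auto
  qed
  have s: "snd (\<eta> z) $ k = \<i> / (2 * of_real pi) * z $ k" for z
    by (simp add: \<eta>_def dc_of_def d_zbar_normsq del: of_real_power)
  have f: "fst (\<eta> z) $ j = - (\<i> / (2 * of_real pi)) * cnj (z $ j)" for z
    by (simp add: \<eta>_def dc_of_def d_z_normsq del: of_real_power)
  show ?thesis
    unfolding s f d_z_def d_zbar_def 1 2
    by (auto simp: kahler_def axis_def field_simps)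
qed

lemma wedge_top_slot:
  fixes T :: "'n::finite current11"
  shows "wedge_top i T (\<lambda>_. \<gamma>) = wedge_top j T (\<lambda>_. \<gamma>)"
proof (rule ext)
  fix \<phi>
  let ?t = "Transposition.transpose i j :: 'n \<Rightarrow> 'n"
  let ?P = "{\<sigma>::'n \<Rightarrow> 'n. \<sigma> permutes UNIV}"
  have bij: "bij_betw (\<lambda>\<sigma>. \<sigma> \<circ> ?t) ?P ?P"
    by (rule bij_betw_byWitness[where f' = "\<lambda>\<sigma>. \<sigma> \<circ> ?t"])
       (auto simp: comp_assoc intro!: permutes_compose permutes_swap_id)
  let ?F = "\<lambda>i \<sigma> \<tau>. of_int (sign \<sigma> * sign \<tau>) * (\<Prod>l\<in>UNIV - {i}. \<gamma> $ \<sigma> l $ \<tau> l) * T (\<sigma> i) (\<tau> i) \<phi>"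
  have perm: "permutation \<sigma>" if "\<sigma> \<in> ?P" for \<sigma>
    using that permutation_permutes by (auto simp: permutation_permutes)
  have eq: "?F j (\<sigma> \<circ> ?t) (\<tau> \<circ> ?t) = ?F i \<sigma> \<tau>" if "\<sigma> \<in> ?P" "\<tau> \<in> ?P" for \<sigma> \<tau>
  proof -
    have "sign (\<sigma> \<circ> ?t) * sign (\<tau> \<circ> ?t) = sign \<sigma> * sign \<tau>"
      using perm[OF that(1)] perm[OF that(2)]
      by (simp add: sign_compose permutation_swap_id sign_swap_id)
    moreover have "(\<Prod>l\<in>UNIV - {j}. \<gamma> $ (\<sigma> \<circ> ?t) l $ (\<tau> \<circ> ?t) l) = (\<Prod>l\<in>UNIV - {i}. \<gamma> $ \<sigma> l $ \<tau> l)"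
      by (rule prod.reindex_bij_witness[where i = ?t and j = ?t]) (auto simp: Transposition.transpose_def)
    ultimately show ?thesis by (simp only: o_apply transpose_apply_second)
  qed
  have "(\<Sum>\<sigma>\<in>?P. \<Sum>\<tau>\<in>?P. ?F j \<sigma> \<tau>) = (\<Sum>\<sigma>\<in>?P. \<Sum>\<tau>\<in>?P. ?F j (\<sigma> \<circ> ?t) (\<tau> \<circ> ?t))"
    by (subst sum.reindex_bij_betw[OF bij, symmetric], rule sum.cong[OF refl],
        subst sum.reindex_bij_betw[OF bij, symmetric], rule refl)
  also have "\<dots> = (\<Sum>\<sigma>\<in>?P. \<Sum>\<tau>\<in>?P. ?F i \<sigma> \<tau>)"
    using eq by (intro sum.cong refl) blast
  finally show "wedge_top i T (\<lambda>_. \<gamma>) \<phi> = wedge_top j T (\<lambda>_. \<gamma>) \<phi>"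
    by (simp add: wedge_top_def)
qed

end

theory Submission
  imports Defs
begin

text \<open>
  All four statements follow from (c).  Let \<open>f \<le> 0\<close> with \<open>\<parallel>f\<parallel>\<^sub>* \<le> \<kappa>\<close>, and let \<open>T\<close> be closed positive with
  \<open>df \<and> d\<^sup>cf \<le> T\<close> and mass at most \<open>2 \<kappa>\<^sup>2\<close>.  Closedness of \<open>T\<close>, tested against radial functions around a point
  \<open>a\<close>, gives Lelong's monotonicity: the contraction of \<open>T\<close> with \<open>(z - a) \<otimes> \<^bold>\<bar>(z - a)\<close>, weighted by
  \<open>(\<bar>z - a\<bar>\<^sup>2 + \<delta>\<^sup>2)\<^sup>-\<^sup>n\<close>, is bounded uniformly in \<open>a\<close> and \<open>\<delta>\<close>.  Hence so is the weighted energy of the radial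
  derivative of \<open>f\<close>, although the full energy near \<open>a\<close> need not be.  Since the weight has total mass of order
  \<open>log (1 / \<delta>)\<close>, the Cauchy-Schwarz inequality bounds the averages of \<open>- f\<close> at scale \<open>\<delta>\<close> by a multiple of
  \<open>\<kappa> sqrt (log (1 / \<delta>))\<close> around every point.  On a set \<open>C\<close> of measure \<open>\<delta>\<close>, the average of \<open>- f\<close> over \<open>C\<close> exceeds this by
  at most a multiple of \<open>\<kappa>\<close>, for which \<open>\<nabla>f \<in> L\<^sup>2\<close> suffices.  If \<open>f < - s\<close> on \<open>C\<close> this reads
  \<open>s \<le> A \<kappa> (1 + sqrt (log (1 / \<bar>C\<bar>)))\<close>, which is (c).
\<close>

text \<open>Two scales are needed. The weight (|z - a|^2 + e)^(-n) is critical in real dimension 2n: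
  its integral grows like log (1 / e), so e cannot tend to 0 in the bound at one center. But C is an
  arbitrary set, and its indicator is recovered from the kernels only as e tends to 0. The radial
  energy is therefore used at e = \<delta>^2 with \<delta> = min (1/2, |C|), and the difference of
  the weights at \<eta>^2 and \<delta>^2 is estimated only after integration over the centers. There
  the plain L^2 gradient suffices, and a gain \<delta>^(1/2) makes this contribution O(|C|),
  uniformly in \<eta>. The link between f and its radial derivative is div ((z - a) W) = P - Q, with
  P concentrating at a and Q bounded. Positivity is defined by constant forms only, so inserting the
  field z - a into T and into its difference with the current of f takes an averaging argument of
  its own. In (a) the capacity is an infimum of reals, so a competitor must be exhibited. The
  constant -1 is one, once its weak gradient, which is obtained by choice, is known to
  vanish.\<close>

section \<open>Smooth functions and test functions\<close>

text \<open>\<open>smooth\<close> quantifies over all iterated directional derivatives, so it is the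
  largest class of differentiable functions closed under \<open>ddir\<close>. Closure properties are
  proved by exhibiting such a class, usually the sums of all expressions that the product or chain
  rule can produce.\<close>

lemma smooth_coinduct:
  assumes "P \<phi>" and "\<And>\<phi> x. P \<phi> \<Longrightarrow> \<phi> differentiable (at x)" and "\<And>\<phi> v. P \<phi> \<Longrightarrow> P (ddir v \<phi>)"
  shows "smooth \<phi>"
proof -
  have "P (ddirs vs \<phi>)" for vs
    by (induction vs) (auto simp: ddirs_def assms)
  then show ?thesis by (simp add: smooth_def assms(2))
qed

lemma smooth_differentiable: "smooth \<phi> \<Longrightarrow> \<phi> differentiable (at x)"
  unfolding smooth_def ddirs_def by (drule spec[of _ "[]"]) simp

lemma smooth_ddir: "smooth \<phi> \<Longrightarrow> smooth (ddir v \<phi>)"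
  unfolding smooth_def
proof (intro allI)
  fix vs x assume "\<forall>vs x. ddirs vs \<phi> differentiable (at x)"
  moreover have "ddirs vs (ddir v \<phi>) = ddirs (vs @ [v]) \<phi>" by (simp add: ddirs_def)
  ultimately show "ddirs vs (ddir v \<phi>) differentiable (at x)" by simp
qed

lemma smooth_has_derivative: "smooth \<phi> \<Longrightarrow> (\<phi> has_derivative (\<lambda>v. ddir v \<phi> x)) (at x)"
  using smooth_differentiable[of \<phi> x]
  by (simp add: ddir_def frechet_derivative_works)

lemma ddir_eqI: "(\<phi> has_derivative D) (at x) \<Longrightarrow> ddir v \<phi> x = D v"
  unfolding ddir_def using frechet_derivative_at by metis

lemma ddir_add:
  assumes "f differentiable (at x)" "g differentiable (at x)"
  shows "ddir v (\<lambda>x. f x + g x) x = ddir v f x + ddir v g x"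
  using assms unfolding frechet_derivative_works
  by (subst ddir_eqI[OF has_derivative_add]) (auto simp: ddir_def)

lemma smooth_continuous: "smooth \<phi> \<Longrightarrow> continuous_on A \<phi>"
  by (intro continuous_at_imp_continuous_on ballI differentiable_imp_continuous_within smooth_differentiable)

lemma smooth_const [simp]: "smooth (\<lambda>x::'a::real_normed_vector. c::'b::real_normed_vector)"
proof (rule smooth_coinduct[of "\<lambda>\<phi>. \<exists>c. \<phi> = (\<lambda>x. c)"])
  fix \<phi> :: "'a \<Rightarrow> 'b" and v assume "\<exists>c. \<phi> = (\<lambda>x. c)"
  then obtain c where \<phi>: "\<phi> = (\<lambda>x. c)" by auto
  have "ddir v \<phi> = (\<lambda>x. 0)"
    by (rule ext, subst ddir_eqI[where D = "\<lambda>_. 0"]) (auto simp: \<phi>)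
  then show "\<exists>c. ddir v \<phi> = (\<lambda>x. c)" by auto
qed auto

lemma smooth_add:
  fixes f g :: "'a::real_normed_vector \<Rightarrow> 'b::real_normed_vector"
  assumes "smooth f" "smooth g"
  shows "smooth (\<lambda>x. f x + g x)"
proof (rule smooth_coinduct[of "\<lambda>\<phi>. \<exists>f g. \<phi> = (\<lambda>x. f x + g x) \<and> smooth f \<and> smooth g"])
  fix \<phi> :: "'a \<Rightarrow> 'b" and v assume "\<exists>f g. \<phi> = (\<lambda>x. f x + g x) \<and> smooth f \<and> smooth g"
  then obtain f g where \<phi>: "\<phi> = (\<lambda>x. f x + g x)" and s: "smooth f" "smooth g" by auto
  have "ddir v \<phi> = (\<lambda>x. ddir v f x + ddir v g x)"
    using smooth_has_derivative[OF s(1)] smooth_has_derivative[OF s(2)]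
    by (intro ext, unfold \<phi>, subst ddir_eqI[OF has_derivative_add]) auto
  then show "\<exists>f g. ddir v \<phi> = (\<lambda>x. f x + g x) \<and> smooth f \<and> smooth g"
    using s smooth_ddir by blast
next
  fix \<phi> :: "'a \<Rightarrow> 'b" and x assume "\<exists>f g. \<phi> = (\<lambda>x. f x + g x) \<and> smooth f \<and> smooth g"
  then show "\<phi> differentiable (at x)"
    by (auto intro!: differentiable_add dest: smooth_differentiable)
qed (use assms in auto)

lemma smooth_linear:
  fixes f :: "'a::real_normed_vector \<Rightarrow> 'b::real_normed_vector" and L :: "'b \<Rightarrow> 'c::real_normed_vector"
  assumes "bounded_linear L" "smooth f"
  shows "smooth (\<lambda>x. L (f x))"
proof (rule smooth_coinduct[of "\<lambda>\<phi>. \<exists>f. \<phi> = (\<lambda>x. L (f x)) \<and> smooth f"])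
  fix \<phi> :: "'a \<Rightarrow> 'c" and v x assume "\<exists>f. \<phi> = (\<lambda>x. L (f x)) \<and> smooth f"
  then obtain f where \<phi>: "\<phi> = (\<lambda>x. L (f x))" and s: "smooth f" by auto
  have D: "(\<phi> has_derivative (\<lambda>v. L (ddir v f x))) (at x)" for x
    unfolding \<phi> by (rule bounded_linear.has_derivative[OF assms(1)]) (rule smooth_has_derivative[OF s])
  then show "\<phi> differentiable at x" by (auto simp: differentiable_def)
  have "ddir v \<phi> = (\<lambda>x. L (ddir v f x))" using ddir_eqI[OF D] by auto
  then show "\<exists>f. ddir v \<phi> = (\<lambda>x. L (f x)) \<and> smooth f"
    using s smooth_ddir by blast
qed (use assms in auto)

lemma smooth_id: "smooth (\<lambda>x::'a::real_normed_vector. x)"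
proof (rule smooth_coinduct[of "\<lambda>\<phi>. \<phi> = (\<lambda>x. x) \<or> smooth \<phi>"])
  fix \<phi> :: "'a \<Rightarrow> 'a" and v :: 'a assume "\<phi> = (\<lambda>x. x) \<or> smooth \<phi>"
  moreover have "ddir v (\<lambda>x. x) = (\<lambda>x. v)"
    using ddir_eqI[OF has_derivative_ident] by blast
  ultimately show "ddir v \<phi> = (\<lambda>x. x) \<or> smooth (ddir v \<phi>)"
    using smooth_ddir by auto
qed (use smooth_differentiable in auto)

lemma smooth_sum: "(\<And>i. i \<in> I \<Longrightarrow> smooth (f i)) \<Longrightarrow> smooth (\<lambda>x. \<Sum>i\<in>I. f i x)"
  by (induction I rule: infinite_finite_induct) (auto intro: smooth_add)

context
  fixes prod :: "'b::real_normed_vector \<Rightarrow> 'c::real_normed_vector \<Rightarrow> 'd::real_normed_vector"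
  assumes bil: "bounded_bilinear prod"
begin

text \<open>A single product is not stable under \<open>ddir\<close>: Leibniz gives a sum of two,
  each with one factor differentiated. Sums of products are stable.\<close>

inductive smooth_product :: "('a::real_normed_vector \<Rightarrow> 'd) \<Rightarrow> bool" where
  prod: "smooth f \<Longrightarrow> smooth g \<Longrightarrow> smooth_product (\<lambda>x. prod (f x) (g x))"
| add: "smooth_product f \<Longrightarrow> smooth_product g \<Longrightarrow> smooth_product (\<lambda>x. f x + g x)"

lemma smooth_product_differentiable: "smooth_product \<phi> \<Longrightarrow> \<phi> differentiable (at x)"
proof (induction rule: smooth_product.induct)
  case (prod f g)
  show ?case
    using bounded_bilinear.FDERIV[OF bil smooth_has_derivative[OF prod(1)] smooth_has_derivative[OF prod(2)]]
    by (auto simp: differentiable_def)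
qed auto

lemma smooth_product_ddir: "smooth_product \<phi> \<Longrightarrow> smooth_product (ddir v \<phi>)"
proof (induction rule: smooth_product.induct)
  case (prod f g)
  have "ddir v (\<lambda>x. prod (f x) (g x)) = (\<lambda>x. prod (f x) (ddir v g x) + prod (ddir v f x) (g x))"
    by (intro ext ddir_eqI[OF bounded_bilinear.FDERIV[OF bil smooth_has_derivative smooth_has_derivative]] prod)
  then show ?case by (simp add: smooth_product.intros smooth_ddir prod)
next
  case (add f g)
  have "ddir v (\<lambda>x. f x + g x) = (\<lambda>x. ddir v f x + ddir v g x)"
    by (rule ext) (rule ddir_add; rule smooth_product_differentiable; rule add)
  then show ?case by (simp add: smooth_product.intros add)
qed

lemma smooth_bilinear:
  assumes "smooth f" "smooth g"
  shows "smooth (\<lambda>x. prod (f x) (g x))"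
  by (rule smooth_coinduct[of smooth_product])
     (auto intro: smooth_product.prod assms smooth_product_differentiable smooth_product_ddir)

end

lemma smooth_mult:
  fixes f g :: "'a::real_normed_vector \<Rightarrow> 'b::real_normed_algebra"
  shows "smooth f \<Longrightarrow> smooth g \<Longrightarrow> smooth (\<lambda>x. f x * g x)"
  by (rule smooth_bilinear[OF bounded_bilinear_mult])

lemma smooth_scaleR: "smooth f \<Longrightarrow> smooth g \<Longrightarrow> smooth (\<lambda>x. f x *\<^sub>R g x)"
  by (rule smooth_bilinear[OF bounded_bilinear_scaleR])

lemma smooth_inner: "smooth f \<Longrightarrow> smooth g \<Longrightarrow> smooth (\<lambda>x. f x \<bullet> g x)"
  by (rule smooth_bilinear[OF bounded_bilinear_inner])

lemma smooth_minus: "smooth f \<Longrightarrow> smooth (\<lambda>x. - f x)"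
  by (rule smooth_linear) (auto intro: bounded_linear_minus bounded_linear_ident)

lemma smooth_diff: "smooth f \<Longrightarrow> smooth g \<Longrightarrow> smooth (\<lambda>x. f x - g x)"
  using smooth_add[OF _ smooth_minus, of f g] by simp

lemma smooth_power:
  fixes f :: "'a::real_normed_vector \<Rightarrow> 'b::real_normed_algebra_1"
  shows "smooth f \<Longrightarrow> smooth (\<lambda>x. f x ^ k)"
  by (induction k) (auto intro: smooth_mult)

lemma smooth_of_real: "smooth f \<Longrightarrow> smooth (\<lambda>x. complex_of_real (f x))"
  by (rule smooth_linear[OF bounded_linear_of_real])

lemma smooth_cnj: "smooth f \<Longrightarrow> smooth (\<lambda>x. cnj (f x))"
  by (rule smooth_linear[OF bounded_linear_cnj])

lemma smooth_vec_nth: "smooth f \<Longrightarrow> smooth (\<lambda>x. f x $ i)"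
  by (rule smooth_linear[OF bounded_linear_vec_nth])

inductive smooth_over_powers :: "('a::real_normed_vector \<Rightarrow> real) \<Rightarrow> ('a \<Rightarrow> real) \<Rightarrow> bool" for q where
  quot: "smooth p \<Longrightarrow> smooth_over_powers q (\<lambda>x. p x * inverse (q x) ^ k)"
| add: "smooth_over_powers q f \<Longrightarrow> smooth_over_powers q g \<Longrightarrow> smooth_over_powers q (\<lambda>x. f x + g x)"

lemma smooth_inverse:
  fixes q :: "'a::real_normed_vector \<Rightarrow> real"
  assumes "smooth q" and nz: "\<And>x. q x \<noteq> 0"
  shows "smooth (\<lambda>x. inverse (q x))"
proof (rule smooth_coinduct[of "smooth_over_powers q"])
  show "smooth_over_powers q (\<lambda>x. inverse (q x))"
    using smooth_over_powers.quot[of "\<lambda>x. 1" q 1] by simp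
  have D: "((\<lambda>x. p x * inverse (q x) ^ k) has_derivative
      (\<lambda>v. ddir v p x * inverse (q x) ^ k + (- real k * p x * ddir v q x) * inverse (q x) ^ (k + 1))) (at x)"
    if "smooth p" for p :: "'a \<Rightarrow> real" and k x
  proof (cases k)
    case 0
    then show ?thesis using smooth_has_derivative[OF that, of x] by simp
  next
    case (Suc m)
    show ?thesis
      by (rule derivative_eq_intros smooth_has_derivative[OF that] smooth_has_derivative[OF assms(1)] nz refl)+
         (auto simp: Suc algebra_simps fun_eq_iff)
  qed
  show diff: "\<phi> differentiable (at x)" if "smooth_over_powers q \<phi>" for \<phi> x
    using that
  proof (induction rule: smooth_over_powers.induct)
    case (quot p k)
    show ?case using D[OF quot] unfolding differentiable_def by blast
  qed auto
  show "smooth_over_powers q (ddir v \<phi>)" if "smooth_over_powers q \<phi>" for \<phi> v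
    using that
  proof (induction rule: smooth_over_powers.induct)
    case (quot p k)
    have "ddir v (\<lambda>x. p x * inverse (q x) ^ k) =
      (\<lambda>x. ddir v p x * inverse (q x) ^ k + (- real k * p x * ddir v q x) * inverse (q x) ^ (k + 1))"
      by (rule ext) (rule ddir_eqI[OF D[OF quot]])
    then show ?case
      using quot assms(1) by (simp only:) (intro smooth_over_powers.intros smooth_mult smooth_ddir; simp)
  next
    case (add f g)
    have "ddir v (\<lambda>x. f x + g x) = (\<lambda>x. ddir v f x + ddir v g x)"
      by (rule ext) (rule ddir_add; rule diff; rule add)
    then show ?case by (simp add: smooth_over_powers.intros add)
  qed
qed

text \<open>For k = 0 this is the standard function vanishing to infinite order at 0. The factor
  x^(-k) is carried along because differentiation only shifts k, so the family is closed under
  derivatives up to linear combinations.\<close>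

definition flat :: "nat \<Rightarrow> real \<Rightarrow> real" where
  "flat k x = (if x > 0 then exp (- inverse x) * inverse x ^ k else 0)"

lemma flat_nonneg: "0 \<le> flat k x"
  by (auto simp: flat_def)

lemma power_le_fact_exp: "0 \<le> u \<Longrightarrow> u ^ k \<le> fact k * exp (u::real)"
proof -
  assume u: "0 \<le> u"
  have "(\<Sum>i\<in>{k}. u ^ i /\<^sub>R fact i) \<le> (\<Sum>i. u ^ i /\<^sub>R fact i)"
    by (rule sum_le_suminf[OF summable_exp_generic]) (use u in auto)
  then show ?thesis by (simp add: exp_def field_simps)
qed

lemma flat_le: "flat k x \<le> fact k"
proof (cases "x > 0")
  case True
  have "exp (- inverse x) * inverse x ^ k \<le> exp (- inverse x) * (fact k * exp (inverse x))"
    by (rule mult_left_mono[OF power_le_fact_exp]) (use True in auto)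
  also have "\<dots> = fact k" by (simp add: exp_minus)
  finally show ?thesis using True by (simp add: flat_def)
qed (simp add: flat_def)

lemma flat_le_linear: "0 \<le> x \<Longrightarrow> flat k x \<le> fact (k + 1) * x"
proof (cases "x > 0")
  case True
  have "flat k x = flat (k + 1) x * x" using True by (simp add: flat_def)
  then show ?thesis using flat_le[of "k + 1" x] True by (simp add: mult_right_mono)
qed (simp add: flat_def)

lemma flat_has_derivative:
  "(flat k has_real_derivative (flat (k + 2) x - real k * flat (k + 1) x)) (at x)"
proof -
  consider "x > 0" | "x < 0" | "x = 0" by linarith
  then show ?thesis
  proof cases
    case 1
    have "((\<lambda>x. exp (- inverse x) * inverse x ^ k) has_real_derivative
        (flat (k + 2) x - real k * flat (k + 1) x)) (at x)"
    proof -
      \<comment> \<open>For k = 0 the natural number k - Suc 0 is 0 instead of -1; the factor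
        \<open>real k\<close> makes both sides vanish.\<close>
      have "real k * inverse x ^ (k - Suc 0) * (inverse x * inverse x) = real k * inverse x ^ (k + 1)"
        by (cases k) (auto simp: algebra_simps)
      moreover have "((\<lambda>x. exp (- inverse x) * inverse x ^ k) has_real_derivative
          exp (- inverse x) * (inverse x * inverse x) * inverse x ^ k
          + exp (- inverse x) * (- (real k * inverse x ^ (k - Suc 0) * (inverse x * inverse x)))) (at x)"
        by (rule derivative_eq_intros refl | use 1 in \<open>simp add: algebra_simps\<close>)+
      moreover have "exp (- inverse x) * (inverse x * inverse x) * inverse x ^ k
          + exp (- inverse x) * (- (real k * inverse x ^ (k + 1)))
          = flat (k + 2) x - real k * flat (k + 1) x"
        using 1 by (simp add: flat_def algebra_simps)
      ultimately show ?thesis by (simp only:)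
    qed
    then show ?thesis
      by (rule has_field_derivative_transform_within_open[of _ _ _ "{0<..}"]) (use 1 in \<open>auto simp: flat_def\<close>)
  next
    case 2
    have "((\<lambda>x. 0) has_real_derivative (flat (k + 2) x - real k * flat (k + 1) x)) (at x)"
      using 2 by (auto simp: flat_def)
    then show ?thesis
      by (rule has_field_derivative_transform_within_open[of _ _ _ "{..<0}"]) (use 2 in \<open>auto simp: flat_def\<close>)
  next
    case 3
    \<comment> \<open>To the right of 0 the difference quotient is \<open>flat (k + 1) h\<close>,
      which is O(h). The derivative at 0 is thus 0, in agreement with the formula since every
      \<open>flat k\<close> vanishes at 0.\<close>
    have "((\<lambda>h. flat k h / h) \<longlongrightarrow> 0) (at 0)"
    proof (rule Lim_null_comparison)
      show "\<forall>\<^sub>F h in at 0. norm (flat k h / h) \<le> fact (k + 2) * \<bar>h\<bar>"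
      proof (rule always_eventually, rule allI)
        fix h :: real
        show "norm (flat k h / h) \<le> fact (k + 2) * \<bar>h\<bar>"
        proof (cases "h > 0")
          case True
          then have "flat k h / h = flat (k + 1) h" by (simp add: flat_def field_simps)
          then show ?thesis using flat_le_linear[of h "k + 1"] True flat_nonneg[of "k + 1" h] by simp
        next
          case False
          moreover have "0 \<le> fact (k + 2) * \<bar>h\<bar>" by (intro mult_nonneg_nonneg) auto
          ultimately show ?thesis by (simp only: flat_def if_False div_0 norm_zero)
        qed
      qed
      show "((\<lambda>h. fact (k + 2) * \<bar>h\<bar>) \<longlongrightarrow> (0::real)) (at 0)"
        by (rule tendsto_eq_intros refl | simp)+
    qed
    then show ?thesis using 3 by (simp add: DERIV_def flat_def)
  qed
qed

text \<open>The chain rule turns \<open>flat k\<close> into \<open>flat (k + 1)\<close> and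
  \<open>flat (k + 2)\<close> times derivatives of \<open>q\<close>, so no fixed index would
  do.\<close>

inductive smooth_times_flat :: "('a::real_normed_vector \<Rightarrow> real) \<Rightarrow> ('a \<Rightarrow> real) \<Rightarrow> bool" for q where
  times: "smooth p \<Longrightarrow> smooth_times_flat q (\<lambda>x. p x * flat k (q x))"
| add: "smooth_times_flat q f \<Longrightarrow> smooth_times_flat q g \<Longrightarrow> smooth_times_flat q (\<lambda>x. f x + g x)"

lemma smooth_flat:
  fixes q :: "'a::real_normed_vector \<Rightarrow> real"
  assumes "smooth q"
  shows "smooth (\<lambda>x. flat k (q x))"
proof (rule smooth_coinduct[of "smooth_times_flat q"])
  show "smooth_times_flat q (\<lambda>x. flat k (q x))"
    using smooth_times_flat.times[of "\<lambda>x. 1" q k] by simp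
  have D: "((\<lambda>x. p x * flat k (q x)) has_derivative
      (\<lambda>v. ddir v p x * flat k (q x) + ((p x * ddir v q x) * flat (k + 2) (q x)
         + (- real k * p x * ddir v q x) * flat (k + 1) (q x)))) (at x)"
    if "smooth p" for p :: "'a \<Rightarrow> real" and k x
    by (rule derivative_eq_intros smooth_has_derivative[OF that] smooth_has_derivative[OF assms]
         DERIV_compose_FDERIV[OF flat_has_derivative] refl)+
       (auto simp: algebra_simps fun_eq_iff)
  show diff: "\<phi> differentiable (at x)" if "smooth_times_flat q \<phi>" for \<phi> x
    using that
  proof (induction rule: smooth_times_flat.induct)
    case (times p k)
    show ?case using D[OF times] unfolding differentiable_def by blast
  qed auto
  show "smooth_times_flat q (ddir v \<phi>)" if "smooth_times_flat q \<phi>" for \<phi> v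
    using that
  proof (induction rule: smooth_times_flat.induct)
    case (times p k)
    have "ddir v (\<lambda>x. p x * flat k (q x)) = (\<lambda>x. ddir v p x * flat k (q x) + ((p x * ddir v q x) * flat (k + 2) (q x)
         + (- real k * p x * ddir v q x) * flat (k + 1) (q x)))"
      by (rule ext) (rule ddir_eqI[OF D[OF times]])
    then show ?case
      using times assms by (simp only:) (intro smooth_times_flat.intros smooth_mult smooth_ddir; simp)
  next
    case (add f g)
    have "ddir v (\<lambda>x. f x + g x) = (\<lambda>x. ddir v f x + ddir v g x)"
      by (rule ext) (rule ddir_add; rule diff; rule add)
    then show ?case by (simp add: smooth_times_flat.intros add)
  qed
qed

section \<open>Algebra of test functions\<close>

lemma test_funI:
  assumes "smooth \<phi>" "compact C" "C \<subseteq> \<Omega>" "\<And>x. x \<notin> C \<Longrightarrow> \<phi> x = 0"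
  shows "\<phi> \<in> test_fun \<Omega>"
  using assms unfolding test_fun_def test_on_def by blast

lemma test_fun_smooth: "\<phi> \<in> test_fun \<Omega> \<Longrightarrow> smooth \<phi>"
  by (auto simp: test_fun_def test_on_def)

lemma test_fun_support:
  assumes "\<phi> \<in> test_fun \<Omega>"
  obtains C where "compact C" "C \<subseteq> \<Omega>" "\<And>x. x \<notin> C \<Longrightarrow> \<phi> x = 0"
  using assms by (auto simp: test_fun_def test_on_def)

lemma test_fun_mult: "\<phi> \<in> test_fun \<Omega> \<Longrightarrow> smooth p \<Longrightarrow> (\<lambda>x. \<phi> x * p x) \<in> test_fun \<Omega>"
  by (auto simp: test_fun_def test_on_def intro!: smooth_mult)

lemma test_fun_add:
  assumes "\<phi> \<in> test_fun \<Omega>" "\<psi> \<in> test_fun \<Omega>"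
  shows "(\<lambda>x. \<phi> x + \<psi> x) \<in> test_fun \<Omega>"
proof -
  obtain C D where "compact C" "C \<subseteq> \<Omega>" "\<And>x. x \<notin> C \<Longrightarrow> \<phi> x = 0"
    "compact D" "D \<subseteq> \<Omega>" "\<And>x. x \<notin> D \<Longrightarrow> \<psi> x = 0"
    using assms by (metis test_fun_support)
  then show ?thesis
    by (intro test_funI[of _ "C \<union> D"] smooth_add test_fun_smooth[OF assms(1)] test_fun_smooth[OF assms(2)]) auto
qed

lemma test_fun_zero [simp]: "(\<lambda>x. 0) \<in> test_fun \<Omega>"
  by (rule test_funI[of _ "{}"]) auto

lemma test_fun_cmult: "\<phi> \<in> test_fun \<Omega> \<Longrightarrow> (\<lambda>x. c * \<phi> x) \<in> test_fun \<Omega>"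
  using test_fun_mult[of \<phi> \<Omega> "\<lambda>x. c"] by (simp add: mult.commute)

lemma test_fun_sum: "(\<And>i. i \<in> I \<Longrightarrow> f i \<in> test_fun \<Omega>) \<Longrightarrow> (\<lambda>x. \<Sum>i\<in>I. f i x) \<in> test_fun \<Omega>"
  by (induction I rule: infinite_finite_induct) (auto intro: test_fun_add)

section \<open>Positive currents\<close>

text \<open>The algebraic half of \<open>distribution\<close>. It is shared by T and by the current
  of f, so lemmas stated for it apply to their difference as well.\<close>

definition test_linear :: "'a::real_normed_vector set \<Rightarrow> (('a \<Rightarrow> complex) \<Rightarrow> complex) \<Rightarrow> bool" where
  "test_linear \<Omega> u \<longleftrightarrow>
     (\<forall>\<phi>\<in>test_fun \<Omega>. \<forall>\<psi>\<in>test_fun \<Omega>. \<forall>c. u (\<lambda>x. c * \<phi> x + \<psi> x) = c * u \<phi> + u \<psi>)"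

lemma test_linear_add:
  "test_linear \<Omega> u \<Longrightarrow> \<phi> \<in> test_fun \<Omega> \<Longrightarrow> \<psi> \<in> test_fun \<Omega> \<Longrightarrow> u (\<lambda>x. \<phi> x + \<psi> x) = u \<phi> + u \<psi>"
  unfolding test_linear_def by (drule bspec, assumption, drule bspec, assumption, drule spec[of _ 1]) simp

lemma test_linear_zero: "test_linear \<Omega> u \<Longrightarrow> u (\<lambda>x. 0) = 0"
  using test_linear_add[of \<Omega> u "\<lambda>x. 0" "\<lambda>x. 0"] by simp

lemma test_linear_cmult:
  assumes "test_linear \<Omega> u" "\<phi> \<in> test_fun \<Omega>"
  shows "u (\<lambda>x. c * \<phi> x) = c * u \<phi>"
proof -
  have "u (\<lambda>x. c * \<phi> x + 0) = c * u \<phi> + u (\<lambda>x. 0)"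
    using bspec[OF bspec[OF assms(1)[unfolded test_linear_def] assms(2)] test_fun_zero] by simp
  then show ?thesis by (simp add: test_linear_zero[OF assms(1)])
qed

lemma test_linear_sum:
  assumes "test_linear \<Omega> u" "\<And>i. i \<in> I \<Longrightarrow> f i \<in> test_fun \<Omega>"
  shows "u (\<lambda>x. \<Sum>i\<in>I. f i x) = (\<Sum>i\<in>I. u (f i))"
  using assms(2)
  by (induction I rule: infinite_finite_induct)
     (simp_all add: test_linear_zero[OF assms(1)] test_linear_add[OF assms(1)] test_fun_sum)

lemma test_linear_diff_fun:
  "test_linear \<Omega> u \<Longrightarrow> test_linear \<Omega> w \<Longrightarrow> test_linear \<Omega> (\<lambda>\<phi>. u \<phi> - w \<phi>)"
  by (simp add: test_linear_def algebra_simps)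

lemma nonneg_testI:
  assumes "smooth r" "compact C" "C \<subseteq> \<Omega>" "\<And>x. x \<notin> C \<Longrightarrow> r x = 0" "\<And>x. 0 \<le> r x"
  shows "(\<lambda>x. complex_of_real (r x)) \<in> nonneg_test \<Omega>"
  using assms unfolding nonneg_test_def
  by (auto intro!: test_funI[of _ C] smooth_of_real)

lemma nonneg_test_mult:
  assumes "\<psi> \<in> nonneg_test \<Omega>" "smooth r" "\<And>x. \<psi> x \<noteq> 0 \<Longrightarrow> 0 \<le> r x"
  shows "(\<lambda>x. \<psi> x * complex_of_real (r x)) \<in> nonneg_test \<Omega>"
proof -
  have "\<psi> x * complex_of_real (r x) \<in> \<real>\<^sub>\<ge>\<^sub>0" for x
    using assms(1,3) unfolding nonneg_test_def by (cases "\<psi> x = 0") auto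
  then show ?thesis
    using assms(1,2) unfolding nonneg_test_def by (auto intro!: test_fun_mult smooth_of_real)
qed

text \<open>Only the transpositions \<open>(j0 p)\<close> contribute: the vectors \<open>e\<^sub>j - (\<xi>\<^sub>j / \<xi>\<^sub>j\<^sub>0) e\<^sub>j\<^sub>0\<close>
  span the annihilator of \<open>\<xi>\<close>, so their cofactors are proportional to \<open>\<xi>\<close>.\<close>
lemma sum_permutes_annihilator:
  fixes \<xi> :: "complex^'n::finite" and H :: "'n \<Rightarrow> complex"
  assumes "\<xi> $ j0 \<noteq> 0"
  defines "\<beta> \<equiv> \<lambda>j. (\<chi> k. if k = j then 1 else if k = j0 then - \<xi> $ j / \<xi> $ j0 else 0)"
  shows "(\<Sum>\<sigma> | \<sigma> permutes UNIV. of_int (sign \<sigma>) * (\<Prod>j\<in>UNIV - {j0}. \<beta> j $ \<sigma> j) * H (\<sigma> j0))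
    = (\<Sum>p\<in>UNIV. \<xi> $ p / \<xi> $ j0 * H p)"
proof -
  let ?t = "\<lambda>p. Transposition.transpose j0 p :: 'n \<Rightarrow> 'n"
  let ?F = "\<lambda>\<sigma>. of_int (sign \<sigma>) * (\<Prod>j\<in>UNIV - {j0}. \<beta> j $ \<sigma> j) * H (\<sigma> j0)"
  have inj: "inj ?t"
    by (rule injI) (metis transpose_apply_first)
  have zero: "?F \<sigma> = 0" if \<sigma>: "\<sigma> permutes UNIV" and out: "\<sigma> \<notin> range ?t" for \<sigma>
  proof (cases "\<exists>j. j \<noteq> j0 \<and> \<sigma> j \<noteq> j \<and> \<sigma> j \<noteq> j0")
    case True
    then obtain j where j: "j \<noteq> j0" "\<sigma> j \<noteq> j" "\<sigma> j \<noteq> j0" by auto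
    then have "(\<Prod>j\<in>UNIV - {j0}. \<beta> j $ \<sigma> j) = 0"
      by (intro prod_zero) (auto simp: \<beta>_def)
    then show ?thesis by simp
  next
    case False
    have inj\<sigma>: "\<sigma> a = \<sigma> b \<Longrightarrow> a = b" for a b using permutes_inj[OF \<sigma>] by (auto dest: injD)
    have "\<sigma> j = ?t (\<sigma> j0) j" for j
    proof (cases "j = j0 \<or> j = \<sigma> j0")
      case True
      then show ?thesis using False inj\<sigma>[of "\<sigma> j0" j0] by (cases "j = j0") auto
    next
      case nj: False
      have "\<sigma> j \<noteq> j0"
      proof
        assume j: "\<sigma> j = j0"
        have "\<sigma> j0 \<noteq> j0" using inj\<sigma>[of j j0] j nj by metis
        moreover have "\<sigma> (\<sigma> j0) \<noteq> \<sigma> j0" using inj\<sigma>[of "\<sigma> j0" j0] calculation by metis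
        moreover have "\<sigma> (\<sigma> j0) \<noteq> j0" using inj\<sigma>[of "\<sigma> j0" j] j nj by metis
        ultimately show False using False by metis
      qed
      then show ?thesis using False nj by (auto simp: Transposition.transpose_def)
    qed
    then have "\<sigma> = ?t (\<sigma> j0)" by (rule ext)
    with out show ?thesis by (metis rangeI)
  qed
  have val: "?F (?t p) = \<xi> $ p / \<xi> $ j0 * H p" for p
  proof (cases "p = j0")
    case True
    then show ?thesis using assms(1) by (simp add: \<beta>_def)
  next
    case False
    have "(\<Prod>j\<in>UNIV - {j0}. \<beta> j $ ?t p j) = \<beta> p $ j0 * (\<Prod>j\<in>UNIV - {j0} - {p}. \<beta> j $ ?t p j)"
      by (subst prod.remove[of _ p]) (use False in auto)
    also have "(\<Prod>j\<in>UNIV - {j0} - {p}. \<beta> j $ ?t p j) = 1"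
      by (rule prod.neutral) (auto simp: \<beta>_def Transposition.transpose_def)
    finally show ?thesis using False by (simp add: sign_swap_id \<beta>_def)
  qed
  have "(\<Sum>\<sigma> | \<sigma> permutes UNIV. ?F \<sigma>) = (\<Sum>\<sigma>\<in>range ?t. ?F \<sigma>)"
    using zero by (intro sum.mono_neutral_right) (auto simp: permutes_swap_id)
  also have "\<dots> = (\<Sum>p\<in>UNIV. ?F (?t p))"
    by (subst sum.reindex[OF inj]) simp
  finally show ?thesis by (simp only: val)
qed

text \<open>The n - 1 covectors \<open>\<beta>\<close> annihilate \<open>\<xi>\<close>, so their
  cofactor vector is a multiple of \<open>\<xi>\<close> and the wedge product with the current
  collapses to the Hermitian form of its coefficient matrix at \<open>\<xi>\<close>. This turns
  positivity, defined by wedge products, into semidefiniteness.\<close>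

lemma positive_current11_hermitian:
  fixes S :: "'n::finite current11"
  assumes "positive_current11 \<Omega> S" "\<psi> \<in> nonneg_test \<Omega>"
  shows "0 \<le> Re (\<Sum>p\<in>UNIV. \<Sum>q\<in>UNIV. \<xi> $ p * cnj (\<xi> $ q) * (- 2 * \<i> * S p q \<psi>))"
proof (cases "\<xi> = 0")
  case False
  then obtain j0 where j0: "\<xi> $ j0 \<noteq> 0" by (auto simp: vec_eq_iff)
  define \<beta> :: "'n \<Rightarrow> complex^'n" where
    "\<beta> = (\<lambda>j. (\<chi> k. if k = j then 1 else if k = j0 then - \<xi> $ j / \<xi> $ j0 else 0))"
  have \<beta>: "\<beta> j = (\<chi> k. if k = j then 1 else if k = j0 then - \<xi> $ j / \<xi> $ j0 else 0)" for j
    by (simp add: \<beta>_def)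
  note cofactors = sum_permutes_annihilator[OF j0, folded \<beta>]
  let ?P = "{\<sigma>::'n \<Rightarrow> 'n. \<sigma> permutes UNIV}"
  let ?C = "\<lambda>\<sigma>. of_int (sign \<sigma>) * (\<Prod>j\<in>UNIV - {j0}. \<beta> j $ \<sigma> j)"
  let ?n = "CARD('n)"
  have n: "?n = Suc (?n - 1)" by simp
  \<comment> \<open>The volume form gives n factors -2\<i>, the forms \<i> \<beta> wedge its
    conjugate give n - 1 factors \<i>. The one left over is the -2\<i> in the definition of
    \<open>hform\<close>.\<close>
  have c: "(- 2 * \<i>) ^ ?n * \<i> ^ (?n - 1) = 2 ^ (?n - 1) * (- 2 * \<i>)"
  proof -
    have "(- 2 * \<i>) ^ ?n * \<i> ^ (?n - 1) = (- 2 * \<i>) * ((- 2 * \<i>) * \<i>) ^ (?n - 1)"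
      by (subst n) (simp only: power_Suc power_mult_distrib mult_ac)
    also have "(- 2 * \<i>) * \<i> = 2" by (simp add: complex_eq_iff)
    finally show ?thesis by (simp only: mult.commute)
  qed
  have summand: "of_int (sign \<sigma> * sign \<tau>) * (\<Prod>j\<in>UNIV - {j0}. i_beta_betabar (\<beta> j) $ \<sigma> j $ \<tau> j) * S (\<sigma> j0) (\<tau> j0) \<psi>
     = \<i> ^ (?n - 1) * (?C \<sigma> * (cnj (?C \<tau>) * S (\<sigma> j0) (\<tau> j0) \<psi>))" for \<sigma> \<tau>
    by (simp add: i_beta_betabar_def wedge11_def conj_vec_def prod.distrib card_Diff_singleton mult_ac)
  \<comment> \<open>The sum over \<open>\<tau>\<close> has conjugated coefficients, so the cofactor
    formula is applied to conjugated values and the result is conjugated back.\<close>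
  have inner: "(\<Sum>\<tau>\<in>?P. cnj (?C \<tau>) * S p (\<tau> j0) \<psi>) = (\<Sum>q\<in>UNIV. cnj (\<xi> $ q / \<xi> $ j0) * S p q \<psi>)" for p
    using cofactors[of "\<lambda>q. cnj (S p q \<psi>)", THEN arg_cong[where f = cnj]]
    by (simp add: cnj_sum)
  have "wedge_top j0 S (\<lambda>j. i_beta_betabar (\<beta> j)) \<psi>
      = (- 2 * \<i>) ^ ?n * (\<i> ^ (?n - 1) * (\<Sum>\<sigma>\<in>?P. ?C \<sigma> * (\<Sum>\<tau>\<in>?P. cnj (?C \<tau>) * S (\<sigma> j0) (\<tau> j0) \<psi>)))"
    unfolding wedge_top_def summand by (simp only: sum_distrib_left)
  also have "\<dots> = (- 2 * \<i>) ^ ?n * (\<i> ^ (?n - 1) *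
      (\<Sum>\<sigma>\<in>?P. ?C \<sigma> * (\<Sum>q\<in>UNIV. cnj (\<xi> $ q / \<xi> $ j0) * S (\<sigma> j0) q \<psi>)))"
    by (simp only: inner)
  also have "\<dots> = (- 2 * \<i>) ^ ?n * (\<i> ^ (?n - 1) *
      (\<Sum>p\<in>UNIV. \<xi> $ p / \<xi> $ j0 * (\<Sum>q\<in>UNIV. cnj (\<xi> $ q / \<xi> $ j0) * S p q \<psi>)))"
    using cofactors[of "\<lambda>p. (\<Sum>q\<in>UNIV. cnj (\<xi> $ q / \<xi> $ j0) * S p q \<psi>)"]
    by (simp only:)
  also have "\<dots> = 2 ^ (?n - 1) / of_real ((cmod (\<xi> $ j0))\<^sup>2) *
      (\<Sum>p\<in>UNIV. \<Sum>q\<in>UNIV. \<xi> $ p * cnj (\<xi> $ q) * (- 2 * \<i> * S p q \<psi>))"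
    unfolding mult.assoc[symmetric] c complex_norm_square
    by (simp add: sum_distrib_left sum_divide_distrib mult_ac)
  also have "\<dots> = of_real (2 ^ (?n - 1) / (cmod (\<xi> $ j0))\<^sup>2) *
      (\<Sum>p\<in>UNIV. \<Sum>q\<in>UNIV. \<xi> $ p * cnj (\<xi> $ q) * (- 2 * \<i> * S p q \<psi>))" by simp
  finally have eq: "wedge_top j0 S (\<lambda>j. i_beta_betabar (\<beta> j)) \<psi> = \<dots>" .
  have "0 \<le> Re (wedge_top j0 S (\<lambda>j. i_beta_betabar (\<beta> j)) \<psi>)"
    using assms unfolding positive_current11_def nonneg_distribution_def
    by (fastforce simp: complex_nonneg_Reals_iff)
  moreover have "0 < 2 ^ (?n - 1) / (cmod (\<xi> $ j0))\<^sup>2" using j0 by simp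
  ultimately show ?thesis
    unfolding eq by (simp only: times_complex.simps Re_complex_of_real Im_complex_of_real
        mult_zero_left diff_zero zero_le_mult_iff) linarith
qed simp

text \<open>The factor \<open>- 2\<i>\<close> makes the coefficient matrix of a positive current positive semidefinite.\<close>
definition hform :: "'n::finite current11 \<Rightarrow> (complex^'n \<Rightarrow> complex^'n) \<Rightarrow> (complex^'n \<Rightarrow> complex) \<Rightarrow> real" where
  "hform S v \<psi> = Re (\<Sum>p\<in>UNIV. \<Sum>q\<in>UNIV. - 2 * \<i> * S p q (\<lambda>z. \<psi> z * (v z $ p * cnj (v z $ q))))"

lemma hform_test_fun:
  assumes "\<psi> \<in> test_fun \<Omega>" "smooth v"
  shows "(\<lambda>z. \<psi> z * (v z $ p * cnj (v z $ q))) \<in> test_fun \<Omega>"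
  by (intro test_fun_mult assms smooth_mult smooth_cnj smooth_vec_nth)

text \<open>\<open>hform\<close> is quadratic in the field, and here the field varies with
  \<open>i\<close>. Linearity is available only inside \<open>S p q\<close>, where the rank one
  matrices are added pointwise; that is the form in which the Bernstein average can be
  evaluated.\<close>

lemma hform_sum:
  assumes lin: "\<And>p q. test_linear \<Omega> (S p q)"
    and fin: "finite I" and \<psi>: "\<And>i. i \<in> I \<Longrightarrow> \<psi> i \<in> test_fun \<Omega>" and v: "\<And>i. i \<in> I \<Longrightarrow> smooth (v i)"
  shows "(\<Sum>i\<in>I. hform S (v i) (\<psi> i)) = Re (\<Sum>p\<in>UNIV. \<Sum>q\<in>UNIV. - 2 * \<i> *
      S p q (\<lambda>z. \<Sum>i\<in>I. \<psi> i z * (v i z $ p * cnj (v i z $ q))))"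
proof -
  have "S p q (\<lambda>z. \<Sum>i\<in>I. \<psi> i z * (v i z $ p * cnj (v i z $ q)))
      = (\<Sum>i\<in>I. S p q (\<lambda>z. \<psi> i z * (v i z $ p * cnj (v i z $ q))))" for p q
    by (rule test_linear_sum[OF lin]) (auto intro: hform_test_fun \<psi> v)
  then have "(\<Sum>p\<in>UNIV. \<Sum>q\<in>UNIV. - 2 * \<i> *
      S p q (\<lambda>z. \<Sum>i\<in>I. \<psi> i z * (v i z $ p * cnj (v i z $ q))))
    = (\<Sum>p\<in>UNIV. \<Sum>q\<in>UNIV. \<Sum>i\<in>I. - 2 * \<i> * S p q (\<lambda>z. \<psi> i z * (v i z $ p * cnj (v i z $ q))))"
    by (simp only: sum_distrib_left)
  also have "\<dots> = (\<Sum>i\<in>I. \<Sum>p\<in>UNIV. \<Sum>q\<in>UNIV. - 2 * \<i> * S p q (\<lambda>z. \<psi> i z * (v i z $ p * cnj (v i z $ q))))"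
    by (simp only: sum.swap[of _ UNIV I])
  finally show ?thesis by (simp only: hform_def Re_sum)
qed

lemma hform_add:
  assumes lin: "\<And>p q. test_linear \<Omega> (S p q)" and "\<phi> \<in> test_fun \<Omega>" "\<psi> \<in> test_fun \<Omega>" "smooth v"
  shows "hform S v (\<lambda>z. \<phi> z + \<psi> z) = hform S v \<phi> + hform S v \<psi>"
proof -
  have "S p q (\<lambda>z. (\<phi> z + \<psi> z) * (v z $ p * cnj (v z $ q)))
     = S p q (\<lambda>z. \<phi> z * (v z $ p * cnj (v z $ q))) + S p q (\<lambda>z. \<psi> z * (v z $ p * cnj (v z $ q)))" for p q
    unfolding distrib_right
    by (rule test_linear_add[OF lin]) (auto intro: hform_test_fun assms)
  then show ?thesis by (simp only: hform_def distrib_left sum.distrib plus_complex.simps)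
qed

lemma hform_cmult:
  assumes lin: "\<And>p q. test_linear \<Omega> (S p q)" and "\<psi> \<in> test_fun \<Omega>" "smooth v"
  shows "hform S v (\<lambda>z. of_real c * \<psi> z) = c * hform S v \<psi>"
proof -
  have "S p q (\<lambda>z. (of_real c * \<psi> z) * (v z $ p * cnj (v z $ q)))
     = of_real c * S p q (\<lambda>z. \<psi> z * (v z $ p * cnj (v z $ q)))" for p q
    unfolding mult.assoc
    by (rule test_linear_cmult[OF lin]) (auto intro: hform_test_fun assms)
  then have "hform S v (\<lambda>z. of_real c * \<psi> z) = Re (of_real c * (\<Sum>p\<in>UNIV. \<Sum>q\<in>UNIV. - 2 * \<i> *
      S p q (\<lambda>z. \<psi> z * (v z $ p * cnj (v z $ q)))))"
    by (simp only: hform_def sum_distrib_left mult_ac)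
  then show ?thesis by (simp only: hform_def Re_complex_of_real Im_complex_of_real times_complex.simps)
qed

lemma hform_const_nonneg:
  assumes lin: "\<And>p q. test_linear \<Omega> (S p q)" and pos: "positive_current11 \<Omega> S" and \<psi>: "\<psi> \<in> nonneg_test \<Omega>"
  shows "0 \<le> hform S (\<lambda>z. c) \<psi>"
proof -
  have "S p q (\<lambda>z. \<psi> z * (c $ p * cnj (c $ q))) = c $ p * cnj (c $ q) * S p q \<psi>" for p q
    using test_linear_cmult[OF lin, of \<psi> p q "c $ p * cnj (c $ q)"] \<psi>
    by (simp add: nonneg_test_def mult_ac)
  then show ?thesis
    using positive_current11_hermitian[OF pos \<psi>, of c] by (simp add: hform_def mult_ac del: Re_sum)
qed

text \<open>A binomial variable with success probability y, divided by N, has mean y and variance y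
  (1 - y) / N. The 1 / N is what removes the averaging error in the limit.\<close>

lemma Bernstein_variance:
  assumes "N > 0"
  shows "(\<Sum>k\<le>N. Bernstein N k y * ((real k / real N - y))\<^sup>2) = y * (1 - y) / real N"
    "(\<Sum>k\<le>N. Bernstein N k y * (real k / real N - y)) = 0"
proof -
  have N: "real N > 0" using assms by simp
  have "(\<Sum>k\<le>N. Bernstein N k y * (real k / real N - y)) = (\<Sum>k\<le>N. real k * Bernstein N k y) / N - y * (\<Sum>k\<le>N. Bernstein N k y)"
    by (simp add: sum_subtractf sum_divide_distrib sum_distrib_left algebra_simps del: sum_k_Bernstein sum_Bernstein)
  then show "(\<Sum>k\<le>N. Bernstein N k y * (real k / real N - y)) = 0" using N by simp
  have "Bernstein N k y * ((real k / real N - y))\<^sup>2 = (real k * (real k - 1) * Bernstein N k y) / N\<^sup>2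
      + (real k * Bernstein N k y) * (1 / N\<^sup>2 - 2 * y / N) + y\<^sup>2 * Bernstein N k y" for k
    using N by (simp add: field_simps power2_eq_square)
  then have "(\<Sum>k\<le>N. Bernstein N k y * ((real k / real N - y))\<^sup>2) =
     (\<Sum>k\<le>N. real k * (real k - 1) * Bernstein N k y) / N\<^sup>2
      + (\<Sum>k\<le>N. real k * Bernstein N k y) * (1 / N\<^sup>2 - 2 * y / N) + y\<^sup>2 * (\<Sum>k\<le>N. Bernstein N k y)"
    by (simp only: sum.distrib sum_divide_distrib sum_distrib_left sum_distrib_right)
  also have "\<dots> = y * (1 - y) / real N"
    unfolding sum_Bernstein sum_k_Bernstein sum_kk_Bernstein using N by (simp add: field_simps power2_eq_square)
  finally show "(\<Sum>k\<le>N. Bernstein N k y * ((real k / real N - y))\<^sup>2) = y * (1 - y) / real N" .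
qed

text \<open>The matrix is quadratic in the vector. Expanded around the mean \<open>y\<close>, the
  linear terms average out and the variance remains as a multiple of the rank one matrix of
  \<open>b\<close>.\<close>

lemma sum_weighted_rank_one:
  fixes w b :: "complex^'n::finite"
  assumes "finite I" "(\<Sum>i\<in>I. B i) = 1" "(\<Sum>i\<in>I. B i * (x i - y)) = 0"
  shows "(\<Sum>i\<in>I. of_real (B i) * ((w + x i *\<^sub>R b) $ p * cnj ((w + x i *\<^sub>R b) $ q)))
    = (w + y *\<^sub>R b) $ p * cnj ((w + y *\<^sub>R b) $ q)
      + of_real (\<Sum>i\<in>I. B i * (x i - y)\<^sup>2) * (b $ p * cnj (b $ q))"
proof -
  let ?u = "(w + y *\<^sub>R b) $ p" and ?v = "(w + y *\<^sub>R b) $ q"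
  have "of_real (B i) * ((w + x i *\<^sub>R b) $ p * cnj ((w + x i *\<^sub>R b) $ q))
    = of_real (B i) * (?u * cnj ?v)
      + of_real (B i * (x i - y)) * (?u * cnj (b $ q) + b $ p * cnj ?v)
      + of_real (B i * (x i - y)\<^sup>2) * (b $ p * cnj (b $ q))" for i
    by (simp add: scaleR_conv_of_real[where 'a = complex] algebra_simps power2_eq_square)
  then have "(\<Sum>i\<in>I. of_real (B i) * ((w + x i *\<^sub>R b) $ p * cnj ((w + x i *\<^sub>R b) $ q)))
    = of_real (\<Sum>i\<in>I. B i) * (?u * cnj ?v)
      + of_real (\<Sum>i\<in>I. B i * (x i - y)) * (?u * cnj (b $ q) + b $ p * cnj ?v)
      + of_real (\<Sum>i\<in>I. B i * (x i - y)\<^sup>2) * (b $ p * cnj (b $ q))"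
    by (simp only: sum.distrib sum_distrib_right of_real_sum)
  then show ?thesis using assms by simp
qed

lemma smooth_Bernstein: "smooth r \<Longrightarrow> smooth (\<lambda>x. Bernstein N k (r x))"
  unfolding Bernstein_def by (intro smooth_mult smooth_power smooth_diff) auto

text \<open>Replaces the constant vector field of the definition of positivity by an affine one, one real
  coordinate at a time: averaging over Bernstein nodes reproduces the rank one matrix up to a
  variance term of order \<open>1/N\<close>.\<close>
lemma hform_affine_nonneg:
  fixes S :: "'n::finite current11"
  assumes lin: "\<And>p q. test_linear \<Omega> (S p q)" and pos: "positive_current11 \<Omega> S"
    and "finite I" and "\<psi> \<in> nonneg_test \<Omega>"
  shows "0 \<le> hform S (\<lambda>z. c + (\<Sum>b\<in>I. (z \<bullet> b) *\<^sub>R b)) \<psi>"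
  using assms(3,4)
\<comment> \<open>Generalised over \<open>c\<close> and \<open>\<psi>\<close>: freezing the
  coordinate along \<open>b\<close> at a node moves it into the constant part, and the Bernstein
  weight is absorbed into the test function.\<close>
proof (induction I arbitrary: c \<psi> rule: finite_induct)
  case empty
  then show ?case using hform_const_nonneg[OF lin pos] by simp
next
  case (insert b I)
  let ?w = "\<lambda>c z. c + (\<Sum>b\<in>I. (z \<bullet> b) *\<^sub>R b)"
  have smw: "smooth (?w c)" for c
    by (intro smooth_add smooth_sum smooth_scaleR smooth_inner smooth_id smooth_const)
  have t\<psi>: "\<psi> \<in> test_fun \<Omega>" using insert.prems by (simp add: nonneg_test_def)
  obtain C where C: "compact C" "\<And>z. z \<notin> C \<Longrightarrow> \<psi> z = 0" using t\<psi> test_fun_support by metis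
  obtain R where R: "R > 0" "\<And>z. z \<in> C \<Longrightarrow> \<bar>z \<bullet> b\<bar> \<le> R"
  proof -
    have "compact ((\<lambda>z. z \<bullet> b) ` C)" by (intro compact_continuous_image C continuous_intros)
    then obtain R where "R > 0" "\<forall>x\<in>(\<lambda>z. z \<bullet> b) ` C. norm x \<le> R"
      using bounded_pos compact_imp_bounded by metis
    then show ?thesis using that by auto
  qed
  \<comment> \<open>The coordinate along \<open>b\<close>, rescaled so that it lies in [0, 1] on the
    support of \<open>\<psi>\<close>; there the Bernstein weights are nonnegative.\<close>
  define y where "y z = (z \<bullet> b + R) / (2 * R)" for z
  have y: "z \<bullet> b = R * (2 * y z - 1)" for z using R by (simp add: y_def field_simps)
  have smy: "smooth y" unfolding y_def divide_inverse
    by (intro smooth_mult smooth_add smooth_inner smooth_id smooth_const)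
  have y01: "0 \<le> y z" "y z \<le> 1" if "\<psi> z \<noteq> 0" for z
  proof -
    have "\<bar>z \<bullet> b\<bar> \<le> R" using that C R by blast
    then show "0 \<le> y z" "y z \<le> 1" using R by (auto simp: y_def field_simps)
  qed
  define \<theta> where "\<theta> z = \<psi> z * of_real (y z * (1 - y z))" for z
  have t\<theta>: "\<theta> \<in> test_fun \<Omega>" unfolding \<theta>_def
    by (intro test_fun_mult t\<psi> smooth_of_real smooth_mult smooth_diff smy smooth_const)
  let ?Q = "hform S (\<lambda>z. c + (\<Sum>b\<in>insert b I. (z \<bullet> b) *\<^sub>R b)) \<psi>"
  \<comment> \<open>The number multiplied by 1 / N does not itself depend on N, because
    \<open>\<theta>\<close> does not; so the error disappears as N grows.\<close>
  have ge: "0 \<le> ?Q + 4 * R\<^sup>2 / real N * hform S (\<lambda>z. b) \<theta>" if N: "N > 0" for N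
  proof -
    define x where "x k = R * (2 * (real k / real N) - 1)" for k :: nat
    let ?B = "\<lambda>k z. Bernstein N k (y z)"
    let ?\<psi> = "\<lambda>k z. \<psi> z * of_real (?B k z)"
    have smB: "smooth (?B k)" for k by (rule smooth_Bernstein[OF smy])
    have dx: "x k - z \<bullet> b = 2 * R * (real k / real N - y z)" for k z
      unfolding y by (simp add: x_def algebra_simps)
    have avg: "(\<Sum>k\<le>N. of_real (?B k z) * (?w (c + x k *\<^sub>R b) z $ p * cnj (?w (c + x k *\<^sub>R b) z $ q)))
      = (?w c z + (z \<bullet> b) *\<^sub>R b) $ p * cnj ((?w c z + (z \<bullet> b) *\<^sub>R b) $ q)
        + of_real (4 * R\<^sup>2 / real N * (y z * (1 - y z))) * (b $ p * cnj (b $ q))" for z p q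
    proof -
      have "(\<Sum>k\<le>N. ?B k z * (x k - z \<bullet> b)) = 2 * R * (\<Sum>k\<le>N. ?B k z * (real k / real N - y z))"
        unfolding dx by (simp only: sum_distrib_left mult_ac)
      then have 1: "(\<Sum>k\<le>N. ?B k z * (x k - z \<bullet> b)) = 0" using Bernstein_variance[OF N] by simp
      have "(\<Sum>k\<le>N. ?B k z * (x k - z \<bullet> b)\<^sup>2) = 4 * R\<^sup>2 * (\<Sum>k\<le>N. ?B k z * (real k / real N - y z)\<^sup>2)"
        unfolding dx power_mult_distrib by (simp add: sum_distrib_left mult_ac)
      then have 2: "(\<Sum>k\<le>N. ?B k z * (x k - z \<bullet> b)\<^sup>2) = 4 * R\<^sup>2 / real N * (y z * (1 - y z))"
        using Bernstein_variance[OF N] by simp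
      have w: "?w (c + x k *\<^sub>R b) z = ?w c z + x k *\<^sub>R b" for k by simp
      show ?thesis
        unfolding w sum_weighted_rank_one[OF finite_atMost sum_Bernstein 1] 2 ..
    qed
    have "0 \<le> (\<Sum>k\<le>N. hform S (?w (c + x k *\<^sub>R b)) (?\<psi> k))"
    proof (rule sum_nonneg)
      fix k
      have "?\<psi> k \<in> nonneg_test \<Omega>"
        by (rule nonneg_test_mult[OF insert.prems smB]) (auto intro!: Bernstein_nonneg y01)
      then show "0 \<le> hform S (?w (c + x k *\<^sub>R b)) (?\<psi> k)" by (rule insert.IH)
    qed
    also have "\<dots> = Re (\<Sum>p\<in>UNIV. \<Sum>q\<in>UNIV. - 2 * \<i> *
      S p q (\<lambda>z. \<Sum>k\<le>N. ?\<psi> k z * (?w (c + x k *\<^sub>R b) z $ p * cnj (?w (c + x k *\<^sub>R b) z $ q))))"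
      by (rule hform_sum[OF lin]) (auto intro!: test_fun_mult t\<psi> smooth_of_real smB smw)
    also have "\<dots> = ?Q + hform S (\<lambda>z. b) (\<lambda>z. of_real (4 * R\<^sup>2 / real N) * \<theta> z)"
    proof -
      have eq: "(\<lambda>z. \<Sum>k\<le>N. ?\<psi> k z * (?w (c + x k *\<^sub>R b) z $ p * cnj (?w (c + x k *\<^sub>R b) z $ q)))
        = (\<lambda>z. \<psi> z * ((c + (\<Sum>b\<in>insert b I. (z \<bullet> b) *\<^sub>R b)) $ p * cnj ((c + (\<Sum>b\<in>insert b I. (z \<bullet> b) *\<^sub>R b)) $ q))
           + (of_real (4 * R\<^sup>2 / real N) * \<theta> z) * (b $ p * cnj (b $ q)))" for p q
      proof
        fix z
        have w: "c + (\<Sum>b\<in>insert b I. (z \<bullet> b) *\<^sub>R b) = ?w c z + (z \<bullet> b) *\<^sub>R b"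
          using insert.hyps by (simp add: add_ac)
        have "(\<Sum>k\<le>N. ?\<psi> k z * (?w (c + x k *\<^sub>R b) z $ p * cnj (?w (c + x k *\<^sub>R b) z $ q)))
          = \<psi> z * (\<Sum>k\<le>N. of_real (?B k z) * (?w (c + x k *\<^sub>R b) z $ p * cnj (?w (c + x k *\<^sub>R b) z $ q)))"
          by (simp only: sum_distrib_left mult.assoc)
        then show "(\<Sum>k\<le>N. ?\<psi> k z * (?w (c + x k *\<^sub>R b) z $ p * cnj (?w (c + x k *\<^sub>R b) z $ q)))
          = \<psi> z * ((c + (\<Sum>b\<in>insert b I. (z \<bullet> b) *\<^sub>R b)) $ p * cnj ((c + (\<Sum>b\<in>insert b I. (z \<bullet> b) *\<^sub>R b)) $ q))
           + (of_real (4 * R\<^sup>2 / real N) * \<theta> z) * (b $ p * cnj (b $ q))"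
          unfolding avg w by (simp only: \<theta>_def of_real_mult distrib_left mult_ac)
      qed
      have lin2: "S p q (\<lambda>z. \<psi> z * ((c + (\<Sum>b\<in>insert b I. (z \<bullet> b) *\<^sub>R b)) $ p * cnj ((c + (\<Sum>b\<in>insert b I. (z \<bullet> b) *\<^sub>R b)) $ q))
           + (of_real (4 * R\<^sup>2 / real N) * \<theta> z) * (b $ p * cnj (b $ q)))
        = S p q (\<lambda>z. \<psi> z * ((c + (\<Sum>b\<in>insert b I. (z \<bullet> b) *\<^sub>R b)) $ p * cnj ((c + (\<Sum>b\<in>insert b I. (z \<bullet> b) *\<^sub>R b)) $ q)))
          + S p q (\<lambda>z. (of_real (4 * R\<^sup>2 / real N) * \<theta> z) * (b $ p * cnj (b $ q)))" for p q
        by (intro test_linear_add[OF lin] hform_test_fun t\<psi> test_fun_mult test_fun_cmult t\<theta>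
            smooth_add smooth_sum smooth_scaleR smooth_inner smooth_id smooth_const)
      show ?thesis
        unfolding eq lin2 hform_def by (simp only: distrib_left sum.distrib plus_complex.simps)
    qed
    also have "hform S (\<lambda>z. b) (\<lambda>z. of_real (4 * R\<^sup>2 / real N) * \<theta> z) = 4 * R\<^sup>2 / real N * hform S (\<lambda>z. b) \<theta>"
      by (rule hform_cmult[OF lin t\<theta>]) simp
    finally show ?thesis .
  qed
  have "(\<lambda>N. ?Q + 4 * R\<^sup>2 / real N * hform S (\<lambda>z. b) \<theta>) \<longlonglongrightarrow> ?Q + 0 * hform S (\<lambda>z. b) \<theta>"
    by (intro tendsto_intros real_tendsto_divide_at_top[OF tendsto_const] filterlim_real_sequentially)
  moreover have "\<forall>\<^sub>F N in sequentially. 0 \<le> ?Q + 4 * R\<^sup>2 / real N * hform S (\<lambda>z. b) \<theta>"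
    using eventually_gt_at_top[of 0] by eventually_elim (rule ge)
  ultimately have "0 \<le> ?Q + 0 * hform S (\<lambda>z. b) \<theta>"
    by (rule tendsto_lowerbound) simp
  then show ?case by simp
qed

lemma hform_translation_nonneg:
  fixes S :: "'n::finite current11"
  assumes lin: "\<And>p q. test_linear \<Omega> (S p q)" and pos: "positive_current11 \<Omega> S" and "\<psi> \<in> nonneg_test \<Omega>"
  shows "0 \<le> hform S (\<lambda>z. z - a) \<psi>"
proof -
  have "(\<lambda>z. - a + (\<Sum>b\<in>Basis. (z \<bullet> b) *\<^sub>R b)) = (\<lambda>z. z - a)"
    by (simp add: euclidean_representation)
  then show ?thesis
    using hform_affine_nonneg[OF lin pos finite_Basis, of \<psi> "- a"] assms(3) by simp
qed

section \<open>The radial mass of a closed positive current\<close>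

definition ctrace :: "'n::finite current11 \<Rightarrow> (complex^'n \<Rightarrow> complex) \<Rightarrow> real" where
  "ctrace T \<phi> = Re (\<Sum>j\<in>UNIV. - 2 * \<i> * T j j \<phi>)"

lemma positive_diagonal:
  fixes S :: "'n::finite current11"
  assumes "positive_current11 \<Omega> S" "\<psi> \<in> nonneg_test \<Omega>"
  shows "0 \<le> Re (- 2 * \<i> * S j j \<psi>)"
proof -
  have "axis j 1 $ p * cnj (axis j 1 $ q) * (- 2 * \<i> * S p q \<psi>)
      = (if q = j then if p = j then - 2 * \<i> * S j j \<psi> else 0 else 0)" for p q
    by (simp add: axis_def)
  then show ?thesis
    using positive_current11_hermitian[OF assms, of "axis j 1"] by simp
qed

lemma ctrace_nonneg:
  assumes "positive_current11 \<Omega> S" "\<psi> \<in> nonneg_test \<Omega>"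
  shows "0 \<le> ctrace S \<psi>"
  unfolding ctrace_def Re_sum by (intro sum_nonneg positive_diagonal[OF assms])

lemma ctrace_add:
  assumes "\<And>p q. test_linear \<Omega> (S p q)" "\<phi> \<in> test_fun \<Omega>" "\<psi> \<in> test_fun \<Omega>"
  shows "ctrace S (\<lambda>x. \<phi> x + \<psi> x) = ctrace S \<phi> + ctrace S \<psi>"
  unfolding ctrace_def using test_linear_add[OF assms(1-3)]
  by (simp only: distrib_left sum.distrib plus_complex.simps)

lemma ctrace_cmult:
  assumes "\<And>p q. test_linear \<Omega> (S p q)" "\<phi> \<in> test_fun \<Omega>"
  shows "ctrace S (\<lambda>x. of_real c * \<phi> x) = c * ctrace S \<phi>"
proof -
  have "ctrace S (\<lambda>x. of_real c * \<phi> x) = Re (of_real c * (\<Sum>j\<in>UNIV. - 2 * \<i> * S j j \<phi>))"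
    unfolding ctrace_def test_linear_cmult[OF assms] by (simp only: sum_distrib_left mult_ac)
  then show ?thesis by (simp only: ctrace_def Re_complex_of_real Im_complex_of_real times_complex.simps)
qed

text \<open>\<open>T \<and> \<omega>\<^sup>n\<^sup>-\<^sup>1\<close> is \<open>(n - 1)! (2 / \<pi>)\<^sup>n\<^sup>-\<^sup>1\<close> times the trace; one permutation for each
  diagonal entry is enough for a lower bound.\<close>
lemma ctrace_le_wedge_kahler:
  fixes T :: "'n::finite current11"
  assumes pos: "positive_current11 \<Omega> T" "\<psi> \<in> nonneg_test \<Omega>"
  shows "(2 / pi) ^ (CARD('n) - 1) * ctrace T \<psi> \<le> Re (wedge_top j0 T (\<lambda>_. kahler) \<psi>)"
proof -
  let ?P = "{\<sigma>::'n \<Rightarrow> 'n. \<sigma> permutes UNIV}"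
  let ?n = "CARD('n)"
  let ?t = "\<lambda>p. Transposition.transpose j0 p :: 'n \<Rightarrow> 'n"
  have inner: "(\<Sum>\<tau>\<in>?P. of_int (sign \<sigma> * sign \<tau>) * (\<Prod>j\<in>UNIV - {j0}. kahler $ \<sigma> j $ \<tau> j) * T (\<sigma> j0) (\<tau> j0) \<psi>)
     = (\<i> / of_real pi) ^ (?n - 1) * T (\<sigma> j0) (\<sigma> j0) \<psi>" if \<sigma>: "\<sigma> \<in> ?P" for \<sigma>
  proof -
    \<comment> \<open>\<open>kahler\<close> is diagonal, and permutations that agree away from
      \<open>j0\<close> agree everywhere. Hence only \<open>\<tau>\<close> = \<open>\<sigma>\<close>
      survives.\<close>
    have "(\<Prod>j\<in>UNIV - {j0}. kahler $ \<sigma> j $ \<tau> j) = (0::complex)" if \<tau>: "\<tau> \<in> ?P - {\<sigma>}" for \<tau>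
    proof -
      have "\<exists>j. j \<noteq> j0 \<and> \<sigma> j \<noteq> \<tau> j"
      proof (rule ccontr)
        assume "\<nexists>j. j \<noteq> j0 \<and> \<sigma> j \<noteq> \<tau> j"
        then have eq: "\<And>j. j \<noteq> j0 \<Longrightarrow> \<sigma> j = \<tau> j" by blast
        have p: "\<sigma> permutes UNIV" "\<tau> permutes UNIV" using \<sigma> \<tau> by auto
        obtain x where x: "\<tau> x = \<sigma> j0" using permutes_surj[OF p(2)] by (metis surjD)
        have "x = j0"
        proof (rule ccontr)
          assume "x \<noteq> j0"
          then have "\<sigma> x = \<sigma> j0" using eq x by simp
          then show False using \<open>x \<noteq> j0\<close> permutes_inj[OF p(1)] by (metis injD)
        qed
        then have "\<sigma> = \<tau>" using eq x by (metis ext)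
        then show False using \<tau> by simp
      qed
      then show ?thesis by (intro prod_zero) (auto simp: kahler_def)
    qed
    then have "(\<Sum>\<tau>\<in>?P. of_int (sign \<sigma> * sign \<tau>) * (\<Prod>j\<in>UNIV - {j0}. kahler $ \<sigma> j $ \<tau> j) * T (\<sigma> j0) (\<tau> j0) \<psi>)
      = (\<Sum>\<tau>\<in>{\<sigma>}. of_int (sign \<sigma> * sign \<tau>) * (\<Prod>j\<in>UNIV - {j0}. kahler $ \<sigma> j $ \<tau> j) * T (\<sigma> j0) (\<tau> j0) \<psi>)"
      using \<sigma> by (intro sum.mono_neutral_right) auto
    also have "\<dots> = of_int (sign \<sigma> * sign \<sigma>) * (\<Prod>j\<in>UNIV - {j0}. \<i> / of_real pi) * T (\<sigma> j0) (\<sigma> j0) \<psi>"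
      by (simp add: kahler_def)
    also have "sign \<sigma> * sign \<sigma> = 1" by (simp add: sign_def)
    finally show ?thesis by (simp add: card_Diff_singleton)
  qed
  have n: "?n = Suc (?n - 1)" by simp
  have c: "(- 2 * \<i>) ^ ?n * (\<i> / of_real pi) ^ (?n - 1) = of_real ((2 / pi) ^ (?n - 1)) * (- 2 * \<i>)"
  proof -
    have "(- 2 * \<i>) ^ ?n * (\<i> / of_real pi) ^ (?n - 1) = (- 2 * \<i>) * ((- 2 * \<i>) * (\<i> / of_real pi)) ^ (?n - 1)"
      by (subst n) (simp only: power_Suc power_mult_distrib mult_ac)
    also have "(- 2 * \<i>) * (\<i> / of_real pi) = of_real (2 / pi)" by (simp add: complex_eq_iff)
    finally show ?thesis by (simp only: of_real_power mult.commute)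
  qed
  have "wedge_top j0 T (\<lambda>_. kahler) \<psi> = (- 2 * \<i>) ^ ?n * (\<Sum>\<sigma>\<in>?P. (\<i> / of_real pi) ^ (?n - 1) * T (\<sigma> j0) (\<sigma> j0) \<psi>)"
    unfolding wedge_top_def by (intro arg_cong2[where f = "(*)"] sum.cong refl inner)
  also have "\<dots> = ((- 2 * \<i>) ^ ?n * (\<i> / of_real pi) ^ (?n - 1)) * (\<Sum>\<sigma>\<in>?P. T (\<sigma> j0) (\<sigma> j0) \<psi>)"
    by (simp only: sum_distrib_left mult.assoc)
  also have "\<dots> = of_real ((2 / pi) ^ (?n - 1)) * (\<Sum>\<sigma>\<in>?P. - 2 * \<i> * T (\<sigma> j0) (\<sigma> j0) \<psi>)"
    unfolding c by (simp only: sum_distrib_left mult.assoc)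
  finally have w: "Re (wedge_top j0 T (\<lambda>_. kahler) \<psi>)
      = (2 / pi) ^ (?n - 1) * (\<Sum>\<sigma>\<in>?P. Re (- 2 * \<i> * T (\<sigma> j0) (\<sigma> j0) \<psi>))"
    by (simp only: times_complex.simps Re_complex_of_real Im_complex_of_real mult_zero_left diff_zero Re_sum)
  have inj: "inj ?t" by (rule injI) (metis transpose_apply_first)
  have "ctrace T \<psi> = (\<Sum>j\<in>UNIV. Re (- 2 * \<i> * T (?t j j0) (?t j j0) \<psi>))"
    by (simp only: ctrace_def Re_sum transpose_apply_first)
  also have "\<dots> = (\<Sum>\<sigma>\<in>range ?t. Re (- 2 * \<i> * T (\<sigma> j0) (\<sigma> j0) \<psi>))"
    by (simp only: sum.reindex[OF inj] o_def)
  also have "\<dots> \<le> (\<Sum>\<sigma>\<in>?P. Re (- 2 * \<i> * T (\<sigma> j0) (\<sigma> j0) \<psi>))"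
    by (intro sum_mono2 positive_diagonal[OF pos]) (auto intro!: permutes_swap_id)
  finally show ?thesis unfolding w by (intro mult_left_mono) auto
qed

text \<open>\<open>mass\<close> is a supremum over tests bounded by 1, so the test function is
  divided by its bound \<open>B\<close> before the comparison.\<close>

lemma ctrace_le_mass:
  fixes T :: "'n::finite current11"
  assumes lin: "\<And>p q. test_linear \<Omega> (T p q)" and pos: "positive_current11 \<Omega> T"
    and mass: "mass \<Omega> T \<le> ennreal m" "0 \<le> m"
    and \<psi>: "(\<lambda>x. complex_of_real (r x)) \<in> nonneg_test \<Omega>" and B: "\<And>x. r x \<le> B" "0 < B"
  shows "ctrace T (\<lambda>x. complex_of_real (r x)) \<le> (pi / 2) ^ (CARD('n) - 1) * (m * B)"
proof -
  let ?\<psi> = "\<lambda>x. complex_of_real (r x)" and ?j = "SOME j::'n. True"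
  let ?\<phi> = "\<lambda>x. of_real (1 / B) * ?\<psi> x"
  let ?c = "(2 / pi) ^ (CARD('n) - 1)"
  have t: "?\<psi> \<in> test_fun \<Omega>" using \<psi> by (simp add: nonneg_test_def)
  have r0: "0 \<le> r x" for x using \<psi> by (simp add: nonneg_test_def)
  have \<phi>: "?\<phi> \<in> nonneg_test \<Omega>"
    using nonneg_test_mult[OF \<psi>, of "\<lambda>x. 1 / B"] B(2) by (simp add: mult.commute)
  have le1: "\<forall>x. norm (?\<phi> x) \<le> 1" using B r0 by (simp add: norm_mult norm_divide)
  have "ennreal (Re (wedge_top ?j T (\<lambda>_. kahler) ?\<phi>)) \<le> mass \<Omega> T"
    unfolding mass_def total_mass_def by (rule SUP_upper) (use \<phi> le1 in blast)
  then have "Re (wedge_top ?j T (\<lambda>_. kahler) ?\<phi>) \<le> m"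
    using mass by (meson ennreal_le_iff order_trans)
  then have "?c * (1 / B * ctrace T ?\<psi>) \<le> m"
    using ctrace_le_wedge_kahler[OF pos \<phi>, of ?j] ctrace_cmult[OF lin t, where c = "1 / B"] by simp
  then have "(pi / 2) ^ (CARD('n) - 1) * (?c * (1 / B * ctrace T ?\<psi>)) * B \<le> (pi / 2) ^ (CARD('n) - 1) * m * B"
    using B(2) by (intro mult_right_mono mult_left_mono) auto
  moreover have "(pi / 2) ^ (CARD('n) - 1) * ?c = 1"
    by (simp add: power_mult_distrib[symmetric])
  then have "(pi / 2) ^ (CARD('n) - 1) * (?c * (1 / B * ctrace T ?\<psi>)) * B = ctrace T ?\<psi>"
    using B(2) unfolding mult.assoc[symmetric] by simp
  ultimately show ?thesis by (simp add: mult.assoc)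
qed

section \<open>Closedness tested against radial functions\<close>

lemma complex_vec_inner_self:
  fixes w :: "complex^'n::finite"
  shows "(\<Sum>k\<in>UNIV. w $ k * cnj (w $ k)) = of_real (w \<bullet> w)"
  by (simp add: inner_vec_def complex_norm_square[symmetric] dot_square_norm power2_norm_eq_inner[symmetric] del: of_real_power)

text \<open>The hypothesis says that the derivative of \<open>g\<close> is that of a function of |z
  - a|^2, with \<open>g'\<close> the derivative in this variable. The diagonal term comes from
  differentiating the antiholomorphic factor.\<close>

lemma d_zbar_radial:
  fixes g g' :: "complex^'n::finite \<Rightarrow> real"
  assumes D: "\<And>z. (g has_derivative (\<lambda>v. g' z * (2 * ((z - a) \<bullet> v)))) (at z)"
  shows "d_zbar j (\<lambda>z. of_real (g z) * cnj ((z - a) $ k))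
    = (\<lambda>z. of_real (g' z) * ((z - a) $ j * cnj ((z - a) $ k)) + (if j = k then of_real (g z) else 0))"
proof
  fix z
  have "((\<lambda>z. of_real (g z) * cnj ((z - a) $ k)) has_derivative
    (\<lambda>v. of_real (g z) * cnj (v $ k) + of_real (g' z * (2 * ((z - a) \<bullet> v))) * cnj ((z - a) $ k))) (at z)"
  proof -
    have 1: "((\<lambda>z. complex_of_real (g z)) has_derivative (\<lambda>v. of_real (g' z * (2 * ((z - a) \<bullet> v))))) (at z)"
      by (rule bounded_linear.has_derivative[OF bounded_linear_of_real D])
    have "((\<lambda>z. z - a) has_derivative (\<lambda>v. v)) (at z)"
      using has_derivative_diff[OF has_derivative_ident has_derivative_const[of a]] by simp
    from bounded_linear.has_derivative[OF bounded_linear_compose[OF bounded_linear_cnj bounded_linear_vec_nth] this]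
    have 2: "((\<lambda>z. cnj ((z - a) $ k)) has_derivative (\<lambda>v. cnj (v $ k))) (at z)" .
    show ?thesis by (rule has_derivative_mult[OF 1 2])
  qed
  from ddir_eqI[OF this] have dd: "ddir v (\<lambda>z. of_real (g z) * cnj ((z - a) $ k)) z =
     of_real (g z) * cnj (v $ k) + of_real (g' z * (2 * ((z - a) \<bullet> v))) * cnj ((z - a) $ k)" for v .
  have "(z - a) $ j = of_real (Re ((z - a) $ j)) + \<i> * of_real (Im ((z - a) $ j))"
    by (rule complex_eq)
  then show "d_zbar j (\<lambda>z. of_real (g z) * cnj ((z - a) $ k)) z
    = of_real (g' z) * ((z - a) $ j * cnj ((z - a) $ k)) + (if j = k then of_real (g z) else 0)"
    unfolding d_zbar_def dd inner_axis_complex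
    by (auto simp: axis_def field_simps complex_eq_iff)
qed

text \<open>With \<open>\<phi>\<close> k = g times the conjugate of (z - a)_k, closedness exchanges
  indices: T_jj (dbar_k \<phi>_k) = T_jk (dbar_j \<phi>_k). Summed over j and k, the left side
  involves only the trace, while the right side produces the contraction with z - a and one copy of
  the trace of g.\<close>

lemma closed_radial_identity:
  fixes T :: "'n::finite current11" and g g' :: "complex^'n \<Rightarrow> real"
  assumes lin: "\<And>p q. test_linear \<Omega> (T p q)" and closed: "closed_current11 \<Omega> T"
    and g: "(\<lambda>z. complex_of_real (g z)) \<in> test_fun \<Omega>" and g': "(\<lambda>z. complex_of_real (g' z)) \<in> test_fun \<Omega>"
    and D: "\<And>z. (g has_derivative (\<lambda>v. g' z * (2 * ((z - a) \<bullet> v)))) (at z)"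
  shows "ctrace T (\<lambda>z. of_real (g' z * ((z - a) \<bullet> (z - a)) + CARD('n) * g z))
    = hform T (\<lambda>z. z - a) (\<lambda>z. of_real (g' z)) + ctrace T (\<lambda>z. of_real (g z))"
proof -
  have sm: "smooth (\<lambda>z. z - a)" by (intro smooth_diff smooth_id smooth_const)
  let ?\<phi> = "\<lambda>k z. of_real (g z) * cnj ((z - a) $ k)"
  let ?w = "\<lambda>j k z. of_real (g' z) * ((z - a) $ j * cnj ((z - a) $ k))"
  have t\<phi>: "?\<phi> k \<in> test_fun \<Omega>" for k
    by (intro test_fun_mult g smooth_cnj smooth_vec_nth sm)
  have tw: "?w j k \<in> test_fun \<Omega>" for j k by (rule hform_test_fun[OF g' sm])
  have eq: "T j j (d_zbar k (?\<phi> k)) = T j k (d_zbar j (?\<phi> k))" for j k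
    using bspec[OF closed[unfolded closed_current11_def] t\<phi>[of k], THEN spec, THEN spec, THEN spec, of j j k]
    unfolding neg_equal_iff_equal by (rule conjunct2)
  have L: "T j j (d_zbar k (?\<phi> k)) = T j j (\<lambda>z. ?w k k z + of_real (g z))" for j k
    unfolding d_zbar_radial[OF D] by simp
  have R: "T j k (d_zbar j (?\<phi> k)) = T j k (?w j k) + (if j = k then T j j (\<lambda>z. of_real (g z)) else 0)" for j k
    unfolding d_zbar_radial[OF D]
    using test_linear_add[OF lin tw g] by auto
  have "(\<Sum>k\<in>UNIV. T j j (\<lambda>z. ?w k k z + of_real (g z)))
     = T j j (\<lambda>z. of_real (g' z * ((z - a) \<bullet> (z - a)) + CARD('n) * g z))" for j
  proof -
    have "(\<Sum>k\<in>UNIV. T j j (\<lambda>z. ?w k k z + of_real (g z))) = T j j (\<lambda>z. \<Sum>k\<in>UNIV. ?w k k z + of_real (g z))"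
      by (rule test_linear_sum[OF lin, symmetric]) (intro test_fun_add tw g)
    also have "(\<lambda>z. \<Sum>k\<in>UNIV. ?w k k z + of_real (g z)) = (\<lambda>z. of_real (g' z * ((z - a) \<bullet> (z - a)) + CARD('n) * g z))"
      using complex_vec_inner_self[of "_ - a"]
      by (simp add: sum.distrib sum_distrib_left[symmetric] del: vector_minus_component)
    finally show ?thesis .
  qed
  moreover have "(\<Sum>k\<in>UNIV. T j k (?w j k) + (if j = k then T j j (\<lambda>z. of_real (g z)) else 0))
      = (\<Sum>k\<in>UNIV. T j j (\<lambda>z. ?w k k z + of_real (g z)))" for j
    by (rule sum.cong[OF refl]) (rule trans[OF R[symmetric] trans[OF eq[symmetric] L]])
  ultimately have "(\<Sum>j\<in>UNIV. - 2 * \<i> * T j j (\<lambda>z. of_real (g' z * ((z - a) \<bullet> (z - a)) + CARD('n) * g z)))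
     = (\<Sum>j\<in>UNIV. \<Sum>k\<in>UNIV. - 2 * \<i> * (T j k (?w j k) + (if j = k then T j j (\<lambda>z. of_real (g z)) else 0)))"
    by (simp only: sum_distrib_left[symmetric])
  also have "\<dots> = (\<Sum>j\<in>UNIV. \<Sum>k\<in>UNIV. - 2 * \<i> * T j k (?w j k)) + (\<Sum>j\<in>UNIV. - 2 * \<i> * T j j (\<lambda>z. of_real (g z)))"
  proof -
    have "- 2 * \<i> * (if j = k then T j j (\<lambda>z. of_real (g z)) else 0)
      = (if j = k then - 2 * \<i> * T j j (\<lambda>z. of_real (g z)) else 0)" for j k by simp
    then show ?thesis
      by (simp only: distrib_left sum.distrib sum.delta[OF finite] sum.delta'[OF finite] UNIV_I if_True)
  qed
  finally show ?thesis
    unfolding ctrace_def hform_def by (simp only: plus_complex.simps)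
qed

text \<open>The exponent \<open>n\<close> makes the derivative \<open>- n t\<^sup>n\<^sup>-\<^sup>1 flat 2 (R\<^sup>2\<^sup>n - t\<^sup>n)\<close> of this cutoff vanish to
  order \<open>n - 1\<close> at the center, so that it can be multiplied by \<open>t\<^sup>1\<^sup>-\<^sup>n\<close>.\<close>
definition cutoff :: "nat \<Rightarrow> nat \<Rightarrow> real \<Rightarrow> 'a::real_inner \<Rightarrow> 'a \<Rightarrow> real" where
  "cutoff n k R a z = flat k (R ^ (2 * n) - ((z - a) \<bullet> (z - a)) ^ n)"

lemma smooth_inner_self: "smooth (\<lambda>z. (z - a) \<bullet> (z - a))"
  by (intro smooth_inner smooth_diff smooth_id smooth_const)

lemma smooth_cutoff: "smooth (cutoff n k R a)"
  unfolding cutoff_def by (intro smooth_flat smooth_diff smooth_power smooth_const smooth_inner_self)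

lemma cutoff_nonneg: "0 \<le> cutoff n k R a z"
  by (simp add: cutoff_def flat_nonneg)

lemma cutoff_le: "cutoff n k R a z \<le> fact k"
  by (simp add: cutoff_def flat_le)

lemma cutoff_support:
  assumes "0 \<le> R" "cutoff n k R a z \<noteq> 0"
  shows "norm (z - a) < R"
proof (rule ccontr)
  assume "\<not> norm (z - a) < R"
  then have "R ^ (2 * n) \<le> norm (z - a) ^ (2 * n)" using assms(1) by (intro power_mono) auto
  then show False
    using assms(2) by (auto simp: cutoff_def flat_def power_mult dot_square_norm split: if_splits)
qed

lemma smooth_kernel:
  fixes a :: "'a::real_inner"
  assumes "0 < e"
  shows "smooth (\<lambda>z. inverse ((z - a) \<bullet> (z - a) + e) ^ k)"
  using assms by (intro smooth_power smooth_inverse smooth_add smooth_inner_self smooth_const)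
    (smt (verit) inner_ge_zero)

lemma cutoff_nonneg_test:
  fixes a :: "'a::euclidean_space"
  assumes "0 \<le> R" "cball a R \<subseteq> \<Omega>" "smooth p" "\<And>z. 0 \<le> p z"
  shows "(\<lambda>z. complex_of_real (p z * cutoff n k R a z)) \<in> nonneg_test \<Omega>"
proof (rule nonneg_testI[of _ "cball a R"])
  show "p x * cutoff n k R a x = 0" if "x \<notin> cball a R" for x
    using that cutoff_support[OF assms(1), of n k a x] by (auto simp: dist_norm norm_minus_commute)
qed (use assms in \<open>auto intro!: smooth_mult smooth_cutoff mult_nonneg_nonneg cutoff_nonneg\<close>)

lemma inner_self_le:
  assumes "0 \<le> R" "cutoff n k R a z \<noteq> 0"
  shows "(z - a) \<bullet> (z - a) \<le> R\<^sup>2"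
  using cutoff_support[OF assms] by (simp add: dot_square_norm power_mono less_imp_le)

text \<open>The exponent \<open>k\<close> of the kernel is kept apart from the \<open>n\<close> of
  the cutoff: the identity for the current is applied with k = n - 1, the divergence identity for f
  with k = n.\<close>

lemma radial_kernel_has_derivative:
  fixes a :: "'a::real_inner"
  assumes e: "0 < e"
  shows "((\<lambda>z. inverse ((z - a) \<bullet> (z - a) + e) ^ k * cutoff n 0 R a z) has_derivative
    (\<lambda>v. (- (real k * inverse ((z - a) \<bullet> (z - a) + e) ^ (k + 1) * cutoff n 0 R a z)
        - real n * ((z - a) \<bullet> (z - a)) ^ (n - 1) * inverse ((z - a) \<bullet> (z - a) + e) ^ k * cutoff n 2 R a z)
      * (2 * ((z - a) \<bullet> v)))) (at z)"
proof -
  let ?t = "\<lambda>z. (z - a) \<bullet> (z - a)"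
  let ?s = "inverse (?t z + e)"
  have te: "?t z + e \<noteq> 0" using e inner_ge_zero[of "z - a"] by linarith
  have dz: "((\<lambda>z. z - a) has_derivative (\<lambda>v. v)) (at z)"
    using has_derivative_diff[OF has_derivative_ident has_derivative_const[of a]] by simp
  have dt: "(?t has_derivative (\<lambda>v. 2 * ((z - a) \<bullet> v))) (at z)"
    using has_derivative_inner[OF dz dz] by (simp add: inner_commute)
  have "((\<lambda>x. inverse (x + e)) has_real_derivative - (?s * ?s)) (at (?t z))"
    by (rule derivative_eq_intros refl | use te in \<open>simp\<close>)+
  from DERIV_power[OF this, of k]
  have 1: "((\<lambda>x. inverse (x + e) ^ k) has_real_derivative - real k * ?s ^ (k + 1)) (at (?t z))"
    by (rule DERIV_cong) (cases k; simp add: algebra_simps)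
  have "((\<lambda>x. R ^ (2 * n) - x ^ n) has_real_derivative - (real n * ?t z ^ (n - 1))) (at (?t z))"
    by (rule derivative_eq_intros refl | simp)+
  from DERIV_chain2[OF flat_has_derivative this, of 0]
  have 2: "((\<lambda>x. flat 0 (R ^ (2 * n) - x ^ n)) has_real_derivative - real n * ?t z ^ (n - 1) * cutoff n 2 R a z) (at (?t z))"
    by (rule DERIV_cong) (simp add: cutoff_def numeral_2_eq_2)
  have "((\<lambda>x. inverse (x + e) ^ k * flat 0 (R ^ (2 * n) - x ^ n)) has_real_derivative
      - (real k * ?s ^ (k + 1) * cutoff n 0 R a z) - real n * ?t z ^ (n - 1) * ?s ^ k * cutoff n 2 R a z) (at (?t z))"
    by (rule DERIV_cong[OF DERIV_mult[OF 1 2]]) (simp add: cutoff_def algebra_simps)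
  from DERIV_compose_FDERIV[OF this dt] show ?thesis
    by (simp add: cutoff_def mult_ac)
qed

text \<open>The radial identity is applied to g = s^(n-1) X, whose derivative reproduces the wanted
  kernel s^n X with factor n - 1. The traces of g, which are not bounded uniformly in
  \<open>e\<close>, cancel; the terms \<open>h2\<close> and e \<open>h1\<close> have a favourable
  sign. There remains \<open>h3\<close>, produced by the derivative of the cutoff and bounded
  uniformly in \<open>e\<close>.\<close>

lemma radial_kernel_bound:
  fixes T :: "'n::finite current11"
  assumes lin: "\<And>p q. test_linear \<Omega> (T p q)" and closed: "closed_current11 \<Omega> T" and pos: "positive_current11 \<Omega> T"
    and mass: "mass \<Omega> T \<le> ennreal m" "0 \<le> m"
    and R: "0 < R" "R \<le> 1" "cball a R \<subseteq> \<Omega>" and e: "0 < e"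
  shows "hform T (\<lambda>z. z - a)
      (\<lambda>z. of_real (inverse ((z - a) \<bullet> (z - a) + e) ^ CARD('n) * cutoff (CARD('n)) 0 R a z))
    \<le> 2 * CARD('n) * (pi / 2) ^ (CARD('n) - 1) * m"
proof -
  define n where "n = CARD('n)"
  have n1: "1 \<le> n" by (simp add: n_def)
  define t where "t z = (z - a) \<bullet> (z - a)" for z
  define s where "s z = inverse (t z + e)" for z
  have t0: "0 \<le> t z" for z by (simp add: t_def)
  have te: "t z + e > 0" for z using t0[of z] e by simp
  have s0: "0 < s z" for z using te by (simp add: s_def)
  have ts: "t z * s z = 1 - e * s z" for z using te[of z] by (simp add: s_def field_simps)
  have ts1: "0 \<le> t z * s z" "t z * s z \<le> 1" for z using mult_nonneg_nonneg[OF t0 less_imp_le[OF s0], of z z] ts[of z] mult_pos_pos[OF e s0[of z]] by linarith+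
  have smt: "smooth t" unfolding t_def by (rule smooth_inner_self)
  have sms: "smooth s" using smooth_kernel[OF e, of a 1] by (simp add: s_def[abs_def] t_def)
  let ?X = "cutoff n 0 R a" and ?Y = "cutoff n 2 R a"
  have t1: "t z \<le> 1" if "cutoff n k R a z \<noteq> 0" for k z
    using inner_self_le[of R n k a z] that R by (smt (verit) power_le_one_iff t_def zero_le_power2)
  have nn: "(\<lambda>z. complex_of_real (p z * cutoff n k R a z)) \<in> nonneg_test \<Omega>" if "smooth p" "\<And>z. 0 \<le> p z" for p k
    using cutoff_nonneg_test[of R a \<Omega> p n k] that R by simp
  have nnt: "(\<lambda>z. complex_of_real (p z * cutoff n k R a z)) \<in> test_fun \<Omega>" if "smooth p" "\<And>z. 0 \<le> p z" for p k
    using nn[OF that] by (simp add: nonneg_test_def)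
  let ?c = "(pi / 2) ^ (n - 1)"
  have main: "hform T (\<lambda>z. z - a) (\<lambda>z. of_real (s z ^ n * ?X z)) \<le> ?c * (m * (2 * n))"
  \<comment> \<open>For n = 1 the wanted term would carry the factor n - 1 = 0. But then contraction
    with z - a is multiplication by |z - a|^2, and the trace bound applies directly.\<close>
  proof (cases "n = 1")
    case True
    then have "CARD('n) = 1" by (simp add: n_def)
    then obtain j :: 'n where U: "UNIV = {j}" by (rule card_1_singletonE)
    have "(z - a) $ j * cnj ((z - a) $ j) = of_real (t z)" for z
      using complex_vec_inner_self[of "z - a"] by (simp add: U t_def)
    then have "(\<lambda>z. of_real (s z ^ n * ?X z) * ((z - a) $ j * cnj ((z - a) $ j)))
      = (\<lambda>z. complex_of_real ((t z * s z) * ?X z))"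
      using True by (auto simp: mult_ac)
    then have "hform T (\<lambda>z. z - a) (\<lambda>z. of_real (s z ^ n * ?X z)) = ctrace T (\<lambda>z. of_real ((t z * s z) * ?X z))"
      by (simp add: hform_def ctrace_def U)
    also have "\<dots> \<le> (pi / 2) ^ (CARD('n) - 1) * (m * (2 * n))"
    proof (rule ctrace_le_mass[OF lin pos mass])
      show "(\<lambda>x. complex_of_real (t x * s x * ?X x)) \<in> nonneg_test \<Omega>"
        by (rule nn) (use ts1 in \<open>auto intro!: smooth_mult smt sms\<close>)
      fix z
      have "(t z * s z) * ?X z \<le> 1 * 1" using ts1[of z] cutoff_le[of n 0 R a z] cutoff_nonneg[of n 0 R a z]
        by (intro mult_mono) auto
      then show "t z * s z * ?X z \<le> 2 * n" using n1 by linarith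
    qed (use n1 in auto)
    finally show ?thesis by (simp add: n_def)
  next
    case False
    then have "n = Suc (Suc (n - 2))" using n1 by simp
    then obtain k where n2: "n = Suc (Suc k)" by blast
    define g where "g z = s z ^ (n - 1) * ?X z" for z
    define h1 where "h1 z = s z ^ n * ?X z" for z
    define h2 where "h2 z = (t z ^ (n - 1) * s z ^ (n - 1)) * ?Y z" for z
    define h3 where "h3 z = (t z ^ n * s z ^ (n - 1)) * ?Y z" for z
    have nng: "(\<lambda>z. complex_of_real (g z)) \<in> nonneg_test \<Omega>" unfolding g_def
      by (rule nn) (use s0 in \<open>auto intro!: smooth_power sms less_imp_le\<close>)
    have nn1: "(\<lambda>z. complex_of_real (h1 z)) \<in> nonneg_test \<Omega>" unfolding h1_def
      by (rule nn) (use s0 in \<open>auto intro!: smooth_power sms less_imp_le\<close>)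
    have nn2: "(\<lambda>z. complex_of_real (h2 z)) \<in> nonneg_test \<Omega>" unfolding h2_def
      by (rule nn) (intro smooth_mult smooth_power smt sms mult_nonneg_nonneg zero_le_power t0 less_imp_le[OF s0])+
    have nn3: "(\<lambda>z. complex_of_real (h3 z)) \<in> nonneg_test \<Omega>" unfolding h3_def
      by (rule nn) (intro smooth_mult smooth_power smt sms mult_nonneg_nonneg zero_le_power t0 less_imp_le[OF s0])+
    note tf = nng[unfolded nonneg_test_def, simplified, THEN conjunct1]
      nn1[unfolded nonneg_test_def, simplified, THEN conjunct1]
      nn2[unfolded nonneg_test_def, simplified, THEN conjunct1]
      nn3[unfolded nonneg_test_def, simplified, THEN conjunct1]
    define g' where "g' z = - (real (n - 1)) * h1 z + - (real n) * h2 z" for z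
    have g'c: "(\<lambda>z. complex_of_real (g' z)) =
        (\<lambda>z. of_real (- real (n - 1)) * complex_of_real (h1 z) + of_real (- real n) * complex_of_real (h2 z))"
      by (simp add: g'_def)
    have tg': "(\<lambda>z. complex_of_real (g' z)) \<in> test_fun \<Omega>"
      unfolding g'c by (intro test_fun_add test_fun_cmult tf)
    have D: "(g has_derivative (\<lambda>v. g' z * (2 * ((z - a) \<bullet> v)))) (at z)" for z
    proof -
      have "g' z = - (real (n - 1) * s z ^ (n - 1 + 1) * ?X z) - real n * t z ^ (n - 1) * s z ^ (n - 1) * ?Y z"
        using n1 by (simp add: g'_def h1_def h2_def algebra_simps)
      then show ?thesis
        using radial_kernel_has_derivative[OF e, of a "n - 1" n R z]
        by (simp only: g_def[abs_def] s_def t_def)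
    qed
    have smz: "smooth (\<lambda>z. z - a)" by (intro smooth_diff smooth_id smooth_const)
    \<comment> \<open>Uses t s = 1 - e s to replace t s^n by s^(n-1). Since n - (n - 1) = 1, exactly
      one copy of g is left, to cancel against the one on the other side of the radial
      identity.\<close>
    have id: "g' z * t z + n * g z = g z + (real (n - 1) * e) * h1 z + (- real n) * h3 z" for z
    proof -
      have sn: "s z ^ n * t z = s z ^ (n - 1) - e * s z ^ n"
      proof -
        have "s z ^ n = s z ^ (n - 1) * s z" using n1 by (cases n) auto
        then have "s z ^ n * t z = s z ^ (n - 1) * (t z * s z)" by (simp only: mult_ac)
        also have "\<dots> = s z ^ (n - 1) - e * (s z ^ (n - 1) * s z)" unfolding ts by (simp add: algebra_simps)
        finally show ?thesis using \<open>s z ^ n = s z ^ (n - 1) * s z\<close> by simp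
      qed
      have tn: "t z ^ (n - 1) * t z = t z ^ n" using n1 by (cases n) auto
      have "g' z * t z + n * g z = - real (n - 1) * (s z ^ n * t z) * ?X z
          - n * ((t z ^ (n - 1) * t z) * s z ^ (n - 1)) * ?Y z + n * g z"
        by (simp add: g'_def h1_def h2_def algebra_simps)
      also have "\<dots> = g z + (real (n - 1) * e) * h1 z + (- real n) * h3 z"
        unfolding sn tn using n1 by (simp add: g_def h1_def h3_def algebra_simps of_nat_diff)
      finally show ?thesis .
    qed
    have "ctrace T (\<lambda>z. of_real (g' z * t z + n * g z))
       = ctrace T (\<lambda>z. of_real (g z)) + (real (n - 1) * e) * ctrace T (\<lambda>z. of_real (h1 z)) + (- real n) * ctrace T (\<lambda>z. of_real (h3 z))"
      unfolding id of_real_add of_real_mult[of "real (n - 1) * e"] of_real_mult[of "- real n"]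
      by (simp only: ctrace_add[OF lin] ctrace_cmult[OF lin] test_fun_add test_fun_cmult tf)
    moreover have "hform T (\<lambda>z. z - a) (\<lambda>z. of_real (g' z))
       = - real (n - 1) * hform T (\<lambda>z. z - a) (\<lambda>z. of_real (h1 z)) + - real n * hform T (\<lambda>z. z - a) (\<lambda>z. of_real (h2 z))"
      unfolding g'c
      by (simp only: hform_add[OF lin] hform_cmult[OF lin] test_fun_cmult tf smz)
    moreover note closed_radial_identity[OF lin closed tf(1) tg' D, folded t_def n_def]
    moreover have "0 \<le> real n * hform T (\<lambda>z. z - a) (\<lambda>z. of_real (h2 z))"
      using hform_translation_nonneg[OF lin pos nn2] by simp
    moreover have "0 \<le> (real (n - 1) * e) * ctrace T (\<lambda>z. of_real (h1 z))"
      using ctrace_nonneg[OF pos nn1] e by simp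
    moreover have "0 \<le> hform T (\<lambda>z. z - a) (\<lambda>z. of_real (h1 z))"
      using hform_translation_nonneg[OF lin pos nn1] .
    \<comment> \<open>Here n >= 2 enters: the factor n - 1 is at least 1 and the form is
      nonnegative.\<close>
    then have "hform T (\<lambda>z. z - a) (\<lambda>z. of_real (h1 z)) \<le> real (n - 1) * hform T (\<lambda>z. z - a) (\<lambda>z. of_real (h1 z))"
      by (simp add: n2 mult_le_cancel_right1)
    moreover have "ctrace T (\<lambda>z. of_real (h3 z)) \<le> (pi / 2) ^ (CARD('n) - 1) * (m * 2)"
    proof (rule ctrace_le_mass[OF lin pos mass nn3])
      fix z
      \<comment> \<open>The 2 is \<open>fact 2\<close>, from the cutoff of index 2. On its support
        |z - a| is below R <= 1, which controls the factor t not paired with an s.\<close>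
      show "h3 z \<le> 2"
      proof (cases "?Y z = 0")
        case False
        have "(t z ^ n * s z ^ (n - 1)) = t z * (t z * s z) ^ (n - 1)"
          using n1 by (cases n) (auto simp: power_mult_distrib)
        also have "\<dots> \<le> 1 * 1"
          using t1[OF False] ts1[of z] t0[of z] by (intro mult_mono power_le_one) auto
        finally have "h3 z \<le> 1 * fact 2"
          unfolding h3_def using cutoff_le[of n 2 R a z] s0[of z] t0[of z] cutoff_nonneg by (intro mult_mono) auto
        then show ?thesis by simp
      qed (simp add: h3_def)
    qed simp
    then have "real n * ctrace T (\<lambda>z. of_real (h3 z)) \<le> ?c * (m * (2 * n))"
      using mult_left_mono[of "ctrace T (\<lambda>z. of_real (h3 z))" _ "real n"] by (fastforce simp: n_def mult_ac)
    ultimately show ?thesis unfolding h1_def by linarith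
  qed
  then show ?thesis unfolding s_def t_def n_def by (simp add: mult_ac)
qed

section \<open>The energy of a function dominated by a current\<close>

lemma test_fun_bounded:
  assumes "\<phi> \<in> test_fun \<Omega>"
  obtains B where "\<And>x. norm (\<phi> x) \<le> B"
proof -
  obtain C where C: "compact C" "\<And>x. x \<notin> C \<Longrightarrow> \<phi> x = 0" using assms test_fun_support by metis
  have "compact (\<phi> ` C)"
    by (intro compact_continuous_image smooth_continuous test_fun_smooth[OF assms] C)
  then obtain B where B: "0 < B" "\<forall>y\<in>\<phi> ` C. norm y \<le> B" using bounded_pos compact_imp_bounded by metis
  have "norm (\<phi> x) \<le> B" for x using B C(2)[of x] by (cases "x \<in> C") auto
  then show ?thesis by (rule that)
qed

lemma test_fun_borel:
  fixes \<phi> :: "'a::euclidean_space \<Rightarrow> complex"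
  assumes "\<phi> \<in> test_fun \<Omega>"
  shows "\<phi> \<in> borel_measurable borel"
  by (rule borel_measurable_continuous_onI[OF smooth_continuous[OF test_fun_smooth[OF assms]]])

lemma borel_imp_measurable_lebesgue_on:
  fixes f :: "'a::euclidean_space \<Rightarrow> 'b::topological_space"
  assumes "f \<in> borel_measurable borel"
  shows "f \<in> borel_measurable (lebesgue_on S)"
proof -
  have "f \<in> borel_measurable lebesgue" using assms by (intro measurable_completion) simp
  then show ?thesis by (rule measurable_restrict_space1)
qed

lemma integrable_L2_product_test:
  assumes "L2_on \<Omega> u" "L2_on \<Omega> v" "\<phi> \<in> test_fun \<Omega>"
  shows "integrable (lebesgue_on \<Omega>) (\<lambda>z. of_real (u z * v z) * \<phi> z)"
proof -
  obtain B where B: "\<And>x. norm (\<phi> x) \<le> B" using test_fun_bounded[OF assms(3)] by blast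
  have m[measurable]: "u \<in> borel_measurable (lebesgue_on \<Omega>)" "v \<in> borel_measurable (lebesgue_on \<Omega>)"
    "\<phi> \<in> borel_measurable (lebesgue_on \<Omega>)"
    using assms by (auto simp: L2_on_def intro: borel_imp_measurable_lebesgue_on test_fun_borel)
  have i: "integrable (lebesgue_on \<Omega>) (\<lambda>z. ((u z)\<^sup>2 + (v z)\<^sup>2) * B)"
    using assms by (intro integrable_mult_left Bochner_Integration.integrable_add) (auto simp: L2_on_def)
  show ?thesis
  proof (rule Bochner_Integration.integrable_bound[OF i])
    show "AE z in lebesgue_on \<Omega>. norm (of_real (u z * v z) * \<phi> z) \<le> norm (((u z)\<^sup>2 + (v z)\<^sup>2) * B)"
    proof (rule AE_I2)
      fix z
      have "\<bar>u z * v z\<bar> \<le> (u z)\<^sup>2 + (v z)\<^sup>2"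
        using sum_squares_bound[of "\<bar>u z\<bar>" "\<bar>v z\<bar>"] mult_nonneg_nonneg[of "\<bar>u z\<bar>" "\<bar>v z\<bar>"]
        unfolding abs_mult power2_abs by linarith
      then have "\<bar>u z * v z\<bar> * norm (\<phi> z) \<le> ((u z)\<^sup>2 + (v z)\<^sup>2) * B"
        by (intro mult_mono B) auto
      moreover have "norm (of_real (u z * v z) * \<phi> z) = \<bar>u z * v z\<bar> * norm (\<phi> z)"
        by (simp only: norm_mult norm_of_real)
      ultimately show "norm (of_real (u z * v z) * \<phi> z) \<le> norm (((u z)\<^sup>2 + (v z)\<^sup>2) * B)"
        unfolding real_norm_def by linarith
    qed
  qed measurable
qed

lemma weak_deriv_wgrad: "f \<in> W12 \<Omega> \<Longrightarrow> b \<in> Basis \<Longrightarrow> weak_deriv \<Omega> f b (wgrad \<Omega> f b)"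
  using someI_ex[of "weak_deriv \<Omega> f b"] unfolding W12_def wgrad_def by blast

lemma L2_wgrad: "f \<in> W12 \<Omega> \<Longrightarrow> b \<in> Basis \<Longrightarrow> L2_on \<Omega> (wgrad \<Omega> f b)"
  using weak_deriv_wgrad unfolding weak_deriv_def by blast

lemma axis_in_Basis_complex: "axis j 1 \<in> (Basis :: (complex^'n::finite) set)" "axis j \<i> \<in> (Basis :: (complex^'n::finite) set)"
  by (auto simp: Basis_vec_def Basis_complex_def)

lemma sum_Basis_complex_vec:
  "(\<Sum>b\<in>(Basis :: (complex^'n::finite) set). h b) = (\<Sum>j\<in>UNIV. h (axis j 1) + h (axis j \<i>))"
proof -
  have B: "(Basis :: (complex^'n) set) = (\<lambda>(j, u). axis j u) ` (UNIV \<times> {1, \<i>})"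
    by (auto simp: Basis_vec_def Basis_complex_def image_iff)
  have inj: "inj_on (\<lambda>(j::'n, u). axis j u) (UNIV \<times> {1, \<i>})"
    by (auto simp: inj_on_def axis_eq_axis)
  have "(\<Sum>b\<in>(Basis :: (complex^'n) set). h b) = (\<Sum>(j, u)\<in>UNIV \<times> {1, \<i>}. h (axis j u))"
    unfolding B sum.reindex[OF inj] by (simp add: o_def split_def)
  also have "\<dots> = (\<Sum>j\<in>UNIV. \<Sum>u\<in>{1, \<i>}. h (axis j u))"
    by (rule sum.cartesian_product[symmetric])
  also have "\<dots> = (\<Sum>j\<in>UNIV. h (axis j 1) + h (axis j \<i>))"
    by (intro sum.cong refl, subst sum.insert) (auto simp: complex_eq_iff)
  finally show ?thesis .
qed

abbreviation dz_part :: "(complex^'n::finite) set \<Rightarrow> (complex^'n \<Rightarrow> real) \<Rightarrow> complex^'n \<Rightarrow> complex^'n" where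
  "dz_part \<Omega> f z \<equiv> fst (wdiff \<Omega> f z)"

text \<open>For real f the (0,1)-part of df is the conjugate of the (1,0)-part. The two mixed
  products in df wedge d^c f contribute \<i> / (2 pi) each, with the same sign.\<close>

lemma df_wedge_dcf_coeff:
  "wedge11 (wdiff \<Omega> f z) (dc_of (wdiff \<Omega> f z)) $ p $ q = \<i> / of_real pi * (dz_part \<Omega> f z $ p * cnj (dz_part \<Omega> f z $ q))"
  by (simp add: wedge11_def dc_of_def wdiff_def field_simps)

lemma integrable_df_wedge_dcf:
  assumes f: "f \<in> W12 \<Omega>" and \<phi>: "\<phi> \<in> test_fun \<Omega>"
  shows "integrable (lebesgue_on \<Omega>) (\<lambda>z. wedge11 (wdiff \<Omega> f z) (dc_of (wdiff \<Omega> f z)) $ p $ q * \<phi> z)"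
proof -
  let ?x = "\<lambda>j. wgrad \<Omega> f (axis j 1)" and ?y = "\<lambda>j. wgrad \<Omega> f (axis j \<i>)"
  have "(\<lambda>z. wedge11 (wdiff \<Omega> f z) (dc_of (wdiff \<Omega> f z)) $ p $ q * \<phi> z) =
    (\<lambda>z. \<i> / of_real (4 * pi) * (of_real (?x p z * ?x q z) * \<phi> z) + \<i> / of_real (4 * pi) * (of_real (?y p z * ?y q z) * \<phi> z)
      + 1 / of_real (4 * pi) * (of_real (?y p z * ?x q z) * \<phi> z) + (- 1 / of_real (4 * pi)) * (of_real (?x p z * ?y q z) * \<phi> z))"
    unfolding df_wedge_dcf_coeff by (auto simp: wdiff_def field_simps fun_eq_iff)
  moreover have "integrable (lebesgue_on \<Omega>) \<dots>"
    by (intro Bochner_Integration.integrable_add integrable_mult_right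
        integrable_L2_product_test L2_wgrad f axis_in_Basis_complex \<phi>)
  ultimately show ?thesis by simp
qed

lemma test_linear_df_wedge_dcf:
  assumes f: "f \<in> W12 \<Omega>"
  shows "test_linear \<Omega> (df_wedge_dcf \<Omega> f p q)"
proof -
  let ?m = "\<lambda>z. wedge11 (wdiff \<Omega> f z) (dc_of (wdiff \<Omega> f z)) $ p $ q"
  have "(LINT z|lebesgue_on \<Omega>. ?m z * (c * \<phi> z + \<psi> z)) =
     c * (LINT z|lebesgue_on \<Omega>. ?m z * \<phi> z) + (LINT z|lebesgue_on \<Omega>. ?m z * \<psi> z)"
    if "\<phi> \<in> test_fun \<Omega>" "\<psi> \<in> test_fun \<Omega>" for c \<phi> \<psi>
  proof -
    have "(\<lambda>z. ?m z * (c * \<phi> z + \<psi> z)) = (\<lambda>z. c * (?m z * \<phi> z) + ?m z * \<psi> z)"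
      by (simp add: algebra_simps)
    then show ?thesis
      using integrable_df_wedge_dcf[OF f that(1), of p q] integrable_df_wedge_dcf[OF f that(2), of p q] by simp
  qed
  then show ?thesis by (simp add: test_linear_def df_wedge_dcf_def form_current_def)
qed

text \<open>The factor -2\<i> in \<open>hform\<close> meets \<i> / pi, so this form is an integral
  with the density 2 / pi. It will be used with v = z - a for the radial derivative and with
  constant axes for the full gradient.\<close>

lemma hform_df_wedge_dcf:
  fixes f :: "complex^'n::finite \<Rightarrow> real"
  assumes f: "f \<in> W12 \<Omega>" and r: "(\<lambda>z. complex_of_real (r z)) \<in> test_fun \<Omega>" and v: "smooth v"
  shows "hform (df_wedge_dcf \<Omega> f) v (\<lambda>z. of_real (r z))
      = (LINT z|lebesgue_on \<Omega>. 2 / pi * (cmod (\<Sum>p\<in>UNIV. dz_part \<Omega> f z $ p * v z $ p))\<^sup>2 * r z)" (is ?eq)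
    "integrable (lebesgue_on \<Omega>) (\<lambda>z. 2 / pi * (cmod (\<Sum>p\<in>UNIV. dz_part \<Omega> f z $ p * v z $ p))\<^sup>2 * r z)" (is ?int)
proof -
  let ?m = "\<lambda>z p q. wedge11 (wdiff \<Omega> f z) (dc_of (wdiff \<Omega> f z)) $ p $ q * (of_real (r z) * (v z $ p * cnj (v z $ q)))"
  let ?I = "\<lambda>z. 2 / pi * (cmod (\<Sum>p\<in>UNIV. dz_part \<Omega> f z $ p * v z $ p))\<^sup>2 * r z"
  have int: "integrable (lebesgue_on \<Omega>) (\<lambda>z. ?m z p q)" for p q
    by (rule integrable_df_wedge_dcf[OF f hform_test_fun[OF r v]])
  have pt: "(\<Sum>p\<in>UNIV. \<Sum>q\<in>UNIV. - 2 * \<i> * ?m z p q) = of_real (?I z)" for z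
  proof -
    let ?s = "\<lambda>p. dz_part \<Omega> f z $ p * v z $ p"
    have "- 2 * \<i> * ?m z p q = of_real (2 / pi * r z) * (?s p * cnj (?s q))" for p q
      unfolding df_wedge_dcf_coeff by (simp add: field_simps)
    then have "(\<Sum>p\<in>UNIV. \<Sum>q\<in>UNIV. - 2 * \<i> * ?m z p q) = of_real (2 / pi * r z) * ((\<Sum>p\<in>UNIV. ?s p) * cnj (\<Sum>q\<in>UNIV. ?s q))"
      by (simp only: sum_distrib_left[symmetric] sum_distrib_right[symmetric] cnj_sum)
    then show ?thesis
      unfolding complex_norm_square[symmetric] by (simp only: of_real_mult mult_ac)
  qed
  have "integrable (lebesgue_on \<Omega>) (\<lambda>z. \<Sum>p\<in>UNIV. \<Sum>q\<in>UNIV. - 2 * \<i> * ?m z p q)"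
    by (intro Bochner_Integration.integrable_sum integrable_mult_right int)
  then have i2: "integrable (lebesgue_on \<Omega>) (\<lambda>z. complex_of_real (?I z))" by (simp only: pt)
  from integrable_Re[OF this] show ?int by (simp only: Re_complex_of_real)
  have "(\<Sum>p\<in>UNIV. \<Sum>q\<in>UNIV. - 2 * \<i> * (LINT z|lebesgue_on \<Omega>. ?m z p q))
     = (LINT z|lebesgue_on \<Omega>. (\<Sum>p\<in>UNIV. \<Sum>q\<in>UNIV. - 2 * \<i> * ?m z p q))"
    using int by (subst Bochner_Integration.integral_sum, simp)+ simp
  also have "\<dots> = of_real (LINT z|lebesgue_on \<Omega>. ?I z)"
    unfolding pt by (rule integral_complex_of_real)
  finally show ?eq
    unfolding hform_def df_wedge_dcf_def form_current_def by (simp only: Re_complex_of_real)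
qed

lemma hform_diff:
  "hform (\<lambda>j k \<phi>. T j k \<phi> - S j k \<phi>) v \<psi> = hform T v \<psi> - hform S v \<psi>"
  unfolding hform_def by (simp only: right_diff_distrib sum_subtractf minus_complex.simps)

lemma hform_axis:
  assumes lin: "\<And>p q. test_linear \<Omega> (S p q)"
  shows "hform S (\<lambda>z. axis j 1) \<psi> = Re (- 2 * \<i> * S j j \<psi>)"
proof -
  have "- 2 * \<i> * S p q (\<lambda>z. \<psi> z * (axis j 1 $ p * cnj (axis j 1 $ q)))
     = (if q = j then if p = j then - 2 * \<i> * S j j \<psi> else 0 else 0)" for p q
    using test_linear_zero[OF lin] by (auto simp: axis_def)
  then show ?thesis by (simp add: hform_def)
qed

lemma ctrace_eq_hform:
  assumes lin: "\<And>p q. test_linear \<Omega> (S p q)"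
  shows "ctrace S \<psi> = (\<Sum>j\<in>UNIV. hform S (\<lambda>z. axis j 1) \<psi>)"
  by (simp only: ctrace_def Re_sum hform_axis[OF lin])

lemma dz_part_norm:
  "4 * (\<Sum>j\<in>UNIV. (cmod (dz_part \<Omega> f z $ j))\<^sup>2) = (\<Sum>b\<in>Basis. (wgrad \<Omega> f b z)\<^sup>2)"
  unfolding sum_Basis_complex_vec sum_distrib_left
  by (intro sum.cong refl) (simp add: wdiff_def cmod_def power_divide field_simps)

text \<open>The complex contraction contains the derivatives along w and along \<i> w as real and
  imaginary part, up to a factor 2; only the first is kept.\<close>

lemma dz_part_contraction:
  "(\<Sum>b\<in>Basis. wgrad \<Omega> f b z * (w \<bullet> b))\<^sup>2 \<le> 4 * (cmod (\<Sum>p\<in>UNIV. dz_part \<Omega> f z $ p * w $ p))\<^sup>2"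
proof -
  let ?s = "\<Sum>p\<in>UNIV. dz_part \<Omega> f z $ p * w $ p"
  have "(\<Sum>b\<in>Basis. wgrad \<Omega> f b z * (w \<bullet> b)) = 2 * Re ?s"
    unfolding sum_Basis_complex_vec inner_axis_complex Re_sum sum_distrib_left
    by (intro sum.cong refl) (simp add: wdiff_def field_simps)
  moreover have "(Re ?s)\<^sup>2 \<le> (cmod ?s)\<^sup>2" by (simp add: cmod_power2)
  ultimately show ?thesis by (simp add: power_mult_distrib)
qed

text \<open>Comparing T with the current of f on the field z - a moves
  \<open>radial_kernel_bound\<close> to f. The factor 2 pi is 4 divided by 2 / pi, from the passage
  to the real derivative.\<close>

lemma radial_energy_bound:
  fixes f :: "complex^'n::finite \<Rightarrow> real"
  assumes f: "f \<in> W12 \<Omega>" and T: "T \<in> Gamma_f \<Omega> f" and mass: "mass \<Omega> T \<le> ennreal m" "0 \<le> m"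
    and R: "0 < R" "R \<le> 1" "cball a R \<subseteq> \<Omega>" and e: "0 < e"
  defines "w \<equiv> \<lambda>z. (\<Sum>b\<in>Basis. wgrad \<Omega> f b z * ((z - a) \<bullet> b))\<^sup>2 *
      (inverse ((z - a) \<bullet> (z - a) + e) ^ CARD('n) * cutoff (CARD('n)) 0 R a z)"
  shows "integrable (lebesgue_on \<Omega>) w"
    "(LINT z|lebesgue_on \<Omega>. w z) \<le> 2 * pi * (2 * CARD('n) * (pi / 2) ^ (CARD('n) - 1) * m)"
proof -
  let ?r = "\<lambda>z. inverse ((z - a) \<bullet> (z - a) + e) ^ CARD('n) * cutoff (CARD('n)) 0 R a z"
  let ?S = "\<lambda>j k \<phi>. T j k \<phi> - df_wedge_dcf \<Omega> f j k \<phi>"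
  let ?I = "\<lambda>z. 2 / pi * (cmod (\<Sum>p\<in>UNIV. dz_part \<Omega> f z $ p * (z - a) $ p))\<^sup>2 * ?r z"
  have k0: "0 \<le> inverse ((z - a) \<bullet> (z - a) + e) ^ CARD('n)" for z
    using e by (intro zero_le_power) (simp add: add_nonneg_nonneg less_imp_le)
  have r0: "0 \<le> ?r z" for z by (intro mult_nonneg_nonneg k0 cutoff_nonneg)
  have nn: "(\<lambda>z. complex_of_real (?r z)) \<in> nonneg_test \<Omega>"
    by (rule cutoff_nonneg_test) (use R smooth_kernel[OF e] k0 in auto)
  then have t: "(\<lambda>z. complex_of_real (?r z)) \<in> test_fun \<Omega>" by (simp add: nonneg_test_def)
  have linT: "test_linear \<Omega> (T p q)" for p q
    using T unfolding Gamma_f_def is_current11_def distribution_def test_linear_def by blast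
  have sm: "smooth (\<lambda>z. z - a)" by (intro smooth_diff smooth_id smooth_const)
  have "0 \<le> hform ?S (\<lambda>z. z - a) (\<lambda>z. of_real (?r z))"
    using T by (intro hform_translation_nonneg[OF test_linear_diff_fun[OF linT test_linear_df_wedge_dcf[OF f]] _ nn])
      (auto simp: Gamma_f_def)
  then have "hform (df_wedge_dcf \<Omega> f) (\<lambda>z. z - a) (\<lambda>z. of_real (?r z)) \<le> hform T (\<lambda>z. z - a) (\<lambda>z. of_real (?r z))"
    unfolding hform_diff by simp
  also have "\<dots> \<le> 2 * CARD('n) * (pi / 2) ^ (CARD('n) - 1) * m"
    using T by (intro radial_kernel_bound[OF linT _ _ mass R e]) (auto simp: Gamma_f_def)
  finally have le: "(LINT z|lebesgue_on \<Omega>. ?I z) \<le> 2 * CARD('n) * (pi / 2) ^ (CARD('n) - 1) * m"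
    unfolding hform_df_wedge_dcf(1)[OF f t sm] .
  have int: "integrable (lebesgue_on \<Omega>) ?I" by (rule hform_df_wedge_dcf(2)[OF f t sm])
  have w0: "0 \<le> w z" for z unfolding w_def by (intro mult_nonneg_nonneg[OF _ r0]) simp
  have wI: "w z \<le> 2 * pi * ?I z" for z
  proof -
    have "w z \<le> 4 * (cmod (\<Sum>p\<in>UNIV. dz_part \<Omega> f z $ p * (z - a) $ p))\<^sup>2 * ?r z"
      unfolding w_def by (intro mult_right_mono[OF _ r0] dz_part_contraction)
    also have "\<dots> = 2 * pi * ?I z" by simp
    finally show ?thesis .
  qed
  have "w \<in> borel_measurable (lebesgue_on \<Omega>)"
  proof -
    have [measurable]: "wgrad \<Omega> f b \<in> borel_measurable (lebesgue_on \<Omega>)" if "b \<in> Basis" for b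
      using L2_wgrad[OF f that] by (simp add: L2_on_def)
    have "(\<lambda>z. inverse ((z - a) \<bullet> (z - a) + e) ^ CARD('n) * cutoff (CARD('n)) 0 R a z) \<in> borel_measurable (lebesgue_on \<Omega>)"
      by (intro borel_imp_measurable_lebesgue_on borel_measurable_continuous_onI smooth_continuous smooth_mult
          smooth_kernel[OF e] smooth_cutoff)
    moreover have "(\<lambda>z. (z - a) \<bullet> b) \<in> borel_measurable (lebesgue_on \<Omega>)" for b
      by (intro borel_imp_measurable_lebesgue_on) measurable
    ultimately show ?thesis unfolding w_def
      by (intro borel_measurable_times[of "\<lambda>z. (_ z)\<^sup>2"] borel_measurable_power borel_measurable_sum
          borel_measurable_times[of "wgrad _ _ _"]) auto
  qed
  then show "integrable (lebesgue_on \<Omega>) w"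
  proof (rule Bochner_Integration.integrable_bound[OF integrable_mult_right[OF int, of "2 * pi"]])
    show "AE z in lebesgue_on \<Omega>. norm (w z) \<le> norm (2 * pi * ?I z)"
      using w0 order_trans[OF wI abs_ge_self] by (intro AE_I2) (simp only: real_norm_def abs_of_nonneg)
  qed
  then have "(LINT z|lebesgue_on \<Omega>. w z) \<le> (LINT z|lebesgue_on \<Omega>. 2 * pi * ?I z)"
    by (intro integral_mono wI integrable_mult_right[OF int])
  also have "\<dots> = 2 * pi * (LINT z|lebesgue_on \<Omega>. ?I z)" by (rule integral_mult_right_zero)
  also have "\<dots> \<le> 2 * pi * (2 * CARD('n) * (pi / 2) ^ (CARD('n) - 1) * m)"
    using le by (intro mult_left_mono) auto
  finally show "(LINT z|lebesgue_on \<Omega>. w z) \<le> 2 * pi * (2 * CARD('n) * (pi / 2) ^ (CARD('n) - 1) * m)" .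
qed

text \<open>The same comparison on the coordinate axes, that is, through the trace. No weight is
  singular here, so boundedness of the cutoff by 1 is enough and closedness does not enter.\<close>

lemma local_energy_bound:
  fixes f :: "complex^'n::finite \<Rightarrow> real"
  assumes f: "f \<in> W12 \<Omega>" and T: "T \<in> Gamma_f \<Omega> f" and mass: "mass \<Omega> T \<le> ennreal m" "0 \<le> m"
    and R: "0 \<le> R" "cball a R \<subseteq> \<Omega>"
  shows "integrable (lebesgue_on \<Omega>) (\<lambda>z. (\<Sum>b\<in>Basis. (wgrad \<Omega> f b z)\<^sup>2) * cutoff (CARD('n)) 0 R a z)"
    and "(LINT z|lebesgue_on \<Omega>. (\<Sum>b\<in>Basis. (wgrad \<Omega> f b z)\<^sup>2) * cutoff (CARD('n)) 0 R a z)
    \<le> 2 * pi * ((pi / 2) ^ (CARD('n) - 1) * m)"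
proof -
  let ?r = "cutoff (CARD('n)) 0 R a"
  let ?S = "\<lambda>j k \<phi>. T j k \<phi> - df_wedge_dcf \<Omega> f j k \<phi>"
  have nn: "(\<lambda>z. complex_of_real (?r z)) \<in> nonneg_test \<Omega>"
    using cutoff_nonneg_test[of R a \<Omega> "\<lambda>z. 1"] R by simp
  then have t: "(\<lambda>z. complex_of_real (?r z)) \<in> test_fun \<Omega>" by (simp add: nonneg_test_def)
  have linT: "test_linear \<Omega> (T p q)" for p q
    using T unfolding Gamma_f_def is_current11_def distribution_def test_linear_def by blast
  note lindf = test_linear_df_wedge_dcf[OF f]
  have "0 \<le> ctrace ?S (\<lambda>z. of_real (?r z))"
    using T by (intro ctrace_nonneg[OF _ nn]) (auto simp: Gamma_f_def)
  then have "ctrace (df_wedge_dcf \<Omega> f) (\<lambda>z. of_real (?r z)) \<le> ctrace T (\<lambda>z. of_real (?r z))"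
    by (simp only: ctrace_def right_diff_distrib sum_subtractf minus_complex.simps)
  also have "\<dots> \<le> (pi / 2) ^ (CARD('n) - 1) * (m * 1)"
    using T cutoff_le[of "CARD('n)" 0 R a] by (intro ctrace_le_mass[OF linT _ mass nn]) (auto simp: Gamma_f_def)
  finally have le: "ctrace (df_wedge_dcf \<Omega> f) (\<lambda>z. of_real (?r z)) \<le> (pi / 2) ^ (CARD('n) - 1) * m" by simp
  have ax: "(\<Sum>p\<in>UNIV. dz_part \<Omega> f z $ p * axis j 1 $ p) = dz_part \<Omega> f z $ j" for z j
  proof -
    have "dz_part \<Omega> f z $ p * axis j 1 $ p = (if p = j then dz_part \<Omega> f z $ p else 0)" for p
      by (simp add: axis_def)
    then show ?thesis by (simp only: sum.delta[OF finite] UNIV_I if_True)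
  qed
  have h: "hform (df_wedge_dcf \<Omega> f) (\<lambda>z. axis j 1) (\<lambda>z. of_real (?r z))
      = (LINT z|lebesgue_on \<Omega>. 2 / pi * (cmod (dz_part \<Omega> f z $ j))\<^sup>2 * ?r z)"
    "integrable (lebesgue_on \<Omega>) (\<lambda>z. 2 / pi * (cmod (dz_part \<Omega> f z $ j))\<^sup>2 * ?r z)" for j
    using hform_df_wedge_dcf[OF f t smooth_const[of "axis j 1"]] unfolding ax by auto
  have eq: "(\<lambda>z. \<Sum>j\<in>UNIV. 2 / pi * (cmod (dz_part \<Omega> f z $ j))\<^sup>2 * ?r z)
      = (\<lambda>z. 1 / (2 * pi) * ((\<Sum>b\<in>Basis. (wgrad \<Omega> f b z)\<^sup>2) * ?r z))"
    unfolding dz_part_norm[symmetric] sum_distrib_left[symmetric] sum_distrib_right[symmetric] by auto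
  have "integrable (lebesgue_on \<Omega>) (\<lambda>z. \<Sum>j\<in>UNIV. 2 / pi * (cmod (dz_part \<Omega> f z $ j))\<^sup>2 * ?r z)"
    by (intro Bochner_Integration.integrable_sum h(2))
  from integrable_mult_right[OF this[unfolded eq], of "2 * pi"]
  show "integrable (lebesgue_on \<Omega>) (\<lambda>z. (\<Sum>b\<in>Basis. (wgrad \<Omega> f b z)\<^sup>2) * ?r z)"
    by simp
  have "ctrace (df_wedge_dcf \<Omega> f) (\<lambda>z. of_real (?r z))
      = (\<Sum>j\<in>UNIV. (LINT z|lebesgue_on \<Omega>. 2 / pi * (cmod (dz_part \<Omega> f z $ j))\<^sup>2 * ?r z))"
    unfolding ctrace_eq_hform[OF lindf] by (simp only: h(1))
  also have "\<dots> = (LINT z|lebesgue_on \<Omega>. (\<Sum>j\<in>UNIV. 2 / pi * (cmod (dz_part \<Omega> f z $ j))\<^sup>2 * ?r z))"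
    by (rule Bochner_Integration.integral_sum[symmetric]) (rule h(2))
  also note eq
  also have "(LINT z|lebesgue_on \<Omega>. 1 / (2 * pi) * ((\<Sum>b\<in>Basis. (wgrad \<Omega> f b z)\<^sup>2) * ?r z))
      = 1 / (2 * pi) * (LINT z|lebesgue_on \<Omega>. (\<Sum>b\<in>Basis. (wgrad \<Omega> f b z)\<^sup>2) * ?r z)"
    by (rule integral_mult_right_zero)
  finally have "(LINT z|lebesgue_on \<Omega>. (\<Sum>b\<in>Basis. (wgrad \<Omega> f b z)\<^sup>2) * ?r z)
      = 2 * pi * ctrace (df_wedge_dcf \<Omega> f) (\<lambda>z. of_real (?r z))" by simp
  also have "\<dots> \<le> 2 * pi * ((pi / 2) ^ (CARD('n) - 1) * m)"
    by (intro mult_left_mono le) auto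
  finally show "(LINT z|lebesgue_on \<Omega>. (\<Sum>b\<in>Basis. (wgrad \<Omega> f b z)\<^sup>2) * ?r z)
    \<le> 2 * pi * ((pi / 2) ^ (CARD('n) - 1) * m)" .
qed

section \<open>Kernels\<close>

lemma powr_shell_bound:
  fixes r :: real
  assumes "0 < r" "r < 1" "0 \<le> p"
  obtains k :: nat where "r < 2 powr (- real k)" "r powr (- p) \<le> 2 powr (p * (real k + 1))"
proof -
  have l: "log 2 r < 0" using assms by simp
  \<comment> \<open>Subtracting 1 from the ceiling makes r < 2^(-k) strict, as membership in an open
    ball demands; the difference is nonnegative because r < 1.\<close>
  define k where "k = nat (\<lceil>- log 2 r\<rceil> - 1)"
  have k1: "real k < - log 2 r" "- log 2 r \<le> real k + 1"
  proof -
    have "1 \<le> \<lceil>- log 2 r\<rceil>" using l by linarith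
    then have "real k = of_int \<lceil>- log 2 r\<rceil> - 1" by (simp add: k_def)
    then show "real k < - log 2 r" "- log 2 r \<le> real k + 1" by linarith+
  qed
  have r: "r = 2 powr (log 2 r)" using assms by simp
  show ?thesis
  proof (rule that[of k])
    have "2 powr (log 2 r) < 2 powr (- real k)" using k1 by (intro powr_less_mono) auto
    then show "r < 2 powr (- real k)" using r by simp
    have "r powr (- p) = 2 powr (p * (- log 2 r))"
      by (subst r) (simp add: powr_powr mult.commute)
    also have "\<dots> \<le> 2 powr (p * (real k + 1))" using k1 assms by (intro powr_mono mult_left_mono) auto
    finally show "r powr (- p) \<le> 2 powr (p * (real k + 1))" .
  qed
qed

text \<open>A bound for the dyadic series: its k-th term is at most the unit ball volume times 4^n
  2^(-\<gamma> k), and 1 / (1 - 2^(-\<gamma>)) is at most 2 / (\<gamma> ln 2).\<close>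

definition riesz_const :: "nat \<Rightarrow> real" where
  "riesz_const n = unit_ball_vol (real (2 * n)) * 4 ^ n * (2 / ln 2)"

lemma riesz_const_pos: "0 < riesz_const n"
  by (simp add: riesz_const_def)

text \<open>Dyadic balls replace polar coordinates: the k-th term alone dominates the integrand on
  shell k. The rate 1 / \<open>\<gamma>\<close> is the point, since \<open>\<gamma>\<close> will be
  taken of order 1 / log (1 / \<delta>).\<close>

lemma nn_integral_norm_powr_ball:
  assumes dim: "DIM('a::euclidean_space) = 2 * n" and g: "0 < \<gamma>" "\<gamma> \<le> 1"
  shows "(\<integral>\<^sup>+y. ennreal (indicator (ball 0 1) y * norm y powr (\<gamma> - 2 * real n)) \<partial>(lborel :: 'a measure))
    \<le> ennreal (riesz_const n / \<gamma>)"
proof -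
  have n1: "1 \<le> n" using dim DIM_positive[where 'a='a] by linarith
  define p where "p = 2 * real n - \<gamma>"
  have p: "0 \<le> p" using g n1 by (simp add: p_def)
  define c where "c k = 2 powr (p * (real k + 1))" for k :: nat
  define V where "V = unit_ball_vol (real (2 * n))"
  have V: "0 < V" by (simp add: V_def)
  let ?B = "\<lambda>k::nat. ball (0::'a) (2 powr (- real k))"
  let ?r = "2 powr (- \<gamma>)"
  have pt: "ennreal (indicator (ball 0 1) y * norm y powr (\<gamma> - 2 * real n)) \<le> (\<Sum>k. ennreal (c k) * indicator (?B k) y)" for y :: 'a
  proof (cases "y \<in> ball 0 1 \<and> y \<noteq> 0")
    case True
    then obtain k where k: "norm y < 2 powr (- real k)" "norm y powr (- p) \<le> 2 powr (p * (real k + 1))"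
      using powr_shell_bound[of "norm y" p] p by auto
    have "ennreal (indicator (ball 0 1) y * norm y powr (\<gamma> - 2 * real n)) \<le> ennreal (c k) * indicator (?B k) y"
      using True k by (simp add: c_def p_def indicator_def ennreal_leI)
    also have "\<dots> = (\<Sum>i\<in>{k}. ennreal (c i) * indicator (?B i) y)"
      by (simp only: sum.insert finite.emptyI empty_iff not_False_eq_True sum.empty add_0_right)
    also have "\<dots> \<le> (\<Sum>k. ennreal (c k) * indicator (?B k) y)" by (rule sum_le_suminf) auto
    finally show ?thesis .
  qed (auto simp: indicator_def)
  have summand: "(\<integral>\<^sup>+y. ennreal (c k) * indicator (?B k) y \<partial>(lborel :: 'a measure)) = ennreal (V * 2 powr p * ?r ^ k)" for k
  proof -
    have "(\<integral>\<^sup>+y. ennreal (c k) * indicator (?B k) y \<partial>(lborel :: 'a measure)) = ennreal (c k) * emeasure lborel (?B k)"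
      by (rule nn_integral_cmult_indicator) simp
    also have "emeasure lborel (?B k) = ennreal (V * (2 powr (- real k)) ^ (2 * n))"
      unfolding V_def dim[symmetric] by (rule emeasure_ball) simp
    also have "ennreal (c k) * ennreal (V * (2 powr (- real k)) ^ (2 * n)) = ennreal (c k * (V * (2 powr (- real k)) ^ (2 * n)))"
      using V by (intro ennreal_mult[symmetric]) (auto simp: c_def)
    also have "c k * (V * (2 powr (- real k)) ^ (2 * n)) = V * 2 powr p * ?r ^ k"
    proof -
      have "(2 powr (- real k)) ^ (2 * n) = (2 powr (- real k)) powr real (2 * n)"
        by (rule powr_realpow[symmetric]) simp
      then have 1: "(2 powr (- real k)) ^ (2 * n) = 2 powr (- real k * real (2 * n))" by (simp only: powr_powr)
      have "?r ^ k = ?r powr real k" by (rule powr_realpow[symmetric]) simp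
      then have 2: "?r ^ k = 2 powr (- \<gamma> * real k)" by (simp only: powr_powr)
      have "p * (real k + 1) + - real k * real (2 * n) = p + - \<gamma> * real k"
        by (simp add: p_def algebra_simps)
      then have "2 powr (p * (real k + 1)) * 2 powr (- real k * real (2 * n)) = 2 powr p * 2 powr (- \<gamma> * real k)"
        by (simp only: powr_add[symmetric])
      then show ?thesis unfolding 1 2 c_def by (simp only: mult_ac)
    qed
    finally show ?thesis .
  qed
  have r: "0 < ?r" "?r < 1" using g powr_less_mono[of "- \<gamma>" 0 2] by auto
  have "(\<integral>\<^sup>+y. ennreal (indicator (ball 0 1) y * norm y powr (\<gamma> - 2 * real n)) \<partial>(lborel :: 'a measure))
     \<le> (\<integral>\<^sup>+y. (\<Sum>k. ennreal (c k) * indicator (?B k) y) \<partial>lborel)"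
    by (intro nn_integral_mono pt)
  also have "\<dots> = (\<Sum>k. ennreal (V * 2 powr p * ?r ^ k))"
    by (subst nn_integral_suminf)
      (auto simp only: summand measurable_lborel2 intro!: borel_measurable_times_ennreal borel_measurable_const
        borel_measurable_indicator borel_open open_ball)
  also have "\<dots> = ennreal (\<Sum>k. V * 2 powr p * ?r ^ k)"
    using V r by (intro suminf_ennreal2 summable_mult summable_geometric) auto
  also have "(\<Sum>k. V * 2 powr p * ?r ^ k) = V * 2 powr p / (1 - ?r)"
    using r by (subst suminf_mult) (auto simp: suminf_geometric summable_geometric)
  also have "\<dots> \<le> riesz_const n / \<gamma>"
  proof -
    have "1 + \<gamma> * ln 2 \<le> exp (\<gamma> * ln 2)" by (rule exp_ge_add_one_self)
    then have "?r \<le> inverse (1 + \<gamma> * ln 2)"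
      using g by (simp add: powr_def exp_minus le_imp_inverse_le add_pos_pos)
    moreover have "inverse (1 + \<gamma> * ln 2) \<le> 1 - \<gamma> * ln 2 / 2"
    proof -
      define x where "x = \<gamma> * ln 2"
      have x: "0 \<le> x" "x \<le> 1" using g ln_2_less_1 mult_le_one[of \<gamma> "ln 2"] by (auto simp: x_def)
      have "1 \<le> (1 - x / 2) * (1 + x)" using mult_left_mono[OF x(2,1)] by (simp add: algebra_simps)
      then have "1 / (1 + x) \<le> 1 - x / 2" using x by (subst pos_divide_le_eq) auto
      then show ?thesis by (simp add: x_def inverse_eq_divide)
    qed
    ultimately have "\<gamma> * ln 2 / 2 \<le> 1 - ?r" by linarith
    moreover have "2 powr p \<le> 4 ^ n"
    proof -
      have "2 powr p \<le> 2 powr (2 * real n)" using g by (intro powr_mono) (auto simp: p_def)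
      also have "\<dots> = 4 ^ n" by (simp add: powr_powr[symmetric] powr_realpow)
      finally show ?thesis .
    qed
    ultimately have "V * 2 powr p / (1 - ?r) \<le> V * 4 ^ n / (\<gamma> * ln 2 / 2)"
      using V g r by (intro frac_le mult_left_mono) auto
    then show ?thesis by (simp add: riesz_const_def V_def field_simps)
  qed
  finally show ?thesis using ennreal_leI by blast
qed

text \<open>The three kernels belong together: in real dimension 2n the divergence of y W(y) is P -
  Q. P concentrates at scale sqrt e, while Q stems from differentiating the cutoff and stays bounded
  as e tends to 0.\<close>

definition Wker :: "nat \<Rightarrow> real \<Rightarrow> real \<Rightarrow> 'a::euclidean_space \<Rightarrow> real" where
  "Wker n R e y = inverse (y \<bullet> y + e) ^ n * cutoff n 0 R 0 y"

definition Pker :: "nat \<Rightarrow> real \<Rightarrow> real \<Rightarrow> 'a::euclidean_space \<Rightarrow> real" where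
  "Pker n R e y = 2 * real n * e * inverse (y \<bullet> y + e) ^ (n + 1) * cutoff n 0 R 0 y"

definition Qker :: "nat \<Rightarrow> real \<Rightarrow> real \<Rightarrow> 'a::euclidean_space \<Rightarrow> real" where
  "Qker n R e y = 2 * real n * ((y \<bullet> y) ^ n * inverse (y \<bullet> y + e) ^ n * cutoff n 2 R 0 y)"

section \<open>Regularity and elementary bounds of the kernels\<close>

lemma cutoff_translate: "cutoff n k R 0 (z - a) = cutoff n k R a z"
  by (simp add: cutoff_def)

lemma continuous_kernels:
  fixes S :: "'a::euclidean_space set"
  assumes "0 < e"
  shows "continuous_on S (Wker n R e)" "continuous_on S (Pker n R e)" "continuous_on S (Qker n R e)"
proof -
  have 1: "continuous_on S (\<lambda>y::'a. inverse (y \<bullet> y + e))"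
    using assms by (intro continuous_intros) (smt (verit) inner_ge_zero)
  have 2: "continuous_on S (cutoff n k R (0::'a))" for k
    by (rule smooth_continuous[OF smooth_cutoff])
  show "continuous_on S (Wker n R e)" "continuous_on S (Pker n R e)" "continuous_on S (Qker n R e)"
    unfolding Wker_def Pker_def Qker_def by (intro continuous_intros 1 2)+
qed

lemma borel_kernels [measurable]:
  assumes "0 < e"
  shows "Wker n R e \<in> borel_measurable borel" "Pker n R e \<in> borel_measurable borel" "Qker n R e \<in> borel_measurable borel"
  by (rule borel_measurable_continuous_onI, rule continuous_kernels[OF assms])+

lemma kernels_nonneg:
  assumes "0 \<le> e"
  shows "0 \<le> Wker n R e y" "0 \<le> Pker n R e y" "0 \<le> Qker n R e y"
  using assms unfolding Wker_def Pker_def Qker_def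
  by (auto intro!: mult_nonneg_nonneg cutoff_nonneg zero_le_power add_nonneg_nonneg)

lemma kernels_support:
  assumes "0 \<le> R" "R \<le> norm y"
  shows "Wker n R e y = 0" "Pker n R e y = 0" "Qker n R e y = 0"
  using cutoff_support[OF assms(1), of n _ 0 y] assms unfolding Wker_def Pker_def Qker_def by fastforce+

text \<open>The bounds for W and P degenerate as e tends to 0 and serve integrability; the one for Q
  is uniform in e and enters the final constant.\<close>

lemma kernels_upper:
  assumes "0 < e"
  shows "Wker n R e y \<le> inverse e ^ n" "Pker n R e y \<le> 2 * real n * e * inverse e ^ (n + 1)" "Qker n R e y \<le> 4 * real n"
proof -
  have i: "0 \<le> inverse (y \<bullet> y + e)" "inverse (y \<bullet> y + e) \<le> inverse e"
    using assms by (auto intro!: le_imp_inverse_le add_nonneg_nonneg)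
  have "inverse (y \<bullet> y + e) ^ n * cutoff n 0 R 0 y \<le> inverse e ^ n * 1"
    using i cutoff_le[of n 0 R 0 y] assms by (intro mult_mono power_mono cutoff_nonneg) auto
  then show "Wker n R e y \<le> inverse e ^ n" by (simp add: Wker_def)
  have "inverse (y \<bullet> y + e) ^ (n + 1) * cutoff n 0 R 0 y \<le> inverse e ^ (n + 1) * 1"
    using i cutoff_le[of n 0 R 0 y] assms by (intro mult_mono power_mono cutoff_nonneg) auto
  then have "2 * real n * e * (inverse (y \<bullet> y + e) ^ (n + 1) * cutoff n 0 R 0 y) \<le> 2 * real n * e * (inverse e ^ (n + 1) * 1)"
    using assms by (intro mult_left_mono) auto
  then have "2 * real n * e * inverse (y \<bullet> y + e) ^ (n + 1) * cutoff n 0 R 0 y \<le> 2 * real n * e * inverse e ^ (n + 1) * 1"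
    by (simp only: mult.assoc)
  then show "Pker n R e y \<le> 2 * real n * e * inverse e ^ (n + 1)" by (simp add: Pker_def)
  have "0 < y \<bullet> y + e" using assms by (simp add: add_nonneg_pos)
  then have "(y \<bullet> y) * inverse (y \<bullet> y + e) \<le> 1"
    using assms by (simp add: divide_inverse[symmetric] pos_divide_le_eq)
  then have "((y \<bullet> y) * inverse (y \<bullet> y + e)) ^ n \<le> 1"
    using i by (intro power_le_one) auto
  then have "((y \<bullet> y) ^ n * inverse (y \<bullet> y + e) ^ n) * cutoff n 2 R 0 y \<le> 1 * 2"
    using cutoff_le[of n 2 R 0 y] i by (intro mult_mono cutoff_nonneg) (auto simp: power_mult_distrib)
  from mult_left_mono[OF this, of "2 * real n"] show "Qker n R e y \<le> 4 * real n" by (simp add: Qker_def)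
qed

text \<open>The factor \<open>\<delta>\<^sup>2 / (t + \<delta>\<^sup>2)\<close> is traded for the integrable gain \<open>(\<delta> / \<parallel>y\<parallel>)\<^sup>1\<^sup>/\<^sup>2\<close>.\<close>
lemma quotient_le_powr:
  assumes "0 < \<delta>" "y \<noteq> (0::'a::real_inner)"
  shows "\<delta>\<^sup>2 * inverse (y \<bullet> y + \<delta>\<^sup>2) \<le> \<delta> powr (1/2) * norm y powr (- (1/2))"
proof -
  have ny: "0 < norm y" using assms by simp
  show ?thesis
  proof (cases "\<delta> \<le> norm y")
    case True
    have "\<delta>\<^sup>2 * inverse (y \<bullet> y + \<delta>\<^sup>2) \<le> \<delta>\<^sup>2 * inverse ((norm y)\<^sup>2)"
      using ny by (intro mult_left_mono le_imp_inverse_le) (auto simp: dot_square_norm)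
    also have "\<dots> = (\<delta> / norm y) powr 2" using ny assms by (simp add: powr_numeral power_divide field_simps)
    also have "\<dots> \<le> (\<delta> / norm y) powr (1/2)"
      using True assms ny by (intro powr_mono') auto
    also have "\<dots> = \<delta> powr (1/2) * norm y powr (- (1/2))"
      using assms ny by (simp add: powr_divide powr_minus field_simps)
    finally show ?thesis .
  next
    case False
    have "\<delta>\<^sup>2 * inverse (y \<bullet> y + \<delta>\<^sup>2) \<le> 1"
      using assms inner_ge_zero[of y] by (simp add: field_simps add_nonneg_pos)
    also have "1 \<le> (\<delta> / norm y) powr (1/2)"
      using False ny by (intro ge_one_powr_ge_zero) auto
    also have "\<dots> = \<delta> powr (1/2) * norm y powr (- (1/2))"
      using assms ny by (simp add: powr_divide powr_minus field_simps)
    finally show ?thesis .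
  qed
qed

lemma inverse_power_le_powr:
  assumes "0 \<le> e" "y \<noteq> (0::'a::real_inner)"
  shows "inverse (y \<bullet> y + e) ^ n \<le> norm y powr (- 2 * real n)"
proof -
  have ny: "0 < norm y" using assms by simp
  have "inverse (y \<bullet> y + e) ^ n \<le> inverse ((norm y)\<^sup>2) ^ n"
    using ny assms(1) by (intro power_mono le_imp_inverse_le) (auto simp: dot_square_norm intro!: add_nonneg_nonneg)
  also have "\<dots> = norm y powr (- 2 * real n)"
  proof -
    have "norm y powr (- 2 * real n) = inverse (norm y powr (real (2 * n)))" by (simp add: powr_minus)
    also have "norm y powr (real (2 * n)) = ((norm y)\<^sup>2) ^ n" unfolding powr_realpow[OF ny] by (rule power_mult)
    finally show ?thesis by (simp add: power_inverse)
  qed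
  finally show ?thesis .
qed

text \<open>The surplus 1/2 over the critical exponent -2n keeps this majorant integrable and still
  leaves a positive power of the scale in the error terms.\<close>

definition Rker :: "nat \<Rightarrow> 'a::euclidean_space \<Rightarrow> real" where
  "Rker n y = indicator (ball 0 1) y * norm y powr (1/2 - 2 * real n)"

lemma Rker_nonneg: "0 \<le> Rker n y"
  by (simp add: Rker_def)

lemma Rker_measurable [measurable]: "Rker n \<in> borel_measurable (borel :: 'a::euclidean_space measure)"
proof -
  have "(\<lambda>y::'a. indicator (ball 0 1) y * norm y powr (1/2 - 2 * real n)) \<in> borel_measurable borel"
    by (intro borel_measurable_times borel_measurable_indicator powr_real_measurable borel_measurable_norm
        measurable_ident_sets borel_measurable_const) auto
  then show ?thesis by (simp add: Rker_def[abs_def])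
qed

text \<open>Controls the first moment of P, hence the cost of replacing a Lipschitz function at a by
  its value at x; this cost tends to 0 with \<open>\<eta>\<close>.\<close>

lemma Pker_le_Rker:
  assumes "0 < \<eta>" "0 \<le> R" "R \<le> 1"
  shows "norm y * Pker n R (\<eta>\<^sup>2) y \<le> 2 * real n * \<eta> powr (1/2) * Rker n y"
proof (cases "y = 0 \<or> R \<le> norm y")
  case True
  then show ?thesis using kernels_support(2)[OF assms(2), of y n] Rker_nonneg[of n y] assms by auto
next
  case False
  then have y: "y \<noteq> 0" "norm y < R" by auto
  define A where "A = \<eta>\<^sup>2 * inverse (y \<bullet> y + \<eta>\<^sup>2)"
  define C where "C = inverse (y \<bullet> y + \<eta>\<^sup>2) ^ n"
  have A: "0 \<le> A" "A \<le> \<eta> powr (1/2) * norm y powr (- (1/2))"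
    using quotient_le_powr[OF assms(1) y(1)] by (auto simp: A_def)
  have C: "0 \<le> C" "C \<le> norm y powr (- 2 * real n)"
    using inverse_power_le_powr[OF _ y(1), of "\<eta>\<^sup>2" n] by (auto simp: C_def)
  have "norm y * Pker n R (\<eta>\<^sup>2) y = 2 * real n * (norm y * A * C) * cutoff n 0 R 0 y"
    by (simp add: Pker_def A_def C_def mult_ac)
  also have "\<dots> \<le> 2 * real n * (norm y * (\<eta> powr (1/2) * norm y powr (- (1/2))) * norm y powr (- 2 * real n)) * 1"
    using A C cutoff_le[of n 0 R 0 y] cutoff_nonneg[of n 0 R 0 y]
    by (intro mult_mono mult_nonneg_nonneg) auto
  also have "\<dots> = 2 * real n * \<eta> powr (1/2) * norm y powr (1/2 - 2 * real n)"
  proof -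
    have "norm y powr 1 * norm y powr (- (1/2)) * norm y powr (- 2 * real n) = norm y powr (1/2 - 2 * real n)"
      unfolding powr_add[symmetric] by simp
    then have "norm y * norm y powr (- (1/2)) * norm y powr (- 2 * real n) = norm y powr (1/2 - 2 * real n)"
      using y by simp
    then show ?thesis by (simp add: mult_ac)
  qed
  finally show ?thesis using y assms by (simp add: Rker_def indicator_def)
qed

lemma Wker_antimono:
  assumes "0 < \<eta>" "\<eta> \<le> \<delta>"
  shows "Wker n R (\<delta>\<^sup>2) y \<le> Wker n R (\<eta>\<^sup>2) y"
proof -
  have "0 < y \<bullet> y + \<eta>\<^sup>2" using assms by (simp add: add_nonneg_pos)
  moreover have "\<eta>\<^sup>2 \<le> \<delta>\<^sup>2" using assms by (intro power_mono) auto
  ultimately show ?thesis unfolding Wker_def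
    by (intro mult_right_mono power_mono le_imp_inverse_le cutoff_nonneg) (auto intro!: add_nonneg_nonneg)
qed

text \<open>With q the ratio of the two denominators, Bernoulli gives 1 - q^n <= n (1 - q) <= n
  \<delta>^2 / (|y|^2 + \<delta>^2), where \<open>\<eta>\<close> has disappeared. This uniformity is
  what lets \<open>\<eta>\<close> tend to 0 with \<open>\<delta>\<close> fixed.\<close>

lemma Wker_diff_le_Rker:
  assumes "0 < \<eta>" "\<eta> \<le> \<delta>" "0 \<le> R" "R \<le> 1"
  shows "norm y * (Wker n R (\<eta>\<^sup>2) y - Wker n R (\<delta>\<^sup>2) y) \<le> real n * \<delta> powr (1/2) * Rker n y"
proof (cases "y = 0 \<or> R \<le> norm y")
  case True
  then show ?thesis using kernels_support(1)[OF assms(3), of y n] Rker_nonneg[of n y] assms by auto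
next
  case False
  then have y: "y \<noteq> 0" "norm y < R" by auto
  have pos: "0 < y \<bullet> y + \<eta>\<^sup>2" "0 < y \<bullet> y + \<delta>\<^sup>2" using assms by (simp_all add: add_nonneg_pos)
  define A where "A = inverse (y \<bullet> y + \<eta>\<^sup>2)"
  define B where "B = inverse (y \<bullet> y + \<delta>\<^sup>2)"
  define q where "q = (y \<bullet> y + \<eta>\<^sup>2) * B"
  have A: "0 < A" "A ^ n \<le> norm y powr (- 2 * real n)"
    using pos inverse_power_le_powr[OF _ y(1), of "\<eta>\<^sup>2" n] by (auto simp: A_def)
  have B: "0 < B" "\<delta>\<^sup>2 * B \<le> \<delta> powr (1/2) * norm y powr (- (1/2))"
    using pos quotient_le_powr[OF _ y(1), of \<delta>] assms by (auto simp: B_def)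
  have Bq: "B = A * q" using pos by (simp add: A_def q_def)
  have q: "0 < q" using pos B by (simp add: q_def)
  have q1: "1 - q \<le> \<delta>\<^sup>2 * B"
  proof -
    have "1 = (y \<bullet> y + \<delta>\<^sup>2) * B" using pos by (simp add: B_def)
    then have "1 - q = (\<delta>\<^sup>2 - \<eta>\<^sup>2) * B" by (simp add: q_def algebra_simps)
    also have "\<dots> \<le> \<delta>\<^sup>2 * B" using B by (intro mult_right_mono) auto
    finally show ?thesis .
  qed
  have "1 + real n * (q - 1) \<le> (1 + (q - 1)) ^ n" using q by (intro Bernoulli_inequality) auto
  then have "1 - q ^ n \<le> real n * (1 - q)" by (simp add: algebra_simps)
  also have "\<dots> \<le> real n * (\<delta> powr (1/2) * norm y powr (- (1/2)))"
    using q1 B by (intro mult_left_mono) auto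
  finally have qn: "1 - q ^ n \<le> real n * (\<delta> powr (1/2) * norm y powr (- (1/2)))" .
  have "A ^ n - B ^ n = A ^ n * (1 - q ^ n)" unfolding Bq by (simp add: power_mult_distrib algebra_simps)
  also have "\<dots> \<le> A ^ n * (real n * (\<delta> powr (1/2) * norm y powr (- (1/2))))"
    using A qn by (intro mult_left_mono) auto
  also have "\<dots> \<le> norm y powr (- 2 * real n) * (real n * (\<delta> powr (1/2) * norm y powr (- (1/2))))"
    using A by (intro mult_right_mono) auto
  finally have AB: "A ^ n - B ^ n \<le> norm y powr (- 2 * real n) * (real n * (\<delta> powr (1/2) * norm y powr (- (1/2))))" .
  have AB0: "0 \<le> A ^ n - B ^ n"
    using power_mono[of B A n] assms pos B unfolding A_def B_def
    by (simp add: le_imp_inverse_le power_mono)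
  have "norm y * (Wker n R (\<eta>\<^sup>2) y - Wker n R (\<delta>\<^sup>2) y) = norm y * (A ^ n - B ^ n) * cutoff n 0 R 0 y"
    by (simp add: Wker_def A_def B_def algebra_simps)
  also have "\<dots> \<le> norm y * (norm y powr (- 2 * real n) * (real n * (\<delta> powr (1/2) * norm y powr (- (1/2))))) * 1"
    using AB AB0 cutoff_le[of n 0 R 0 y] cutoff_nonneg[of n 0 R 0 y] by (intro mult_mono mult_nonneg_nonneg) auto
  also have "\<dots> = real n * \<delta> powr (1/2) * norm y powr (1/2 - 2 * real n)"
  proof -
    have "norm y powr 1 * norm y powr (- (1/2)) * norm y powr (- 2 * real n) = norm y powr (1/2 - 2 * real n)"
      unfolding powr_add[symmetric] by simp
    then have "norm y * norm y powr (- (1/2)) * norm y powr (- 2 * real n) = norm y powr (1/2 - 2 * real n)"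
      using y by simp
    then show ?thesis by (simp add: mult_ac)
  qed
  finally show ?thesis using y assms by (simp add: Rker_def indicator_def)
qed

lemma nn_integral_Rker:
  assumes "DIM('a::euclidean_space) = 2 * n"
  shows "(\<integral>\<^sup>+y. ennreal (Rker n y) \<partial>(lborel :: 'a measure)) \<le> ennreal (2 * riesz_const n)"
  using nn_integral_norm_powr_ball[OF assms, of "1/2"] by (simp add: Rker_def mult.commute)

lemma nn_integral_Wker:
  assumes dim: "DIM('a::euclidean_space) = 2 * n" and d: "0 < \<delta>" "\<delta> \<le> 1/2" and R: "0 \<le> R" "R \<le> 1"
  shows "(\<integral>\<^sup>+y. ennreal (Wker n R (\<delta>\<^sup>2) y) \<partial>(lborel :: 'a measure)) \<le> ennreal (4 * riesz_const n * ln (1 / \<delta>))"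
proof -
  have n1: "1 \<le> n" using dim DIM_positive[where 'a='a] by linarith
  \<comment> \<open>Chosen so that \<delta>^(-\<gamma>) = exp (1/2) <= 2. Up to this factor the
    regularised weight is dominated by |y|^(\<gamma> - 2n), whose integral is of order 1 / \<gamma>.
    The bound \<delta> <= 1/2 ensures \<gamma> <= 1.\<close>
  define \<gamma> where "\<gamma> = 1 / (2 * ln (1 / \<delta>))"
  have l: "1/2 \<le> ln (1 / \<delta>)"
  proof -
    have "ln 2 \<le> ln (1 / \<delta>)" using d by (subst ln_le_cancel_iff) (auto simp: field_simps)
    then show ?thesis using ln2_ge_two_thirds by linarith
  qed
  have g: "0 < \<gamma>" "\<gamma> \<le> 1" using l by (auto simp: \<gamma>_def field_simps)
  have d2: "\<delta> powr (- \<gamma>) \<le> 2"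
  proof -
    have "\<delta> powr (- \<gamma>) = exp (\<gamma> * ln (1 / \<delta>))" using d by (simp add: powr_def ln_div)
    also have "\<gamma> * ln (1 / \<delta>) = 1/2" using l by (simp add: \<gamma>_def)
    also have "exp (1/2) \<le> (2::real)" using exp_bound_half[of "1/2::real"] by simp
    finally show ?thesis .
  qed
  have pt: "Wker n R (\<delta>\<^sup>2) y \<le> 2 * (indicator (ball 0 1) y * norm y powr (\<gamma> - 2 * real n))" if y: "y \<noteq> 0" for y :: 'a
  proof (cases "R \<le> norm y")
    case True
    then show ?thesis using kernels_support(1)[OF R(1) True, of n] by simp
  next
    case False
    have ny: "0 < norm y" using y by simp
    have pos: "0 < y \<bullet> y + \<delta>\<^sup>2" using d by (simp add: add_nonneg_pos)
    have "inverse (y \<bullet> y + \<delta>\<^sup>2) ^ n \<le> \<delta> powr (- \<gamma>) * norm y powr (\<gamma> - 2 * real n)"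
    proof (cases "\<delta> \<le> norm y")
      case True
      have "inverse (y \<bullet> y + \<delta>\<^sup>2) ^ n \<le> norm y powr (- \<gamma>) * norm y powr (\<gamma> - 2 * real n)"
        using inverse_power_le_powr[OF _ y, of "\<delta>\<^sup>2" n] by (simp add: powr_add[symmetric])
      also have "\<dots> \<le> \<delta> powr (- \<gamma>) * norm y powr (\<gamma> - 2 * real n)"
        using True d g by (intro mult_right_mono powr_mono2') auto
      finally show ?thesis .
    next
      case False
      have "inverse (y \<bullet> y + \<delta>\<^sup>2) ^ n \<le> inverse (\<delta>\<^sup>2) ^ n"
        using pos d by (intro power_mono le_imp_inverse_le) auto
      also have "\<dots> = \<delta> powr (- 2 * real n)"
        using d powr_realpow[of \<delta> "2 * n"] by (simp add: powr_minus power_inverse power_mult)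
      also have "\<dots> = \<delta> powr (- \<gamma>) * \<delta> powr (\<gamma> - 2 * real n)" by (simp add: powr_add[symmetric])
      also have "\<dots> \<le> \<delta> powr (- \<gamma>) * norm y powr (\<gamma> - 2 * real n)"
        using False ny g n1 by (intro mult_left_mono powr_mono2') auto
      finally show ?thesis .
    qed
    also have "\<dots> \<le> 2 * norm y powr (\<gamma> - 2 * real n)" by (intro mult_right_mono d2) auto
    finally have "inverse (y \<bullet> y + \<delta>\<^sup>2) ^ n * cutoff n 0 R 0 y \<le> 2 * norm y powr (\<gamma> - 2 * real n) * 1"
      using cutoff_le[of n 0 R 0 y] by (intro mult_mono cutoff_nonneg) auto
    then show ?thesis using False R by (simp add: Wker_def indicator_def)
  qed
  have ae: "AE y in (lborel :: 'a measure). y \<noteq> 0" by (rule AE_lborel_singleton)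
  have "(\<integral>\<^sup>+y. ennreal (Wker n R (\<delta>\<^sup>2) y) \<partial>(lborel :: 'a measure))
     \<le> (\<integral>\<^sup>+y. ennreal 2 * ennreal (indicator (ball 0 1) y * norm y powr (\<gamma> - 2 * real n)) \<partial>(lborel :: 'a measure))"
  proof (rule nn_integral_mono_AE)
    show "AE y in (lborel :: 'a measure). ennreal (Wker n R (\<delta>\<^sup>2) y)
        \<le> ennreal 2 * ennreal (indicator (ball 0 1) y * norm y powr (\<gamma> - 2 * real n))"
      using ae
    proof eventually_elim
      case (elim y)
      have "ennreal 2 * ennreal (indicator (ball 0 1) y * norm y powr (\<gamma> - 2 * real n))
        = ennreal (2 * (indicator (ball 0 1) y * norm y powr (\<gamma> - 2 * real n)))"
        by (rule ennreal_mult'[symmetric]) simp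
      then show ?case using ennreal_leI[OF pt[OF elim]] by simp
    qed
  qed
  also have "\<dots> = ennreal 2 * (\<integral>\<^sup>+y. ennreal (indicator (ball 0 1) y * norm y powr (\<gamma> - 2 * real n)) \<partial>(lborel :: 'a measure))"
    by (rule nn_integral_cmult) (auto simp only: measurable_lborel2 intro!: measurable_compose[OF _ measurable_ennreal]
       borel_measurable_times borel_measurable_indicator powr_real_measurable borel_measurable_norm
        measurable_ident_sets borel_measurable_const borel_open open_ball)
  also have "\<dots> \<le> ennreal 2 * ennreal (riesz_const n / \<gamma>)"
    by (intro mult_left_mono nn_integral_norm_powr_ball[OF dim g]) auto
  also have "\<dots> = ennreal (2 * (riesz_const n / \<gamma>))" by (rule ennreal_mult'[symmetric]) simp
  also have "2 * (riesz_const n / \<gamma>) = 4 * riesz_const n * ln (1 / \<delta>)" by (simp add: \<gamma>_def)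
  finally show ?thesis .
qed

text \<open>A lower bound for the mass of P, taken on the ball of radius \<open>\<eta>\<close> <= R
  / 2: there the denominator is at most 2 \<eta>^2 and the cutoff is at least its value at distance
  R / 2. All powers of \<open>\<eta>\<close> cancel.\<close>

definition core_const :: "nat \<Rightarrow> real \<Rightarrow> real" where
  "core_const n R = 2 * real n * flat 0 (R ^ (2 * n) - (R / 2) ^ (2 * n)) * inverse 2 ^ (n + 1) * unit_ball_vol (real (2 * n))"

lemma flat_pos: "0 < x \<Longrightarrow> 0 < flat k x"
  by (simp add: flat_def)

lemma flat_0_mono: "x \<le> y \<Longrightarrow> flat 0 x \<le> flat 0 y"
  by (auto simp: flat_def le_imp_inverse_le)

lemma core_const_pos:
  assumes "0 < R" "1 \<le> n"
  shows "0 < core_const n R"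
proof -
  have "(R / 2) ^ (2 * n) < R ^ (2 * n)" using assms by (intro power_strict_mono) auto
  then show ?thesis using assms by (simp add: core_const_def flat_pos)
qed

lemma nn_integral_Pker_ge:
  assumes dim: "DIM('a::euclidean_space) = 2 * n" and e: "0 < \<eta>" "\<eta> \<le> R / 2"
  shows "ennreal (core_const n R) \<le> (\<integral>\<^sup>+y. ennreal (Pker n R (\<eta>\<^sup>2) y) \<partial>(lborel :: 'a measure))"
proof -
  define \<kappa> where "\<kappa> = flat 0 (R ^ (2 * n) - (R / 2) ^ (2 * n))"
  define c where "c = 2 * real n * \<eta>\<^sup>2 * inverse (2 * \<eta>\<^sup>2) ^ (n + 1) * \<kappa>"
  have c0: "0 \<le> c" unfolding c_def \<kappa>_def by (intro mult_nonneg_nonneg flat_nonneg) auto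
  have pt: "ennreal c * indicator (ball 0 \<eta>) y \<le> ennreal (Pker n R (\<eta>\<^sup>2) y)" for y :: 'a
  proof (cases "y \<in> ball 0 \<eta>")
    case True
    then have ny: "norm y < \<eta>" by simp
    have "y \<bullet> y \<le> \<eta>\<^sup>2" using ny by (simp add: dot_square_norm power_mono)
    then have i: "inverse (2 * \<eta>\<^sup>2) \<le> inverse (y \<bullet> y + \<eta>\<^sup>2)"
      using e by (intro le_imp_inverse_le) (auto simp: add_nonneg_pos)
    have "(y \<bullet> y) ^ n \<le> (R / 2) ^ (2 * n)"
      using ny e by (simp add: dot_square_norm power_mult[symmetric] power_mono)
    then have "\<kappa> \<le> cutoff n 0 R 0 y" by (auto simp: \<kappa>_def cutoff_def intro!: flat_0_mono)
    then have "c \<le> Pker n R (\<eta>\<^sup>2) y"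
      unfolding c_def Pker_def using i e
      by (intro mult_mono mult_left_mono power_mono mult_nonneg_nonneg) (auto simp: \<kappa>_def flat_nonneg add_nonneg_nonneg)
    then show ?thesis using True by (simp add: ennreal_leI)
  qed simp
  have "core_const n R = c * (unit_ball_vol (real (2 * n)) * \<eta> ^ (2 * n))"
  proof -
    define h where "h = \<eta>\<^sup>2"
    have h: "h \<noteq> 0" "\<eta> ^ (2 * n) = h ^ n" using e by (auto simp: h_def power_mult)
    have "h * inverse h ^ (n + 1) * h ^ n = 1"
      using h(1) by (simp add: power_inverse field_simps)
    moreover have "c * (unit_ball_vol (real (2 * n)) * h ^ n) = core_const n R * (h * inverse h ^ (n + 1) * h ^ n)"
      by (simp only: core_const_def c_def \<kappa>_def h_def[symmetric] inverse_mult_distrib power_mult_distrib mult_ac)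
    ultimately show ?thesis unfolding h(2) by simp
  qed
  then have "ennreal (core_const n R) = ennreal c * ennreal (unit_ball_vol (real (2 * n)) * \<eta> ^ (2 * n))"
    using c0 by (simp add: ennreal_mult')
  also have "\<dots> = ennreal c * emeasure lborel (ball (0::'a) \<eta>)"
    using emeasure_ball[of \<eta> "0::'a"] e by (simp add: dim)
  also have "\<dots> = (\<integral>\<^sup>+y. ennreal c * indicator (ball 0 \<eta>) y \<partial>(lborel :: 'a measure))"
    by (rule nn_integral_cmult_indicator[symmetric]) simp
  also have "\<dots> \<le> (\<integral>\<^sup>+y. ennreal (Pker n R (\<eta>\<^sup>2) y) \<partial>(lborel :: 'a measure))"
    by (intro nn_integral_mono pt)
  finally show ?thesis .
qed

section \<open>The estimate of weighted averages\<close>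

lemma nn_integral_lborel_translate:
  fixes h :: "'a::euclidean_space \<Rightarrow> ennreal"
  assumes [measurable]: "h \<in> borel_measurable borel"
  shows "(\<integral>\<^sup>+x. h (x - a) \<partial>lborel) = (\<integral>\<^sup>+x. h x \<partial>lborel)"
proof -
  have "(\<integral>\<^sup>+x. h x \<partial>lborel) = (\<integral>\<^sup>+x. h x \<partial>(distr lborel borel ((+) (- a))))"
    by (simp only: lborel_distr_plus)
  also have "\<dots> = (\<integral>\<^sup>+x. h (- a + x) \<partial>lborel)"
    by (rule nn_integral_distr) auto
  finally show ?thesis by simp
qed

lemma nn_integral_lborel_reflect_even:
  fixes h :: "'a::euclidean_space \<Rightarrow> ennreal"
  assumes "h \<in> borel_measurable borel" "\<And>y. h (- y) = h y"
  shows "(\<integral>\<^sup>+a. h (x - a) \<partial>lborel) = (\<integral>\<^sup>+x. h x \<partial>lborel)"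
proof -
  have "h (x - a) = h (a - x)" for a using assms(2)[of "a - x"] by simp
  then show ?thesis using nn_integral_lborel_translate[OF assms(1), of x] by simp
qed

lemma kernels_even:
  "Wker n R e (- y) = Wker n R e y" "Pker n R e (- y) = Pker n R e y"
  by (simp_all add: Wker_def Pker_def cutoff_def)

lemma ennreal_add_le: "0 \<le> x \<Longrightarrow> ennreal (x + y) \<le> ennreal x + ennreal y"
proof (cases "0 \<le> y")
  case False
  then have "ennreal (x + y) \<le> ennreal x" by (intro ennreal_leI) simp
  then show ?thesis by (rule order_trans) simp
qed (simp add: ennreal_plus)

lemma nn_integral_Tonelli_lborel:
  fixes h :: "'a::euclidean_space \<Rightarrow> 'a \<Rightarrow> ennreal"
  assumes "(\<lambda>(x, y). h x y) \<in> borel_measurable (lborel \<Otimes>\<^sub>M lborel)"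
  shows "(\<integral>\<^sup>+y. \<integral>\<^sup>+x. h x y \<partial>lborel \<partial>lborel) = (\<integral>\<^sup>+x. \<integral>\<^sup>+y. h x y \<partial>lborel \<partial>lborel)"
  by (rule lborel_pair.Fubini'[OF assms])

text \<open>The real-variable content alone. F and G stand for f / \<kappa> and its weak gradient,
  as Borel functions on the whole space; A holds the admissible centers, and L contains the balls of
  radius R around them. A single M bounds every quantity, so conclusions depend on n, R and M
  only.\<close>

locale radial_energy =
  fixes n :: nat and R M :: real and F :: "'a::euclidean_space \<Rightarrow> real" and G :: "'a \<Rightarrow> 'a" and A L :: "'a set"
  assumes dim: "DIM('a) = 2 * n" and R: "0 < R" "R \<le> 1"
    and F_borel [measurable]: "F \<in> borel_measurable borel" and F_nonpos: "\<And>x. F x \<le> 0"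
    and F_int: "integrable lborel F" and F_bound: "- (\<integral>x. F x \<partial>lborel) \<le> M"
    and G_borel [measurable]: "G \<in> borel_measurable borel"
    and L_borel [measurable]: "L \<in> sets borel" and L_finite: "emeasure lborel L < \<infinity>"
    and G_bound: "(\<integral>\<^sup>+x. ennreal (indicator L x * (norm (G x))\<^sup>2) \<partial>lborel) \<le> ennreal M"
    and divergence: "\<And>a e. a \<in> A \<Longrightarrow> 0 < e \<Longrightarrow>
      (\<integral>x. F x * (Pker n R e (x - a) - Qker n R e (x - a)) \<partial>lborel)
        = - (\<integral>x. (G x \<bullet> (x - a)) * Wker n R e (x - a) \<partial>lborel)"
    and energy: "\<And>a e. a \<in> A \<Longrightarrow> 0 < e \<Longrightarrow>
      (\<integral>\<^sup>+x. ennreal ((G x \<bullet> (x - a))\<^sup>2 * Wker n R e (x - a)) \<partial>lborel) \<le> ennreal M"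
    and A_L: "\<And>a x. a \<in> A \<Longrightarrow> norm (x - a) < R \<Longrightarrow> x \<in> L"
begin

section \<open>Integrability in the locale\<close>

lemma n1: "1 \<le> n"
  using dim DIM_positive[where 'a='a] by linarith

lemma M0: "0 \<le> M"
proof -
  have "0 \<le> (\<integral>x. - F x \<partial>lborel)" using F_nonpos by (intro integral_nonneg_AE) auto
  then show ?thesis using F_bound by simp
qed

lemma integrable_G: "integrable lborel (\<lambda>x. indicator L x * norm (G x))"
proof (rule integrableI_bounded)
  have "ennreal (norm (indicator L x * norm (G x))) \<le> indicator L x + ennreal (indicator L x * (norm (G x))\<^sup>2)" for x
  proof (cases "x \<in> L")
    case True
    have "0 \<le> (norm (G x) - 1)\<^sup>2" by simp
    then have "norm (G x) \<le> 1 + (norm (G x))\<^sup>2"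
      by (simp add: power2_diff) (smt (verit) norm_ge_zero zero_le_power2)
    then have "ennreal (norm (G x)) \<le> ennreal (1 + (norm (G x))\<^sup>2)" by (rule ennreal_leI)
    then show ?thesis using True by (simp add: ennreal_plus)
  qed simp
  then have "(\<integral>\<^sup>+x. ennreal (norm (indicator L x * norm (G x))) \<partial>lborel)
      \<le> (\<integral>\<^sup>+x. indicator L x + ennreal (indicator L x * (norm (G x))\<^sup>2) \<partial>lborel)"
    by (intro nn_integral_mono)
  also have "\<dots> = emeasure lborel L + (\<integral>\<^sup>+x. ennreal (indicator L x * (norm (G x))\<^sup>2) \<partial>lborel)"
    by (subst nn_integral_add) auto
  also have "\<dots> < \<infinity>" using L_finite le_less_trans[OF G_bound ennreal_less_top] by (simp add: less_top[symmetric])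
  finally show "(\<integral>\<^sup>+x. ennreal (norm (indicator L x * norm (G x))) \<partial>lborel) < \<infinity>" .
qed measurable

lemma integrable_F_bounded:
  assumes [measurable]: "h \<in> borel_measurable borel" and "\<And>x. \<bar>h x\<bar> \<le> B"
  shows "integrable lborel (\<lambda>x. F x * h x)"
proof (rule Bochner_Integration.integrable_bound[OF integrable_mult_right[OF F_int, of B]])
  show "AE x in lborel. norm (F x * h x) \<le> norm (B * F x)"
  proof (rule AE_I2)
    fix x
    have "\<bar>F x\<bar> * \<bar>h x\<bar> \<le> \<bar>F x\<bar> * \<bar>B\<bar>" using assms(2)[of x] by (intro mult_left_mono) auto
    then show "norm (F x * h x) \<le> norm (B * F x)" by (simp add: abs_mult mult.commute)
  qed
qed measurable

lemma integrable_G_kernel: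
  assumes a: "a \<in> A" and e: "0 < e"
  shows "integrable lborel (\<lambda>x. (G x \<bullet> (x - a)) * Wker n R e (x - a))"
proof (rule Bochner_Integration.integrable_bound[OF integrable_mult_left[OF integrable_G, of "inverse e ^ n"]])
  show "AE x in lborel. norm ((G x \<bullet> (x - a)) * Wker n R e (x - a)) \<le> norm (indicator L x * norm (G x) * inverse e ^ n)"
  proof (rule AE_I2)
    fix x
    show "norm ((G x \<bullet> (x - a)) * Wker n R e (x - a)) \<le> norm (indicator L x * norm (G x) * inverse e ^ n)"
    proof (cases "norm (x - a) < R")
      case True
      then have "x \<in> L" using A_L[OF a] by simp
      have "\<bar>G x \<bullet> (x - a)\<bar> \<le> norm (G x) * norm (x - a)" by (rule Cauchy_Schwarz_ineq2)
      also have "\<dots> \<le> norm (G x) * 1" using True R by (intro mult_left_mono) auto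
      finally have "\<bar>G x \<bullet> (x - a)\<bar> * \<bar>Wker n R e (x - a)\<bar> \<le> norm (G x) * inverse e ^ n"
        using kernels_nonneg(1)[of e n R "x - a"] kernels_upper(1)[OF e, of n R "x - a"] e
        by (intro mult_mono) auto
      then show ?thesis using \<open>x \<in> L\<close> e by (simp add: abs_mult)
    next
      case False
      then show ?thesis using kernels_support(1)[of R "x - a" n e] R by simp
    qed
  qed
  have [measurable]: "Wker n R e \<in> borel_measurable borel" by (rule borel_kernels[OF e])
  show "(\<lambda>x. (G x \<bullet> (x - a)) * Wker n R e (x - a)) \<in> borel_measurable lborel" by measurable
qed

text \<open>What is lost when W at scale \<open>\<eta>\<close> is replaced by W at scale
  \<open>\<delta>\<close>; the factor |y| comes from bounding G x . (x - a) by norms.\<close>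

definition tail :: "real \<Rightarrow> real \<Rightarrow> 'a \<Rightarrow> real" where
  "tail \<eta> \<delta> y = norm y * (Wker n R (\<eta>\<^sup>2) y - Wker n R (\<delta>\<^sup>2) y)"

lemma tail_nonneg: "0 < \<eta> \<Longrightarrow> \<eta> \<le> \<delta> \<Longrightarrow> 0 \<le> tail \<eta> \<delta> y"
  using Wker_antimono[of \<eta> \<delta> n R y] by (simp add: tail_def)

lemma tail_borel: "0 < \<eta> \<Longrightarrow> 0 < \<delta> \<Longrightarrow> tail \<eta> \<delta> \<in> borel_measurable borel"
  unfolding tail_def using borel_kernels(1)[of "\<eta>\<^sup>2" n R] borel_kernels(1)[of "\<delta>\<^sup>2" n R]
  by (intro borel_measurable_times borel_measurable_diff borel_measurable_norm measurable_ident_sets) auto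

lemma nn_integral_tail:
  assumes "0 < \<eta>" "\<eta> \<le> \<delta>"
  shows "(\<integral>\<^sup>+y. ennreal (tail \<eta> \<delta> y) \<partial>lborel) \<le> ennreal (2 * real n * riesz_const n * \<delta> powr (1/2))"
proof -
  have "(\<integral>\<^sup>+y. ennreal (tail \<eta> \<delta> y) \<partial>lborel) \<le> (\<integral>\<^sup>+y. ennreal (real n * \<delta> powr (1/2)) * ennreal (Rker n y) \<partial>(lborel :: 'a measure))"
    using Wker_diff_le_Rker[OF assms, where R = R and n = n and 'a = 'a] R
    by (intro nn_integral_mono) (auto simp: tail_def ennreal_mult'[symmetric] intro!: ennreal_leI)
  also have "\<dots> = ennreal (real n * \<delta> powr (1/2)) * (\<integral>\<^sup>+y. ennreal (Rker n y) \<partial>(lborel :: 'a measure))"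
    by (rule nn_integral_cmult) measurable
  also have "\<dots> \<le> ennreal (real n * \<delta> powr (1/2)) * ennreal (2 * riesz_const n)"
    by (intro mult_left_mono nn_integral_Rker dim) auto
  also have "\<dots> = ennreal (2 * real n * riesz_const n * \<delta> powr (1/2))"
    using riesz_const_pos[of n] by (subst ennreal_mult[symmetric]) (auto simp: mult_ac)
  finally show ?thesis .
qed

text \<open>The first summand is the contribution of Q, the second that of W at scale
  \<open>\<delta>\<close>.\<close>

definition log_bound :: "real \<Rightarrow> real" where
  "log_bound \<delta> = 4 * real n * M + (M + 4 * riesz_const n) / 2 * sqrt (ln (1 / \<delta>))"

text \<open>In the divergence identity W at scale \<open>\<eta>\<close> is split into W at scale
  \<open>\<delta>\<close> and the difference. The radial energy handles the first part and yields
  the square root of the logarithm; the second is kept as an integral, to be estimated after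
  averaging over \<open>a\<close>.\<close>

lemma inner_average_bound:
  assumes a: "a \<in> A" and \<eta>: "0 < \<eta>" "\<eta> \<le> \<delta>" and \<delta>: "\<delta> \<le> 1/2"
  shows "(\<integral>\<^sup>+x. ennreal (- F x * Pker n R (\<eta>\<^sup>2) (x - a)) \<partial>lborel)
    \<le> ennreal (log_bound \<delta>) + (\<integral>\<^sup>+x. ennreal (indicator L x * norm (G x) * tail \<eta> \<delta> (x - a)) \<partial>lborel)"
proof -
  \<comment> \<open>The weight in g <= \<theta> g^2 / 2 + 1 / (2 \<theta>), used in place of
    Cauchy-Schwarz. As the integral of W is of order \<theta>^2 = log (1 / \<delta>), both halves
    become of order \<open>\<theta>\<close>.\<close>
  define \<theta> where "\<theta> = sqrt (ln (1 / \<delta>))"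
  have d0: "0 < \<delta>" using \<eta> by simp
  have e0: "0 < \<eta>\<^sup>2" "0 < \<delta>\<^sup>2" using \<eta> by auto
  have l0: "0 < ln (1 / \<delta>)" using d0 \<delta> by (intro ln_gt_zero) (auto simp: field_simps)
  then have \<theta>: "0 < \<theta>" "\<theta> * \<theta> = ln (1 / \<delta>)" by (auto simp: \<theta>_def)
  let ?g = "\<lambda>x. G x \<bullet> (x - a)"
  let ?W = "\<lambda>e x. Wker n R (e\<^sup>2) (x - a)" and ?P = "\<lambda>x. Pker n R (\<eta>\<^sup>2) (x - a)" and ?Q = "\<lambda>x. Qker n R (\<eta>\<^sup>2) (x - a)"
  have [measurable]: "Wker n R (\<eta>\<^sup>2) \<in> borel_measurable borel" "Wker n R (\<delta>\<^sup>2) \<in> borel_measurable borel"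
      "Pker n R (\<eta>\<^sup>2) \<in> borel_measurable borel" "Qker n R (\<eta>\<^sup>2) \<in> borel_measurable borel"
    using borel_kernels e0 by blast+
  have [measurable]: "tail \<eta> \<delta> \<in> borel_measurable borel" using tail_borel \<eta> d0 by blast
  have iP: "integrable lborel (\<lambda>x. F x * ?P x)"
  proof (rule integrable_F_bounded)
    show "\<bar>?P x\<bar> \<le> 2 * real n * \<eta>\<^sup>2 * inverse (\<eta>\<^sup>2) ^ (n + 1)" for x
      unfolding abs_of_nonneg[OF kernels_nonneg(2)[OF less_imp_le[OF e0(1)]]] by (rule kernels_upper(2)[OF e0(1)])
  qed measurable
  have iQ: "integrable lborel (\<lambda>x. F x * ?Q x)"
  proof (rule integrable_F_bounded)
    show "\<bar>?Q x\<bar> \<le> 4 * real n" for x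
      unfolding abs_of_nonneg[OF kernels_nonneg(3)[OF less_imp_le[OF e0(1)]]] by (rule kernels_upper(3)[OF e0(1)])
  qed measurable
  have iW: "integrable lborel (\<lambda>x. ?g x * ?W \<eta> x)" "integrable lborel (\<lambda>x. ?g x * ?W \<delta> x)"
    by (rule integrable_G_kernel[OF a e0(1)], rule integrable_G_kernel[OF a e0(2)])
  have main: "(\<integral>x. - F x * ?P x \<partial>lborel) = (\<integral>x. - F x * ?Q x \<partial>lborel) + (\<integral>x. ?g x * ?W \<delta> x \<partial>lborel)
      + (\<integral>x. ?g x * ?W \<eta> x - ?g x * ?W \<delta> x \<partial>lborel)"
    using divergence[OF a e0(1)] iP iQ iW by (simp add: right_diff_distrib)
  have bQ: "(\<integral>x. - F x * ?Q x \<partial>lborel) \<le> 4 * real n * M"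
  proof -
    have "(\<integral>x. - F x * ?Q x \<partial>lborel) \<le> (\<integral>x. 4 * real n * - F x \<partial>lborel)"
    proof (rule integral_mono)
      show "- F x * ?Q x \<le> 4 * real n * - F x" for x
        using mult_left_mono[OF kernels_upper(3)[OF e0(1), of n R "x - a"], of "- F x"] F_nonpos[of x]
        by (simp add: mult_ac)
    qed (use iQ F_int in auto)
    also have "\<dots> = 4 * real n * - (\<integral>x. F x \<partial>lborel)" by simp
    also have "\<dots> \<le> 4 * real n * M" using F_bound by (intro mult_left_mono) auto
    finally show ?thesis .
  qed
  have bW: "(\<integral>x. ?g x * ?W \<delta> x \<partial>lborel) \<le> (M + 4 * riesz_const n) / 2 * \<theta>"
  proof -
    have iw: "integrable lborel (\<lambda>x. ?W \<delta> x)" and w: "(\<integral>x. ?W \<delta> x \<partial>lborel) \<le> 4 * riesz_const n * (\<theta> * \<theta>)"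
    proof -
      have "(\<integral>\<^sup>+x. ennreal (?W \<delta> x) \<partial>lborel) = (\<integral>\<^sup>+x. ennreal (Wker n R (\<delta>\<^sup>2) x) \<partial>(lborel :: 'a measure))"
        by (rule nn_integral_lborel_translate[where h = "\<lambda>y. ennreal (Wker n R (\<delta>\<^sup>2) y)"]) measurable
      also have "\<dots> \<le> ennreal (4 * riesz_const n * (\<theta> * \<theta>))"
        unfolding \<theta>(2) using R by (intro nn_integral_Wker[OF dim d0 \<delta>]) auto
      finally have *: "(\<integral>\<^sup>+x. ennreal (?W \<delta> x) \<partial>lborel) \<le> ennreal (4 * riesz_const n * (\<theta> * \<theta>))" .
      then show iw: "integrable lborel (\<lambda>x. ?W \<delta> x)"
        using kernels_nonneg(1)[of "\<delta>\<^sup>2" n R] le_less_trans[OF * ennreal_less_top] by (intro integrableI_nonneg) auto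
      have "0 \<le> 4 * riesz_const n * (\<theta> * \<theta>)" using riesz_const_pos[of n] by simp
      then show "(\<integral>x. ?W \<delta> x \<partial>lborel) \<le> 4 * riesz_const n * (\<theta> * \<theta>)"
        using * nn_integral_eq_integral[OF iw AE_I2[OF kernels_nonneg(1)]] e0 by (simp only: ennreal_le_iff less_imp_le)
    qed
    have ig: "integrable lborel (\<lambda>x. (?g x)\<^sup>2 * ?W \<delta> x)" and g: "(\<integral>x. (?g x)\<^sup>2 * ?W \<delta> x \<partial>lborel) \<le> M"
    proof -
      note * = energy[OF a e0(2)]
      then show ig: "integrable lborel (\<lambda>x. (?g x)\<^sup>2 * ?W \<delta> x)"
        using kernels_nonneg(1)[of "\<delta>\<^sup>2" n R] le_less_trans[OF * ennreal_less_top] by (intro integrableI_nonneg) (auto intro!: AE_I2 mult_nonneg_nonneg)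
      show "(\<integral>x. (?g x)\<^sup>2 * ?W \<delta> x \<partial>lborel) \<le> M"
        using * nn_integral_eq_integral[OF ig AE_I2[OF mult_nonneg_nonneg[OF zero_le_power2 kernels_nonneg(1)]]] e0 M0
        by (simp only: ennreal_le_iff less_imp_le)
    qed
    have "(\<integral>x. ?g x * ?W \<delta> x \<partial>lborel) \<le> (\<integral>x. \<theta> / 2 * ((?g x)\<^sup>2 * ?W \<delta> x) + 1 / (2 * \<theta>) * ?W \<delta> x \<partial>lborel)"
    proof (rule integral_mono)
      fix x
      have "0 \<le> (\<theta> * ?g x - 1)\<^sup>2 / (2 * \<theta>)" using \<theta> by simp
      also have "\<dots> = \<theta> / 2 * (?g x)\<^sup>2 + 1 / (2 * \<theta>) - ?g x" using \<theta>(1) by (simp add: field_simps power2_eq_square)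
      finally have "?g x * ?W \<delta> x \<le> (\<theta> / 2 * (?g x)\<^sup>2 + 1 / (2 * \<theta>)) * ?W \<delta> x"
        using kernels_nonneg(1)[of "\<delta>\<^sup>2" n R "x - a"] by (intro mult_right_mono) auto
      then show "?g x * ?W \<delta> x \<le> \<theta> / 2 * ((?g x)\<^sup>2 * ?W \<delta> x) + 1 / (2 * \<theta>) * ?W \<delta> x"
        by (simp add: algebra_simps)
    qed (use iW iw ig in auto)
    also have "\<dots> = \<theta> / 2 * (\<integral>x. (?g x)\<^sup>2 * ?W \<delta> x \<partial>lborel) + 1 / (2 * \<theta>) * (\<integral>x. ?W \<delta> x \<partial>lborel)"
      using iw ig by simp
    also have "\<dots> \<le> \<theta> / 2 * M + 1 / (2 * \<theta>) * (4 * riesz_const n * (\<theta> * \<theta>))"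
      using \<theta> w g by (intro add_mono mult_left_mono) auto
    also have "\<dots> = (M + 4 * riesz_const n) / 2 * \<theta>" using \<theta>(1) by (simp add: field_simps)
    finally show ?thesis .
  qed
  have it: "integrable lborel (\<lambda>x. ?g x * ?W \<eta> x - ?g x * ?W \<delta> x)" using iW by simp
  have "ennreal (\<integral>x. ?g x * ?W \<eta> x - ?g x * ?W \<delta> x \<partial>lborel) \<le> (\<integral>\<^sup>+x. ennreal (?g x * ?W \<eta> x - ?g x * ?W \<delta> x) \<partial>lborel)"
  proof -
    have "(\<integral>x. ?g x * ?W \<eta> x - ?g x * ?W \<delta> x \<partial>lborel) \<le> (\<integral>x. max 0 (?g x * ?W \<eta> x - ?g x * ?W \<delta> x) \<partial>lborel)"
      using it by (intro integral_mono integrable_max) auto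
    moreover have "(\<integral>\<^sup>+x. ennreal (max 0 (?g x * ?W \<eta> x - ?g x * ?W \<delta> x)) \<partial>lborel)
        = ennreal (\<integral>x. max 0 (?g x * ?W \<eta> x - ?g x * ?W \<delta> x) \<partial>lborel)"
      using it by (intro nn_integral_eq_integral integrable_max) auto
    ultimately show ?thesis by (simp add: ennreal_leI ennreal_max_0 cong: nn_integral_cong)
  qed
  also have "\<dots> \<le> (\<integral>\<^sup>+x. ennreal (indicator L x * norm (G x) * tail \<eta> \<delta> (x - a)) \<partial>lborel)"
  proof (intro nn_integral_mono ennreal_leI)
    fix x
    show "?g x * ?W \<eta> x - ?g x * ?W \<delta> x \<le> indicator L x * norm (G x) * tail \<eta> \<delta> (x - a)"
    proof (cases "norm (x - a) < R")
      case True
      then have "x \<in> L" using A_L[OF a] by simp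
      have "?g x * (?W \<eta> x - ?W \<delta> x) \<le> norm (G x) * norm (x - a) * (?W \<eta> x - ?W \<delta> x)"
        using Wker_antimono[of \<eta> \<delta> n R "x - a"] \<eta> norm_cauchy_schwarz[of "G x" "x - a"] by (intro mult_right_mono) auto
      then show ?thesis using \<open>x \<in> L\<close> by (simp add: tail_def algebra_simps)
    next
      case False
      then show ?thesis using kernels_support(1)[of R "x - a" n] R by (simp add: tail_def)
    qed
  qed
  finally have bt: "ennreal (\<integral>x. ?g x * ?W \<eta> x - ?g x * ?W \<delta> x \<partial>lborel)
      \<le> (\<integral>\<^sup>+x. ennreal (indicator L x * norm (G x) * tail \<eta> \<delta> (x - a)) \<partial>lborel)" .
  have "(\<integral>\<^sup>+x. ennreal (- F x * ?P x) \<partial>lborel) = ennreal (\<integral>x. - F x * ?P x \<partial>lborel)"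
    using iP F_nonpos kernels_nonneg(2)[of "\<eta>\<^sup>2" n R]
    by (intro nn_integral_eq_integral) (auto intro!: AE_I2 mult_nonpos_nonneg)
  also have "\<dots> \<le> ennreal (log_bound \<delta> + (\<integral>x. ?g x * ?W \<eta> x - ?g x * ?W \<delta> x \<partial>lborel))"
    using main bQ bW by (intro ennreal_leI) (simp add: log_bound_def \<theta>_def)
  also have "\<dots> \<le> ennreal (log_bound \<delta>) + ennreal (\<integral>x. ?g x * ?W \<eta> x - ?g x * ?W \<delta> x \<partial>lborel)"
  proof (rule ennreal_add_le)
    show "0 \<le> log_bound \<delta>" unfolding log_bound_def using M0 riesz_const_pos[of n] l0 by simp
  qed
  also have "\<dots> \<le> ennreal (log_bound \<delta>) + (\<integral>\<^sup>+x. ennreal (indicator L x * norm (G x) * tail \<eta> \<delta> (x - a)) \<partial>lborel)"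
    by (intro add_left_mono bt)
  finally show ?thesis .
qed

text \<open>After Tonelli, convolution with the tail costs its L^1 norm, of order \<delta>^(1/2).
  The mean inequality with \<theta> = sqrt \<mu> balances \<theta> M, from the gradient, against
  \<mu> / \<theta>, from \<open>\<phi>\<close>; then \<delta> <= \<mu> turns \<delta>^(1/2) \<theta>
  into \<mu>.\<close>

lemma weighted_tail_bound:
  assumes \<eta>: "0 < \<eta>" "\<eta> \<le> \<delta>" and [measurable]: "\<phi> \<in> borel_measurable borel"
    and \<phi>: "\<And>a. 0 \<le> \<phi> a" "\<And>a. \<phi> a \<le> 1"
    and \<mu>: "(\<integral>\<^sup>+a. ennreal (\<phi> a) \<partial>lborel) \<le> ennreal \<mu>" "0 < \<mu>" "\<delta> \<le> \<mu>"
  shows "(\<integral>\<^sup>+a. \<integral>\<^sup>+x. ennreal (\<phi> a * (indicator L x * norm (G x) * tail \<eta> \<delta> (x - a))) \<partial>lborel \<partial>lborel)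
    \<le> ennreal (real n * riesz_const n * (M + 1) * \<mu>)"
proof -
  have d0: "0 < \<delta>" using \<eta> by simp
  define \<theta> where "\<theta> = sqrt \<mu>"
  have \<theta>: "0 < \<theta>" "\<theta> * \<theta> = \<mu>" using \<mu> by (auto simp: \<theta>_def)
  define u where "u = 2 * real n * riesz_const n * \<delta> powr (1/2)"
  have u0: "0 \<le> u" using riesz_const_pos[of n] by (simp add: u_def)
  have [measurable]: "tail \<eta> \<delta> \<in> borel_measurable borel" using tail_borel \<eta> d0 by blast
  have even: "tail \<eta> \<delta> (- y) = tail \<eta> \<delta> y" for y by (simp add: tail_def kernels_even)
  let ?t = "\<lambda>x a. tail \<eta> \<delta> (x - a)" and ?g = "\<lambda>x. indicator L x * (norm (G x))\<^sup>2"
  have t0: "0 \<le> ?t x a" for x a by (rule tail_nonneg[OF \<eta>])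
  have ut: "(\<integral>\<^sup>+y. ennreal (tail \<eta> \<delta> y) \<partial>lborel) \<le> ennreal u" unfolding u_def by (rule nn_integral_tail[OF \<eta>])
  have ux: "(\<integral>\<^sup>+x. ennreal (?t x a) \<partial>lborel) \<le> ennreal u" for a
    using ut by (subst nn_integral_lborel_translate[where h = "\<lambda>y. ennreal (tail \<eta> \<delta> y)"]) auto
  have ua: "(\<integral>\<^sup>+a. ennreal (?t x a) \<partial>lborel) \<le> ennreal u" for x
    using ut by (subst nn_integral_lborel_reflect_even[where h = "\<lambda>y. ennreal (tail \<eta> \<delta> y)"]) (auto simp: even)
  have pt: "ennreal (\<phi> a * (indicator L x * norm (G x) * ?t x a))
      \<le> ennreal (\<theta> / 2 * ?g x) * ennreal (?t x a) + ennreal (1 / (2 * \<theta>) * \<phi> a) * ennreal (?t x a)" for a x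
  proof -
    have "0 \<le> (\<theta> * norm (G x) - 1)\<^sup>2 / (2 * \<theta>)" using \<theta> by simp
    also have "\<dots> = \<theta> / 2 * (norm (G x))\<^sup>2 + 1 / (2 * \<theta>) - norm (G x)" using \<theta>(1) by (simp add: field_simps power2_eq_square)
    finally have "\<phi> a * norm (G x) \<le> \<phi> a * (\<theta> / 2 * (norm (G x))\<^sup>2 + 1 / (2 * \<theta>))"
      using \<phi>(1)[of a] by (intro mult_left_mono) auto
    also have "\<dots> \<le> 1 * (\<theta> / 2 * (norm (G x))\<^sup>2) + 1 / (2 * \<theta>) * \<phi> a"
      using mult_right_mono[OF \<phi>(2)[of a], of "\<theta> / 2 * (norm (G x))\<^sup>2"] \<theta> by (simp add: algebra_simps)
    finally have "\<phi> a * (indicator L x * norm (G x)) \<le> \<theta> / 2 * ?g x + 1 / (2 * \<theta>) * \<phi> a"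
      using \<phi>(1)[of a] \<theta> by (cases "x \<in> L") auto
    then have "\<phi> a * (indicator L x * norm (G x)) * ?t x a \<le> (\<theta> / 2 * ?g x + 1 / (2 * \<theta>) * \<phi> a) * ?t x a"
      by (intro mult_right_mono t0)
    then have "ennreal (\<phi> a * (indicator L x * norm (G x) * ?t x a)) \<le> ennreal (\<theta> / 2 * ?g x * ?t x a + 1 / (2 * \<theta>) * \<phi> a * ?t x a)"
      by (intro ennreal_leI) (simp add: algebra_simps)
    also have "\<dots> = ennreal (\<theta> / 2 * ?g x * ?t x a) + ennreal (1 / (2 * \<theta>) * \<phi> a * ?t x a)"
      using \<theta> \<phi>(1)[of a] t0[of x a] by (intro ennreal_plus) auto
    finally show ?thesis by (simp only: ennreal_mult''[OF t0])
  qed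
  have "(\<integral>\<^sup>+a. \<integral>\<^sup>+x. ennreal (\<phi> a * (indicator L x * norm (G x) * ?t x a)) \<partial>lborel \<partial>lborel)
    \<le> (\<integral>\<^sup>+a. \<integral>\<^sup>+x. ennreal (\<theta> / 2 * ?g x) * ennreal (?t x a) + ennreal (1 / (2 * \<theta>) * \<phi> a) * ennreal (?t x a) \<partial>lborel \<partial>lborel)"
    by (intro nn_integral_mono pt)
  also have "\<dots> = (\<integral>\<^sup>+a. (\<integral>\<^sup>+x. ennreal (\<theta> / 2 * ?g x) * ennreal (?t x a) \<partial>lborel)
      + ennreal (1 / (2 * \<theta>) * \<phi> a) * (\<integral>\<^sup>+x. ennreal (?t x a) \<partial>lborel) \<partial>lborel)"
    by (intro nn_integral_cong) (simp add: nn_integral_add nn_integral_cmult)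
  also have "\<dots> = (\<integral>\<^sup>+a. (\<integral>\<^sup>+x. ennreal (\<theta> / 2 * ?g x) * ennreal (?t x a) \<partial>lborel) \<partial>lborel)
      + (\<integral>\<^sup>+a. ennreal (1 / (2 * \<theta>) * \<phi> a) * (\<integral>\<^sup>+x. ennreal (?t x a) \<partial>lborel) \<partial>lborel)"
    by (rule nn_integral_add) measurable
  also have "(\<integral>\<^sup>+a. (\<integral>\<^sup>+x. ennreal (\<theta> / 2 * ?g x) * ennreal (?t x a) \<partial>lborel) \<partial>lborel)
      = (\<integral>\<^sup>+x. (\<integral>\<^sup>+a. ennreal (\<theta> / 2 * ?g x) * ennreal (?t x a) \<partial>lborel) \<partial>lborel)"
    by (rule nn_integral_Tonelli_lborel) measurable
  also have "\<dots> = (\<integral>\<^sup>+x. ennreal (\<theta> / 2 * ?g x) * (\<integral>\<^sup>+a. ennreal (?t x a) \<partial>lborel) \<partial>lborel)"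
    by (intro nn_integral_cong nn_integral_cmult) measurable
  also have "\<dots> \<le> (\<integral>\<^sup>+x. ennreal (\<theta> / 2 * u) * ennreal (?g x) \<partial>lborel)"
  proof (rule nn_integral_mono)
    fix x
    have "ennreal (\<theta> / 2 * ?g x) * (\<integral>\<^sup>+a. ennreal (?t x a) \<partial>lborel) \<le> ennreal (\<theta> / 2 * ?g x) * ennreal u"
      by (intro mult_left_mono ua) auto
    also have "\<dots> = ennreal (\<theta> / 2 * ?g x * u)" using \<theta> u0 by (intro ennreal_mult[symmetric]) auto
    also have "\<dots> = ennreal (\<theta> / 2 * u * ?g x)" by (simp only: mult_ac)
    also have "\<dots> = ennreal (\<theta> / 2 * u) * ennreal (?g x)" using \<theta> u0 by (intro ennreal_mult) auto
    finally show "ennreal (\<theta> / 2 * ?g x) * (\<integral>\<^sup>+a. ennreal (?t x a) \<partial>lborel) \<le> ennreal (\<theta> / 2 * u) * ennreal (?g x)" .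
  qed
  also have "\<dots> = ennreal (\<theta> / 2 * u) * (\<integral>\<^sup>+x. ennreal (?g x) \<partial>lborel)"
    by (rule nn_integral_cmult) measurable
  also have "\<dots> \<le> ennreal (\<theta> / 2 * u) * ennreal M" by (intro mult_left_mono G_bound) auto
  also have "\<dots> = ennreal (\<theta> / 2 * u * M)" using \<theta> u0 M0 by (intro ennreal_mult[symmetric]) auto
  also have "(\<integral>\<^sup>+a. ennreal (1 / (2 * \<theta>) * \<phi> a) * (\<integral>\<^sup>+x. ennreal (?t x a) \<partial>lborel) \<partial>lborel)
      \<le> (\<integral>\<^sup>+a. ennreal (1 / (2 * \<theta>) * u) * ennreal (\<phi> a) \<partial>lborel)"
  proof (rule nn_integral_mono)
    fix a
    have "ennreal (1 / (2 * \<theta>) * \<phi> a) * (\<integral>\<^sup>+x. ennreal (?t x a) \<partial>lborel) \<le> ennreal (1 / (2 * \<theta>) * \<phi> a) * ennreal u"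
      by (intro mult_left_mono ux) auto
    also have "\<dots> = ennreal (1 / (2 * \<theta>) * \<phi> a * u)" using \<theta> u0 \<phi>(1) by (intro ennreal_mult[symmetric]) auto
    also have "\<dots> = ennreal (1 / (2 * \<theta>) * u * \<phi> a)" by (simp only: mult_ac)
    also have "\<dots> = ennreal (1 / (2 * \<theta>) * u) * ennreal (\<phi> a)" using \<theta> u0 \<phi>(1) by (intro ennreal_mult) auto
    finally show "ennreal (1 / (2 * \<theta>) * \<phi> a) * (\<integral>\<^sup>+x. ennreal (?t x a) \<partial>lborel) \<le> ennreal (1 / (2 * \<theta>) * u) * ennreal (\<phi> a)" .
  qed
  also have "\<dots> = ennreal (1 / (2 * \<theta>) * u) * (\<integral>\<^sup>+a. ennreal (\<phi> a) \<partial>lborel)"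
    by (rule nn_integral_cmult) measurable
  also have "\<dots> \<le> ennreal (1 / (2 * \<theta>) * u) * ennreal \<mu>" by (intro mult_left_mono \<mu>) auto
  also have "\<dots> = ennreal (1 / (2 * \<theta>) * u * \<mu>)" using \<theta> u0 \<mu> by (intro ennreal_mult[symmetric]) auto
  also have "ennreal (\<theta> / 2 * u * M) + ennreal (1 / (2 * \<theta>) * u * \<mu>) = ennreal (\<theta> / 2 * u * M + 1 / (2 * \<theta>) * u * \<mu>)"
    using \<theta> u0 M0 \<mu> by (intro ennreal_plus[symmetric]) auto
  also have "\<dots> \<le> ennreal (real n * riesz_const n * (M + 1) * \<mu>)"
  proof (rule ennreal_leI)
    have "\<theta> / 2 * u * M + 1 / (2 * \<theta>) * u * \<mu> = u * (\<theta> / 2 * (M + 1))"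
      using \<theta>(1) unfolding \<theta>(2)[symmetric] by (simp add: field_simps)
    also have "\<dots> \<le> (2 * real n * riesz_const n * \<theta>) * (\<theta> / 2 * (M + 1))"
    proof (intro mult_right_mono)
      have "\<delta> powr (1/2) \<le> \<theta>" using d0 \<mu> by (simp add: powr_half_sqrt \<theta>_def)
      then show "u \<le> 2 * real n * riesz_const n * \<theta>"
        unfolding u_def using riesz_const_pos[of n] by (intro mult_left_mono) auto
    qed (use \<theta> M0 in auto)
    also have "\<dots> = real n * riesz_const n * (M + 1) * (\<theta> * \<theta>)" by (simp add: field_simps)
    finally show "\<theta> / 2 * u * M + 1 / (2 * \<theta>) * u * \<mu> \<le> real n * riesz_const n * (M + 1) * \<mu>"
      unfolding \<theta>(2) .
  qed
  finally show ?thesis by (simp add: add_mono)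
qed

text \<open>P has mass at least \<open>core_const\<close> and concentrates at 0, so convolution with
  it recovers \<open>\<phi>\<close> x up to the Lipschitz constant times its first moment.\<close>

lemma mollified_lower_bound:
  fixes \<phi> :: "'a \<Rightarrow> real"
  assumes \<eta>: "0 < \<eta>" "\<eta> \<le> R / 2" and [measurable]: "\<phi> \<in> borel_measurable borel"
    and \<phi>: "\<And>a. 0 \<le> \<phi> a" and Lip: "\<And>x y. \<bar>\<phi> x - \<phi> y\<bar> \<le> \<Lambda> * norm (x - y)" "0 \<le> \<Lambda>"
  shows "ennreal (core_const n R * \<phi> x)
    \<le> (\<integral>\<^sup>+a. ennreal (\<phi> a * Pker n R (\<eta>\<^sup>2) (x - a)) \<partial>lborel)
      + ennreal (4 * \<Lambda> * real n * riesz_const n * \<eta> powr (1/2))"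
proof -
  have e0: "0 < \<eta>\<^sup>2" using \<eta> by simp
  have [measurable]: "Pker n R (\<eta>\<^sup>2) \<in> borel_measurable borel" using borel_kernels e0 by blast
  let ?P = "\<lambda>a. Pker n R (\<eta>\<^sup>2) (x - a)"
  have P0: "0 \<le> Pker n R (\<eta>\<^sup>2) y" for y :: 'a by (rule kernels_nonneg) simp
  have "ennreal (core_const n R * \<phi> x) = ennreal (\<phi> x) * ennreal (core_const n R)"
    using \<phi> by (simp add: ennreal_mult' mult.commute)
  also have "\<dots> \<le> ennreal (\<phi> x) * (\<integral>\<^sup>+y. ennreal (Pker n R (\<eta>\<^sup>2) y) \<partial>(lborel :: 'a measure))"
    by (intro mult_left_mono nn_integral_Pker_ge[OF dim \<eta>]) auto
  also have "\<dots> = ennreal (\<phi> x) * (\<integral>\<^sup>+a. ennreal (?P a) \<partial>lborel)"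
    by (subst nn_integral_lborel_reflect_even[where h = "\<lambda>y. ennreal (Pker n R (\<eta>\<^sup>2) y)"]) (auto simp: kernels_even)
  also have "\<dots> = (\<integral>\<^sup>+a. ennreal (\<phi> x) * ennreal (?P a) \<partial>lborel)"
    by (rule nn_integral_cmult[symmetric]) measurable
  also have "\<dots> \<le> (\<integral>\<^sup>+a. ennreal (\<phi> a * ?P a) + ennreal (\<Lambda> * (norm (x - a) * ?P a)) \<partial>lborel)"
  proof (rule nn_integral_mono)
    fix a
    have "\<phi> x * ?P a \<le> (\<phi> a + \<Lambda> * norm (x - a)) * ?P a"
      using Lip(1)[of x a] by (intro mult_right_mono P0) auto
    then have "ennreal (\<phi> x * ?P a) \<le> ennreal (\<phi> a * ?P a + \<Lambda> * (norm (x - a) * ?P a))"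
      by (intro ennreal_leI) (simp add: algebra_simps)
    also have "\<dots> = ennreal (\<phi> a * ?P a) + ennreal (\<Lambda> * (norm (x - a) * ?P a))"
      using \<phi> Lip P0 by (intro ennreal_plus) auto
    finally show "ennreal (\<phi> x) * ennreal (?P a) \<le> ennreal (\<phi> a * ?P a) + ennreal (\<Lambda> * (norm (x - a) * ?P a))"
      using \<phi> by (simp add: ennreal_mult')
  qed
  also have "\<dots> = (\<integral>\<^sup>+a. ennreal (\<phi> a * ?P a) \<partial>lborel) + (\<integral>\<^sup>+a. ennreal (\<Lambda> * (norm (x - a) * ?P a)) \<partial>lborel)"
    by (rule nn_integral_add) measurable
  also have "(\<integral>\<^sup>+a. ennreal (\<Lambda> * (norm (x - a) * ?P a)) \<partial>lborel)
     = (\<integral>\<^sup>+y. ennreal (\<Lambda> * (norm y * Pker n R (\<eta>\<^sup>2) y)) \<partial>(lborel :: 'a measure))"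
    by (rule nn_integral_lborel_reflect_even[where h = "\<lambda>y. ennreal (\<Lambda> * (norm y * Pker n R (\<eta>\<^sup>2) y))"]) (auto simp: kernels_even)
  also have "\<dots> \<le> (\<integral>\<^sup>+y. ennreal (\<Lambda> * (2 * real n * \<eta> powr (1/2))) * ennreal (Rker n y) \<partial>(lborel :: 'a measure))"
  proof (rule nn_integral_mono)
    fix y :: 'a
    have "\<Lambda> * (norm y * Pker n R (\<eta>\<^sup>2) y) \<le> \<Lambda> * (2 * real n * \<eta> powr (1/2) * Rker n y)"
      using R \<eta> Lip by (intro mult_left_mono Pker_le_Rker) auto
    then show "ennreal (\<Lambda> * (norm y * Pker n R (\<eta>\<^sup>2) y)) \<le> ennreal (\<Lambda> * (2 * real n * \<eta> powr (1/2))) * ennreal (Rker n y)"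
      using Lip by (subst ennreal_mult'[symmetric]) (auto intro!: ennreal_leI simp: mult_ac)
  qed
  also have "\<dots> = ennreal (\<Lambda> * (2 * real n * \<eta> powr (1/2))) * (\<integral>\<^sup>+y. ennreal (Rker n y) \<partial>(lborel :: 'a measure))"
    by (rule nn_integral_cmult) measurable
  also have "\<dots> \<le> ennreal (\<Lambda> * (2 * real n * \<eta> powr (1/2))) * ennreal (2 * riesz_const n)"
    by (intro mult_left_mono nn_integral_Rker dim) auto
  also have "\<dots> = ennreal (4 * \<Lambda> * real n * riesz_const n * \<eta> powr (1/2))"
    using Lip riesz_const_pos[of n] by (subst ennreal_mult[symmetric]) (auto simp: mult_ac)
  finally show ?thesis by (simp add: add_left_mono)
qed

text \<open>The Lipschitz constant of \<open>\<phi>\<close> enters only an error that vanishes as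
  \<open>\<eta>\<close> tends to 0 with \<open>\<delta>\<close> fixed. So \<open>\<phi>\<close> may
  be arbitrarily steep and only the bound \<open>\<mu>\<close> of its integral counts, which is what
  admits sets of any shape.\<close>

lemma weighted_bound:
  fixes \<phi> :: "'a \<Rightarrow> real"
  assumes \<delta>: "0 < \<delta>" "\<delta> \<le> 1/2" and [measurable]: "\<phi> \<in> borel_measurable borel"
    and \<phi>: "\<And>a. 0 \<le> \<phi> a" "\<And>a. \<phi> a \<le> 1" "\<And>a. \<phi> a \<noteq> 0 \<Longrightarrow> a \<in> A"
    and Lip: "\<And>x y. \<bar>\<phi> x - \<phi> y\<bar> \<le> \<Lambda> * norm (x - y)" "0 \<le> \<Lambda>"
    and \<mu>: "(\<integral>\<^sup>+a. ennreal (\<phi> a) \<partial>lborel) \<le> ennreal \<mu>" "\<delta> \<le> \<mu>"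
  shows "(\<integral>\<^sup>+x. ennreal (- F x * \<phi> x) \<partial>lborel)
    \<le> ennreal ((log_bound \<delta> + real n * riesz_const n * (M + 1)) * \<mu> / core_const n R)"
proof -
  define K where "K = (log_bound \<delta> + real n * riesz_const n * (M + 1)) * \<mu>"
  define c where "c = core_const n R"
  have c0: "0 < c" unfolding c_def using R n1 by (intro core_const_pos)
  have \<mu>0: "0 < \<mu>" using \<delta> \<mu> by simp
  have lb0: "0 \<le> log_bound \<delta>" unfolding log_bound_def
    using M0 riesz_const_pos[of n] \<delta> by (intro add_nonneg_nonneg mult_nonneg_nonneg) (auto simp: field_simps)
  have K0: "0 \<le> K" unfolding K_def
    using lb0 M0 riesz_const_pos[of n] \<mu>0 by (intro mult_nonneg_nonneg add_nonneg_nonneg) auto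
  have Fn: "0 \<le> - F x" for x using F_nonpos[of x] by simp
  have iF\<phi>: "integrable lborel (\<lambda>x. F x * \<phi> x)"
    using \<phi> by (intro integrable_F_bounded[of _ 1]) auto
  define I where "I = (\<integral>x. - F x * \<phi> x \<partial>lborel)"
  have I: "(\<integral>\<^sup>+x. ennreal (- F x * \<phi> x) \<partial>lborel) = ennreal I" unfolding I_def
    using iF\<phi> Fn \<phi>(1) by (intro nn_integral_eq_integral AE_I2 mult_nonneg_nonneg) auto
  have I0: "0 \<le> I" unfolding I_def using Fn \<phi>(1) by (intro integral_nonneg_AE AE_I2 mult_nonneg_nonneg) auto
  \<comment> \<open>\<open>\<phi>\<close> is replaced by its convolution with P. Tonelli then leaves
    integrals over x with P centered at a, where \<open>inner_average_bound\<close> applies because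
    \<open>\<phi>\<close> vanishes outside A.\<close>
  have key: "c * I \<le> K + 4 * \<Lambda> * real n * riesz_const n * \<eta> powr (1/2) * M"
    if \<eta>: "0 < \<eta>" "\<eta> \<le> \<delta>" "\<eta> \<le> R / 2" for \<eta>
  proof -
    define \<epsilon> where "\<epsilon> = 4 * \<Lambda> * real n * riesz_const n * \<eta> powr (1/2)"
    have \<epsilon>0: "0 \<le> \<epsilon>" using Lip riesz_const_pos[of n] by (simp add: \<epsilon>_def)
    have e0: "0 < \<eta>\<^sup>2" using \<eta> by simp
    have [measurable]: "Pker n R (\<eta>\<^sup>2) \<in> borel_measurable borel" using borel_kernels e0 by blast
    have [measurable]: "tail \<eta> \<delta> \<in> borel_measurable borel" using tail_borel \<eta> \<delta> by blast
    let ?P = "\<lambda>x a. Pker n R (\<eta>\<^sup>2) (x - a)"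
    have P0: "0 \<le> ?P x a" for x a by (rule kernels_nonneg) simp
    have "ennreal (c * I) = ennreal c * (\<integral>\<^sup>+x. ennreal (- F x * \<phi> x) \<partial>lborel)"
      unfolding I using c0 by (intro ennreal_mult') simp
    also have "\<dots> = (\<integral>\<^sup>+x. ennreal c * ennreal (- F x * \<phi> x) \<partial>lborel)"
      by (rule nn_integral_cmult[symmetric]) measurable
    also have "\<dots> \<le> (\<integral>\<^sup>+x. ennreal (- F x) * (\<integral>\<^sup>+a. ennreal (\<phi> a * ?P x a) \<partial>lborel) + ennreal \<epsilon> * ennreal (- F x) \<partial>lborel)"
    proof (rule nn_integral_mono)
      fix x
      have "ennreal c * ennreal (- F x * \<phi> x) = ennreal (- F x) * ennreal (c * \<phi> x)"
        using c0 Fn[of x] \<phi>(1)[of x] by (simp add: ennreal_mult'[symmetric] mult_ac)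
      also have "\<dots> \<le> ennreal (- F x) * ((\<integral>\<^sup>+a. ennreal (\<phi> a * ?P x a) \<partial>lborel) + ennreal \<epsilon>)"
        unfolding c_def \<epsilon>_def using \<eta> \<phi> Lip by (intro mult_left_mono mollified_lower_bound) auto
      finally show "ennreal c * ennreal (- F x * \<phi> x)
          \<le> ennreal (- F x) * (\<integral>\<^sup>+a. ennreal (\<phi> a * ?P x a) \<partial>lborel) + ennreal \<epsilon> * ennreal (- F x)"
        by (simp only: distrib_left mult.commute)
    qed
    also have "\<dots> = (\<integral>\<^sup>+x. ennreal (- F x) * (\<integral>\<^sup>+a. ennreal (\<phi> a * ?P x a) \<partial>lborel) \<partial>lborel)
        + (\<integral>\<^sup>+x. ennreal \<epsilon> * ennreal (- F x) \<partial>lborel)"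
      by (rule nn_integral_add) measurable
    also have "(\<integral>\<^sup>+x. ennreal \<epsilon> * ennreal (- F x) \<partial>lborel) \<le> ennreal (\<epsilon> * M)"
    proof -
      have "(\<integral>\<^sup>+x. ennreal \<epsilon> * ennreal (- F x) \<partial>lborel) = ennreal \<epsilon> * (\<integral>\<^sup>+x. ennreal (- F x) \<partial>lborel)"
        by (rule nn_integral_cmult) measurable
      also have "(\<integral>\<^sup>+x. ennreal (- F x) \<partial>lborel) = ennreal (\<integral>x. - F x \<partial>lborel)"
        using F_int Fn by (intro nn_integral_eq_integral) auto
      also have "ennreal \<epsilon> * \<dots> \<le> ennreal \<epsilon> * ennreal M"
        using F_bound by (intro mult_left_mono ennreal_leI) auto
      also have "\<dots> = ennreal (\<epsilon> * M)" using \<epsilon>0 M0 by (intro ennreal_mult[symmetric])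
      finally show ?thesis .
    qed
    also have "(\<integral>\<^sup>+x. ennreal (- F x) * (\<integral>\<^sup>+a. ennreal (\<phi> a * ?P x a) \<partial>lborel) \<partial>lborel)
      = (\<integral>\<^sup>+x. (\<integral>\<^sup>+a. ennreal (\<phi> a) * ennreal (- F x * ?P x a) \<partial>lborel) \<partial>lborel)"
    proof (rule nn_integral_cong)
      fix x
      have "ennreal (- F x) * (\<integral>\<^sup>+a. ennreal (\<phi> a * ?P x a) \<partial>lborel) = (\<integral>\<^sup>+a. ennreal (- F x) * ennreal (\<phi> a * ?P x a) \<partial>lborel)"
        by (rule nn_integral_cmult[symmetric]) measurable
      also have "\<dots> = (\<integral>\<^sup>+a. ennreal (\<phi> a) * ennreal (- F x * ?P x a) \<partial>lborel)"
        using Fn[of x] \<phi>(1) by (intro nn_integral_cong) (simp only: ennreal_mult'[symmetric] mult_ac)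
      finally show "ennreal (- F x) * (\<integral>\<^sup>+a. ennreal (\<phi> a * ?P x a) \<partial>lborel)
          = (\<integral>\<^sup>+a. ennreal (\<phi> a) * ennreal (- F x * ?P x a) \<partial>lborel)" .
    qed
    also have "\<dots> = (\<integral>\<^sup>+a. (\<integral>\<^sup>+x. ennreal (\<phi> a) * ennreal (- F x * ?P x a) \<partial>lborel) \<partial>lborel)"
      by (rule nn_integral_Tonelli_lborel[symmetric]) measurable
    also have "\<dots> \<le> (\<integral>\<^sup>+a. ennreal (log_bound \<delta>) * ennreal (\<phi> a)
        + (\<integral>\<^sup>+x. ennreal (\<phi> a * (indicator L x * norm (G x) * tail \<eta> \<delta> (x - a))) \<partial>lborel) \<partial>lborel)"
    proof (rule nn_integral_mono)
      fix a
      let ?T = "\<lambda>x. indicator L x * norm (G x) * tail \<eta> \<delta> (x - a)"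
      have "(\<integral>\<^sup>+x. ennreal (\<phi> a) * ennreal (- F x * ?P x a) \<partial>lborel) = ennreal (\<phi> a) * (\<integral>\<^sup>+x. ennreal (- F x * ?P x a) \<partial>lborel)"
        by (rule nn_integral_cmult) measurable
      also have "\<dots> \<le> ennreal (\<phi> a) * (ennreal (log_bound \<delta>) + (\<integral>\<^sup>+x. ennreal (?T x) \<partial>lborel))"
      proof (cases "\<phi> a = 0")
        case False
        show ?thesis by (intro mult_left_mono inner_average_bound \<phi>(3)[OF False] \<eta> \<delta>) auto
      qed simp
      also have "\<dots> = ennreal (log_bound \<delta>) * ennreal (\<phi> a) + ennreal (\<phi> a) * (\<integral>\<^sup>+x. ennreal (?T x) \<partial>lborel)"
        by (simp only: distrib_left mult.commute)
      also have "ennreal (\<phi> a) * (\<integral>\<^sup>+x. ennreal (?T x) \<partial>lborel) = (\<integral>\<^sup>+x. ennreal (\<phi> a) * ennreal (?T x) \<partial>lborel)"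
        by (rule nn_integral_cmult[symmetric]) measurable
      also have "\<dots> = (\<integral>\<^sup>+x. ennreal (\<phi> a * ?T x) \<partial>lborel)"
        using \<phi>(1) by (intro nn_integral_cong ennreal_mult'[symmetric])
      finally show "(\<integral>\<^sup>+x. ennreal (\<phi> a) * ennreal (- F x * ?P x a) \<partial>lborel)
        \<le> ennreal (log_bound \<delta>) * ennreal (\<phi> a) + (\<integral>\<^sup>+x. ennreal (\<phi> a * ?T x) \<partial>lborel)" .
    qed
    also have "\<dots> = (\<integral>\<^sup>+a. ennreal (log_bound \<delta>) * ennreal (\<phi> a) \<partial>lborel)
        + (\<integral>\<^sup>+a. (\<integral>\<^sup>+x. ennreal (\<phi> a * (indicator L x * norm (G x) * tail \<eta> \<delta> (x - a))) \<partial>lborel) \<partial>lborel)"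
      by (rule nn_integral_add) measurable
    also have "\<dots> \<le> ennreal (log_bound \<delta> * \<mu>) + ennreal (real n * riesz_const n * (M + 1) * \<mu>)"
    proof (rule add_mono)
      have "(\<integral>\<^sup>+a. ennreal (log_bound \<delta>) * ennreal (\<phi> a) \<partial>lborel) = ennreal (log_bound \<delta>) * (\<integral>\<^sup>+a. ennreal (\<phi> a) \<partial>lborel)"
        by (rule nn_integral_cmult) measurable
      also have "\<dots> \<le> ennreal (log_bound \<delta>) * ennreal \<mu>" by (intro mult_left_mono \<mu>) auto
      also have "\<dots> = ennreal (log_bound \<delta> * \<mu>)" using lb0 \<mu>0 by (intro ennreal_mult[symmetric]) auto
      finally show "(\<integral>\<^sup>+a. ennreal (log_bound \<delta>) * ennreal (\<phi> a) \<partial>lborel) \<le> ennreal (log_bound \<delta> * \<mu>)" .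
    qed (use weighted_tail_bound[OF \<eta>(1,2) _ \<phi>(1,2) \<mu>(1) \<mu>0 \<mu>(2)] in simp)
    also have "\<dots> = ennreal K"
      unfolding K_def distrib_right using lb0 \<mu>0 M0 riesz_const_pos[of n] by (intro ennreal_plus[symmetric]) auto
    finally have "ennreal (c * I) \<le> ennreal K + ennreal (\<epsilon> * M)" by (simp add: add_mono)
    also have "\<dots> = ennreal (K + \<epsilon> * M)" using K0 \<epsilon>0 M0 by (intro ennreal_plus[symmetric]) auto
    finally show ?thesis
      using K0 \<epsilon>0 M0 unfolding \<epsilon>_def by (subst (asm) ennreal_le_iff) auto
  qed
  have lim: "((\<lambda>\<eta>. K + 4 * \<Lambda> * real n * riesz_const n * \<eta> powr (1/2) * M) \<longlongrightarrow> K + 4 * \<Lambda> * real n * riesz_const n * 0 powr (1/2) * M) (at_right 0)"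
    by (intro tendsto_intros tendsto_powr') (auto intro!: eventually_at_right_less[THEN eventually_mono])
  have "\<forall>\<^sub>F \<eta> in at_right 0. c * I \<le> K + 4 * \<Lambda> * real n * riesz_const n * \<eta> powr (1/2) * M"
    using R \<delta> unfolding eventually_at_right_field
    by (intro exI[of _ "min \<delta> (R / 2)"]) (auto intro!: key)
  from tendsto_lowerbound[OF lim this] have "c * I \<le> K" by simp
  then have "I \<le> K / c" using c0 by (simp add: field_simps)
  then show ?thesis unfolding I K_def[symmetric] c_def[symmetric] by (rule ennreal_leI)
qed

end

section \<open>Sublevel sets\<close>

context radial_energy
begin

text \<open>The 2 comes from a test weight whose integral is at most twice the measure of C. The
  summands collect the constant and the square root coefficient of \<open>log_bound\<close> and the
  tail term.\<close>

definition level_const :: real where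
  "level_const = 2 / core_const n R *
     (4 * real n * M + (M + 4 * riesz_const n) / 2 + real n * riesz_const n * (M + 1))"

lemma level_const_pos: "0 < level_const"
proof -
  have "0 < 2 / core_const n R" using core_const_pos[OF R(1) n1] by simp
  moreover have "0 < 4 * real n * M + (M + 4 * riesz_const n) / 2 + real n * riesz_const n * (M + 1)"
    using M0 riesz_const_pos[of n] n1 by (intro add_nonneg_pos add_nonneg_nonneg mult_pos_pos mult_nonneg_nonneg) auto
  ultimately show ?thesis unfolding level_const_def by (rule mult_pos_pos)
qed

text \<open>\<open>weighted_bound\<close> for a weight that is 1 on C and has integral at most 2
  |C|: both sides are proportional to |C|, which cancels and survives only in the logarithm through
  \<open>\<delta>\<close>.\<close>

lemma level_le_sqrt_log:
  assumes C: "compact C" "0 < measure lborel C" and \<kappa>: "0 < \<kappa>0" "(\<Union>x\<in>C. ball x \<kappa>0) \<subseteq> A"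
    and s: "0 \<le> s" "\<And>x. x \<in> C \<Longrightarrow> F x \<le> - s"
  defines "\<delta> \<equiv> min (1/2) (measure lborel C)"
  shows "s \<le> level_const * (1 + sqrt (ln (1 / \<delta>)))"
proof -
  have Cb: "C \<in> sets borel" using C by (simp add: compact_imp_closed)
  have Ce: "C \<noteq> {}" using C by auto
  define m where "m = measure lborel C"
  have m: "0 < m" using C by (simp add: m_def)
  have em: "emeasure lborel C = ennreal m"
    unfolding m_def using emeasure_compact_finite[OF C(1)] by (intro emeasure_eq_ennreal_measure) simp
  have Cl: "C \<in> sets lebesgue" using Cb by (intro sets_completionI_sets) simp
  obtain U where U: "open U" "C \<subseteq> U" "U - C \<in> lmeasurable" "emeasure lebesgue (U - C) < ennreal m"
    by (rule sets_lebesgue_outer_open[OF Cl m])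
  have emU: "emeasure lborel U \<le> ennreal (2 * m)"
  proof -
    have "emeasure lborel (U - C) \<le> ennreal m"
      using U Cb by (simp add: emeasure_completion less_imp_le)
    then have "emeasure lborel C + emeasure lborel (U - C) \<le> ennreal m + ennreal m" unfolding em by (rule add_left_mono)
    moreover have "emeasure lborel C + emeasure lborel (U - C) = emeasure lborel U"
      using U Cb by (subst plus_emeasure) (auto simp: Un_absorb1)
    ultimately show ?thesis using m by (simp add: ennreal_plus[symmetric] del: ennreal_plus)
  qed
  obtain \<kappa>1 where \<kappa>1: "\<kappa>1 > 0" "(\<Union>x\<in>C. ball x \<kappa>1) \<subseteq> U"
    using compact_subset_open_imp_ball_epsilon_subset[OF C(1) U(1,2)] by blast
  define \<kappa> where "\<kappa> = min \<kappa>0 \<kappa>1"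
  have k: "0 < \<kappa>" using \<kappa> \<kappa>1 by (simp add: \<kappa>_def)
  \<comment> \<open>A tent over C: 1 on C and supported within distance \<open>\<kappa>\<close> of
    it, hence in A and in the open set U of measure at most 2 |C|. Its slope 1 /
    \<open>\<kappa>\<close> leaves no trace in the bound.\<close>
  define \<phi> where "\<phi> x = max 0 (1 - infdist x C / \<kappa>)" for x
  have \<phi>0: "0 \<le> \<phi> x" "\<phi> x \<le> 1" for x using k infdist_nonneg[of x C] by (auto simp: \<phi>_def)
  have \<phi>C: "\<phi> x = 1" if "x \<in> C" for x using that by (simp add: \<phi>_def)
  have supp: "\<exists>c\<in>C. x \<in> ball c \<kappa>" if "\<phi> x \<noteq> 0" for x
  proof -
    have "infdist x C < \<kappa>" using that k by (auto simp: \<phi>_def max_def field_simps split: if_splits)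
    moreover obtain c where "c \<in> C" "infdist x C = dist x c"
      using infdist_attains_inf[OF compact_imp_closed[OF C(1)] Ce] by blast
    ultimately show ?thesis by (auto simp: dist_commute)
  qed
  have cont: "continuous_on UNIV \<phi>" unfolding \<phi>_def using k by (intro continuous_intros) auto
  have [measurable]: "\<phi> \<in> borel_measurable borel" by (rule borel_measurable_continuous_onI[OF cont])
  have Lip: "\<bar>\<phi> x - \<phi> y\<bar> \<le> 1 / \<kappa> * norm (x - y)" for x y
  proof -
    have "\<bar>\<phi> x - \<phi> y\<bar> \<le> \<bar>(1 - infdist x C / \<kappa>) - (1 - infdist y C / \<kappa>)\<bar>" unfolding \<phi>_def by linarith
    also have "\<dots> = \<bar>infdist y C - infdist x C\<bar> / \<kappa>" using k by (simp add: diff_divide_distrib[symmetric])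
    also have "\<dots> \<le> dist y x / \<kappa>" using k infdist_triangle_abs[of y C x] by (intro divide_right_mono) auto
    finally show ?thesis by (simp add: dist_norm norm_minus_commute)
  qed
  have d: "0 < \<delta>" "\<delta> \<le> 1/2" "\<delta> \<le> 2 * m" using m by (auto simp: \<delta>_def m_def)
  have \<mu>: "(\<integral>\<^sup>+a. ennreal (\<phi> a) \<partial>lborel) \<le> ennreal (2 * m)"
  proof -
    have "(\<integral>\<^sup>+a. ennreal (\<phi> a) \<partial>lborel) \<le> (\<integral>\<^sup>+a. indicator U a \<partial>lborel)"
    proof (rule nn_integral_mono)
      fix a
      show "ennreal (\<phi> a) \<le> indicator U a"
      proof (cases "\<phi> a = 0")
        case False
        then obtain c where "c \<in> C" "a \<in> ball c \<kappa>" using supp by blast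
        then have "a \<in> U" using \<kappa>1 by (force simp: \<kappa>_def)
        then show ?thesis using \<phi>0[of a] by simp
      qed simp
    qed
    also have "\<dots> = emeasure lborel U" using U by simp
    finally show ?thesis using emU by simp
  qed
  have A: "a \<in> A" if nz: "\<phi> a \<noteq> 0" for a
  proof -
    obtain c where "c \<in> C" "a \<in> ball c \<kappa>" using supp[OF nz] by blast
    then show ?thesis using \<kappa> by (force simp: \<kappa>_def)
  qed
  have Lam: "0 \<le> 1 / \<kappa>" using k by simp
  have "ennreal (s * m) = (\<integral>\<^sup>+x. ennreal s * indicator C x \<partial>lborel)"
    using Cb s by (simp add: nn_integral_cmult_indicator em ennreal_mult')
  also have "\<dots> \<le> (\<integral>\<^sup>+x. ennreal (- F x * \<phi> x) \<partial>lborel)"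
    by (intro nn_integral_mono) (auto simp: indicator_def \<phi>C intro!: ennreal_leI dest!: s(2))
  also have "\<dots> \<le> ennreal ((log_bound \<delta> + real n * riesz_const n * (M + 1)) * (2 * m) / core_const n R)"
    by (rule weighted_bound[OF d(1,2) _ \<phi>0 A Lip Lam \<mu> d(3)]) measurable
  finally have le: "ennreal (s * m) \<le> ennreal ((log_bound \<delta> + real n * riesz_const n * (M + 1)) * (2 * m) / core_const n R)" .
  define q where "q = sqrt (ln (1 / \<delta>))"
  have q: "0 \<le> q" using d by (auto simp: q_def field_simps)
  have c0: "0 < core_const n R" using core_const_pos[OF R(1) n1] .
  have lb: "0 \<le> log_bound \<delta> + real n * riesz_const n * (M + 1)"
    unfolding log_bound_def q_def[symmetric] using M0 riesz_const_pos[of n] q by (intro add_nonneg_nonneg mult_nonneg_nonneg) auto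
  have "s * m \<le> (log_bound \<delta> + real n * riesz_const n * (M + 1)) * (2 * m) / core_const n R"
    using le lb m c0 by (subst (asm) ennreal_le_iff) auto
  also have "\<dots> = (2 / core_const n R * (log_bound \<delta> + real n * riesz_const n * (M + 1))) * m" by simp
  finally have "s \<le> 2 / core_const n R * (log_bound \<delta> + real n * riesz_const n * (M + 1))"
    using m by (simp only: mult_le_cancel_right_pos)
  also have "\<dots> \<le> 2 / core_const n R * ((4 * real n * M + (M + 4 * riesz_const n) / 2 + real n * riesz_const n * (M + 1)) * (1 + q))"
  proof (rule mult_left_mono)
    have "0 \<le> 4 * real n * M * q" "0 \<le> real n * riesz_const n * (M + 1) * q" "0 \<le> (M + 4 * riesz_const n) / 2"
      using M0 riesz_const_pos[of n] q by (auto intro!: mult_nonneg_nonneg)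
    then show "log_bound \<delta> + real n * riesz_const n * (M + 1)
      \<le> (4 * real n * M + (M + 4 * riesz_const n) / 2 + real n * riesz_const n * (M + 1)) * (1 + q)"
      unfolding log_bound_def q_def[symmetric] by (simp add: distrib_left distrib_right)
  qed (use c0 in simp)
  also have "\<dots> = level_const * (1 + q)" by (simp add: level_const_def)
  finally show ?thesis by (simp add: q_def)
qed

text \<open>Inverts s <= k (1 + sqrt l), where k is \<open>level_const\<close> and l is ln (1 /
  \<delta>). For s > 2 k, half of s absorbs the 1 and the square gives the Gaussian. For smaller s
  the exponential is at least exp (-1) >= 1/3, so 3 V already dominates the measure.\<close>

lemma measure_compact_le_exp:
  assumes C: "compact C" "measure lborel C \<le> V" and \<kappa>: "0 < \<kappa>0" "(\<Union>x\<in>C. ball x \<kappa>0) \<subseteq> A"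
    and s: "0 \<le> s" "\<And>x. x \<in> C \<Longrightarrow> F x \<le> - s"
  shows "measure lborel C \<le> (1 + 3 * V) * exp (- s\<^sup>2 / (4 * level_const\<^sup>2))"
proof (cases "measure lborel C = 0")
  case True
  then show ?thesis using C by simp
next
  case False
  define m where "m = measure lborel C"
  have m: "0 < m" "m \<le> V" using False C by (auto simp: m_def less_le)
  define \<delta> where "\<delta> = min (1/2) m"
  have d: "0 < \<delta>" "\<delta> \<le> 1/2" using m by (auto simp: \<delta>_def)
  note K0 = level_const_pos
  let ?K = level_const
  let ?E = "exp (- s\<^sup>2 / (4 * ?K\<^sup>2))"
  have le: "s \<le> ?K * (1 + sqrt (ln (1 / \<delta>)))"
    unfolding \<delta>_def m_def using m by (intro level_le_sqrt_log[OF C(1) _ \<kappa> s]) (auto simp: m_def)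
  show ?thesis
  proof (cases "s \<le> 2 * ?K")
    case True
    then have "s\<^sup>2 \<le> (2 * ?K)\<^sup>2" using s by (intro power_mono) auto
    then have "s\<^sup>2 / (4 * ?K\<^sup>2) \<le> 1" using K0 by (simp add: power_mult_distrib)
    then have "exp (-1) \<le> ?E" by simp
    moreover have "1 / 3 \<le> exp (-1::real)" using exp_le by (simp add: exp_minus field_simps)
    ultimately have "1 / 3 \<le> ?E" by (rule order_trans[rotated])
    then have "(3 * V) * (1 / 3) \<le> (1 + 3 * V) * ?E"
      using m by (intro mult_mono[OF _ \<open>1 / 3 \<le> ?E\<close>]) auto
    then show ?thesis using m by (simp add: m_def)
  next
    case False
    define l where "l = ln (1 / \<delta>)"
    have l0: "0 \<le> l" using d by (auto simp: l_def field_simps)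
    have "s / ?K \<le> 1 + sqrt l" using le K0 by (simp add: l_def field_simps)
    moreover have "1 \<le> s / (2 * ?K)" using False K0 by (simp add: field_simps)
    moreover have "s / ?K = s / (2 * ?K) + s / (2 * ?K)" by simp
    ultimately have "s / (2 * ?K) \<le> sqrt l" by linarith
    then have "(s / (2 * ?K))\<^sup>2 \<le> (sqrt l)\<^sup>2" using s K0 by (intro power_mono) auto
    then have "s\<^sup>2 / (4 * ?K\<^sup>2) \<le> l" using l0 by (simp add: power_divide power_mult_distrib)
    then have "exp (- l) \<le> ?E" by simp
    moreover have "exp (- l) = \<delta>" using d by (simp add: l_def ln_div)
    \<comment> \<open>Either \<delta> = m, or m exceeds 1/2 and \<delta> = 1/2; then m <= V does
      it.\<close>
    moreover have "m \<le> (1 + 3 * V) * \<delta>"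
    proof (cases "m \<le> 1/2")
      case True
      then show ?thesis using m by (simp add: \<delta>_def algebra_simps)
    next
      case False
      then have half: "\<delta> = 1/2" by (simp add: \<delta>_def)
      show ?thesis unfolding half using m by simp
    qed
    moreover have "(1 + 3 * V) * \<delta> \<le> (1 + 3 * V) * ?E"
      using m calculation by (intro mult_left_mono) auto
    ultimately show ?thesis by (simp add: m_def)
  qed
qed

text \<open>Inner regularity: closed subsets of the sublevel set are compact, and the constant found
  for them involves only the measure of K, so it survives the approximation.\<close>

lemma measure_sublevel_le_exp:
  assumes K: "compact K" and \<kappa>: "0 < \<kappa>0" "(\<Union>x\<in>K. ball x \<kappa>0) \<subseteq> A" and s: "0 \<le> s"
  shows "measure lborel {x\<in>K. F x < - s} \<le> (1 + 3 * measure lborel K) * exp (- s\<^sup>2 / (4 * level_const\<^sup>2))"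
proof (rule field_le_epsilon)
  fix \<epsilon> :: real assume \<epsilon>: "0 < \<epsilon>"
  let ?E = "{x\<in>K. F x < - s}"
  have Kb [measurable]: "K \<in> sets borel" using K by (simp add: compact_imp_closed)
  have Eb: "?E \<in> sets borel" by measurable
  have Kf: "emeasure lborel K < \<infinity>" by (rule emeasure_compact_finite[OF K])
  have El: "?E \<in> sets lebesgue" using Eb by (intro sets_completionI_sets) simp
  obtain C where C: "closed C" "C \<subseteq> ?E" "?E - C \<in> lmeasurable" "emeasure lebesgue (?E - C) < ennreal \<epsilon>"
    by (rule sets_lebesgue_inner_closed[OF El \<epsilon>])
  have "K \<inter> C = C" using C by blast
  then have cC: "compact C" using compact_Int_closed[OF K C(1)] by simp
  have Cb: "C \<in> sets borel" using C by simp
  have fin: "emeasure lborel X \<noteq> \<infinity>" if "X \<subseteq> K" for X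
    using Kf emeasure_mono[OF that, of lborel] Kb by (auto simp: top_unique)
  have "measure lborel ?E = measure lborel C + measure lborel (?E - C)"
    using C Cb Eb fin[of ?E] fin[of C] fin[of "?E - C"] measure_Union[of lborel C "?E - C"] by (auto simp: Un_absorb1)
  moreover have "measure lborel (?E - C) \<le> \<epsilon>"
  proof -
    have "emeasure lborel (?E - C) \<le> ennreal \<epsilon>" using C Cb Eb by (simp add: emeasure_completion less_imp_le)
    then show ?thesis using \<epsilon> by (simp add: measure_def enn2real_leI)
  qed
  moreover have "measure lborel C \<le> (1 + 3 * measure lborel K) * exp (- s\<^sup>2 / (4 * level_const\<^sup>2))"
  proof (rule measure_compact_le_exp[OF cC _ \<kappa>(1) _ s])
    show "measure lborel C \<le> measure lborel K"
      using C Cb Kf by (intro measure_mono_fmeasurable) (auto simp: fmeasurable_def)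
  qed (use C \<kappa> in \<open>force+\<close>)
  ultimately show "measure lborel ?E \<le> (1 + 3 * measure lborel K) * exp (- s\<^sup>2 / (4 * level_const\<^sup>2)) + \<epsilon>" by linarith
qed

end

section \<open>Passage to Borel representatives\<close>

lemma test_fun_ddir:
  assumes "\<phi> \<in> test_fun \<Omega>"
  shows "ddir v \<phi> \<in> test_fun \<Omega>"
proof -
  obtain C where C: "compact C" "C \<subseteq> \<Omega>" "\<And>x. x \<notin> C \<Longrightarrow> \<phi> x = 0"
    using test_fun_support[OF assms] by blast
  have "ddir v \<phi> x = 0" if x: "x \<notin> C" for x
  proof -
    have "open (- C)" using C(1) by (simp add: compact_imp_closed open_Compl)
    then have "(\<phi> has_derivative (\<lambda>v. 0)) (at x)"
      by (rule has_derivative_transform_within_open[OF has_derivative_const]) (simp_all add: x C(3))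
    from ddir_eqI[OF this] show ?thesis .
  qed
  then show ?thesis
    using C by (intro test_funI[of _ C] smooth_ddir test_fun_smooth[OF assms]) auto
qed

lemma L2_const_one:
  fixes \<Omega> :: "'a::euclidean_space set"
  assumes "open \<Omega>" "bounded \<Omega>"
  shows "L2_on \<Omega> (\<lambda>_. 1)"
proof -
  have "emeasure lebesgue \<Omega> < \<infinity>"
    using bounded_set_imp_lmeasurable[OF assms(2)] assms(1) by (simp add: fmeasurable_def)
  then have "emeasure (lebesgue_on \<Omega>) (space (lebesgue_on \<Omega>)) < \<infinity>"
    using assms(1) by (simp add: emeasure_restrict_space)
  then have "integrable (lebesgue_on \<Omega>) (\<lambda>_. 1::real)"
    by (intro finite_measure.integrable_const finite_measureI) auto
  then show ?thesis by (simp add: L2_on_def)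
qed

lemma integrable_L2_test:
  fixes \<Omega> :: "'a::euclidean_space set"
  assumes "open \<Omega>" "bounded \<Omega>" "L2_on \<Omega> u" "(\<lambda>z. complex_of_real (r z)) \<in> test_fun \<Omega>"
  shows "integrable (lebesgue_on \<Omega>) (\<lambda>z. u z * r z)"
  using integrable_Re[OF integrable_L2_product_test[OF assms(3) L2_const_one[OF assms(1,2)] assms(4)]] by simp

text \<open>Each weak derivative is tested on the component \<open>?\<psi>\<close> b of the field (z
  - a) W. In the divergence, 2n W from the dimension meets -2n t s W from the power, leaving 2n e s
  W = P because 1 - t s = e s; differentiating the cutoff gives -Q.\<close>

lemma weak_divergence_radial:
  fixes f :: "'a::euclidean_space \<Rightarrow> real"
  assumes \<Omega>: "open \<Omega>" "bounded \<Omega>" and f: "f \<in> W12 \<Omega>" and dim: "DIM('a) = 2 * n"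
    and R: "0 < R" "cball a R \<subseteq> \<Omega>" and e: "0 < e"
  shows "(LINT z|lebesgue_on \<Omega>. f z * (Pker n R e (z - a) - Qker n R e (z - a)))
    = - (LINT z|lebesgue_on \<Omega>. (\<Sum>b\<in>Basis. wgrad \<Omega> f b z * ((z - a) \<bullet> b)) * Wker n R e (z - a))"
proof -
  have n1: "1 \<le> n" using dim DIM_positive[where 'a='a] by linarith
  let ?t = "\<lambda>z. (z - a) \<bullet> (z - a)"
  let ?s = "\<lambda>z. inverse (?t z + e)"
  let ?W = "\<lambda>z. Wker n R e (z - a)"
  define W' where "W' z = - (real n * ?s z ^ (n + 1) * cutoff n 0 R a z)
        - real n * ?t z ^ (n - 1) * ?s z ^ n * cutoff n 2 R a z" for z
  have W: "?W = (\<lambda>z. ?s z ^ n * cutoff n 0 R a z)" by (simp add: Wker_def cutoff_def)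
  have dW: "(?W has_derivative (\<lambda>v. W' z * (2 * ((z - a) \<bullet> v)))) (at z)" for z
    unfolding W W'_def by (rule radial_kernel_has_derivative[OF e])
  have dz: "((\<lambda>z. (z - a) \<bullet> b) has_derivative (\<lambda>v. v \<bullet> b)) (at z)" for z b
    using has_derivative_inner_left[OF has_derivative_diff[OF has_derivative_ident has_derivative_const[of a]], of b] by simp
  let ?\<psi> = "\<lambda>b z. ?W z * ((z - a) \<bullet> b)"
  define D where "D b z = ?W z * (b \<bullet> b) + W' z * (2 * ((z - a) \<bullet> b)) * ((z - a) \<bullet> b)" for b z
  have tW: "(\<lambda>z. complex_of_real (?W z)) \<in> test_fun \<Omega>"
    using cutoff_nonneg_test[of R a \<Omega> "\<lambda>z. ?s z ^ n" n 0] R smooth_kernel[OF e, of a n] e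
    unfolding fun_cong[OF W] nonneg_test_def by (auto intro!: zero_le_power add_nonneg_nonneg)
  have t\<psi>: "(\<lambda>z. complex_of_real (?\<psi> b z)) \<in> test_fun \<Omega>" for b
    unfolding of_real_mult
    by (intro test_fun_mult tW smooth_of_real smooth_inner smooth_diff smooth_id smooth_const)
  have dd: "ddir b (\<lambda>z. complex_of_real (?\<psi> b z)) z = of_real (D b z)" for b z
  proof -
    have "(?\<psi> b has_derivative (\<lambda>v. ?W z * (v \<bullet> b) + W' z * (2 * ((z - a) \<bullet> v)) * ((z - a) \<bullet> b))) (at z)"
      by (rule has_derivative_mult[OF dW dz])
    from ddir_eqI[OF bounded_linear.has_derivative[OF bounded_linear_of_real this]] show ?thesis
      by (simp add: D_def)
  qed
  have tD: "(\<lambda>z. complex_of_real (D b z)) \<in> test_fun \<Omega>" for b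
    using test_fun_ddir[OF t\<psi>[of b], of b] unfolding dd[abs_def] .
  have fL: "L2_on \<Omega> f" using f by (simp add: W12_def)
  have each: "(LINT z|lebesgue_on \<Omega>. f z * D b z) = - (LINT z|lebesgue_on \<Omega>. wgrad \<Omega> f b z * ?\<psi> b z)" if b: "b \<in> Basis" for b
  proof -
    have "(LINT z|lebesgue_on \<Omega>. of_real (f z) * ddir b (\<lambda>z. complex_of_real (?\<psi> b z)) z)
        = - (LINT z|lebesgue_on \<Omega>. of_real (wgrad \<Omega> f b z) * complex_of_real (?\<psi> b z))"
      using weak_deriv_wgrad[OF f b] t\<psi>[of b] unfolding weak_deriv_def by blast
    then show ?thesis unfolding dd of_real_mult[symmetric]
      by (simp only: integral_complex_of_real of_real_minus[symmetric] of_real_eq_iff)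
  qed
  have sumD: "(\<Sum>b\<in>Basis. D b z) = Pker n R e (z - a) - Qker n R e (z - a)" for z
  proof -
    have te: "?t z + e > 0" using e by (simp add: add_nonneg_pos)
    have ts: "?t z * ?s z = 1 - e * ?s z" using te by (simp add: field_simps)
    have "(\<Sum>b\<in>Basis. D b z) = ?W z * real DIM('a) + 2 * W' z * (\<Sum>b\<in>Basis. ((z - a) \<bullet> b) * ((z - a) \<bullet> b))"
      by (simp add: D_def sum.distrib sum_distrib_left mult_ac)
    also have "(\<Sum>b\<in>Basis. ((z - a) \<bullet> b) * ((z - a) \<bullet> b)) = ?t z" by (rule euclidean_inner[symmetric])
    also have "?W z * real DIM('a) + 2 * W' z * ?t z
        = 2 * real n * (?s z ^ n * cutoff n 0 R a z * (1 - ?t z * ?s z)) - 2 * real n * ((?t z ^ (n - 1) * ?t z) * ?s z ^ n * cutoff n 2 R a z)"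
      unfolding fun_cong[OF W] W'_def dim by (simp add: algebra_simps)
    also have "?t z ^ (n - 1) * ?t z = ?t z ^ n" using n1 by (cases n) auto
    finally show ?thesis
      unfolding ts by (simp add: Pker_def Qker_def cutoff_translate mult_ac)
  qed
  have "(LINT z|lebesgue_on \<Omega>. f z * (Pker n R e (z - a) - Qker n R e (z - a)))
      = (LINT z|lebesgue_on \<Omega>. (\<Sum>b\<in>Basis. f z * D b z))"
    by (simp only: sumD[symmetric] sum_distrib_left)
  also have "\<dots> = (\<Sum>b\<in>Basis. (LINT z|lebesgue_on \<Omega>. f z * D b z))"
    by (intro Bochner_Integration.integral_sum integrable_L2_test \<Omega> fL tD)
  also have "\<dots> = - (\<Sum>b\<in>Basis. (LINT z|lebesgue_on \<Omega>. wgrad \<Omega> f b z * ?\<psi> b z))"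
    by (simp add: each sum_negf)
  also have "(\<Sum>b\<in>Basis. (LINT z|lebesgue_on \<Omega>. wgrad \<Omega> f b z * ?\<psi> b z))
      = (LINT z|lebesgue_on \<Omega>. (\<Sum>b\<in>Basis. wgrad \<Omega> f b z * ?\<psi> b z))"
    by (intro Bochner_Integration.integral_sum[symmetric] integrable_L2_test \<Omega> L2_wgrad[OF f] t\<psi>)
  also have "(\<lambda>z. \<Sum>b\<in>Basis. wgrad \<Omega> f b z * ?\<psi> b z) = (\<lambda>z. (\<Sum>b\<in>Basis. wgrad \<Omega> f b z * ((z - a) \<bullet> b)) * ?W z)"
    unfolding sum_distrib_right by (simp only: mult_ac)
  finally show ?thesis .
qed

text \<open>The averaging argument applies Tonelli to \<open>lborel\<close> and so wants Borel
  functions on the whole space, while \<open>W12\<close> supplies Lebesgue measurable ones on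
  \<open>\<Omega>\<close>.\<close>

lemma lebesgue_on_borel_representative:
  fixes u :: "'a::euclidean_space \<Rightarrow> real"
  assumes "open \<Omega>" "u \<in> borel_measurable (lebesgue_on \<Omega>)"
  obtains v where "v \<in> borel_measurable borel" "AE x in lborel. x \<in> \<Omega> \<longrightarrow> v x = u x"
proof -
  have "(\<lambda>x. if x \<in> \<Omega> then u x else 0) \<in> borel_measurable lebesgue"
    using assms by (intro borel_measurable_if_I) auto
  then obtain v where "v \<in> borel_measurable lborel" "AE x in lborel. (if x \<in> \<Omega> then u x else 0) = v x"
    using completion_ex_borel_measurable_real by blast
  then show ?thesis by (intro that[of v]) auto
qed

lemma lebesgue_on_transfer:
  fixes P :: "'a::euclidean_space \<Rightarrow> real"
  assumes \<Omega>: "open \<Omega>" and P [measurable]: "P \<in> borel_measurable borel" and p: "integrable (lebesgue_on \<Omega>) p"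
    and ae: "AE x in lborel. x \<in> \<Omega> \<longrightarrow> P x = p x" and out: "\<And>x. x \<notin> \<Omega> \<Longrightarrow> P x = 0"
  shows "integrable lborel P" "(\<integral>x. P x \<partial>lborel) = (LINT x|lebesgue_on \<Omega>. p x)"
proof -
  have \<Omega>l: "\<Omega> \<in> sets lebesgue" using \<Omega> by simp
  have ae': "AE x in lebesgue_on \<Omega>. p x = P x"
    using AE_completion[OF ae] \<Omega>l by (subst AE_restrict_space_iff) (auto elim!: eventually_mono)
  have Pm: "P \<in> borel_measurable (lebesgue_on \<Omega>)" by (rule borel_imp_measurable_lebesgue_on[OF P])
  have ind: "(\<lambda>x. indicator \<Omega> x *\<^sub>R P x) = P"
  proof
    show "indicator \<Omega> x *\<^sub>R P x = P x" for x using out[of x] by (cases "x \<in> \<Omega>") auto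
  qed
  have "integrable (lebesgue_on \<Omega>) P"
    using p ae' Pm by (subst integrable_cong_AE[of _ _ p]) (auto elim!: eventually_mono)
  then have "integrable lebesgue P"
    using \<Omega>l by (subst (asm) integrable_restrict_space) (auto simp: ind[unfolded real_scaleR_def])
  then show "integrable lborel P" by (subst (asm) integrable_completion) auto
  have "(LINT x|lebesgue_on \<Omega>. p x) = (LINT x|lebesgue_on \<Omega>. P x)"
    using p ae' Pm by (intro integral_cong_AE) auto
  also have "\<dots> = (LINT x|lebesgue. P x)"
    using \<Omega>l by (subst integral_restrict_space) (auto simp: ind[unfolded real_scaleR_def])
  also have "\<dots> = (\<integral>x. P x \<partial>lborel)" by (rule integral_completion) measurable
  finally show "(\<integral>x. P x \<partial>lborel) = (LINT x|lebesgue_on \<Omega>. p x)" ..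
qed

text \<open>A minimising current is not at hand, but \<kappa> > 0 leaves room for a factor 2.
  Membership in \<open>W_star\<close> makes the infimum finite, so \<open>enn2real\<close> in the
  norm loses nothing.\<close>

lemma star_norm_current:
  assumes f: "f \<in> W_star \<Omega>" and \<kappa>: "0 < \<kappa>" "star_norm \<Omega> f \<le> \<kappa>"
  obtains T where "T \<in> Gamma_f \<Omega> f" "mass \<Omega> T \<le> ennreal (2 * \<kappa>\<^sup>2)" "(LINT z|lebesgue_on \<Omega>. (f z)\<^sup>2) \<le> \<kappa>\<^sup>2"
proof -
  define q where "q = (LINT z|lebesgue_on \<Omega>. (f z)\<^sup>2)"
  define i where "i = (INF T\<in>Gamma_f \<Omega> f. mass \<Omega> T)"
  have q0: "0 \<le> q" unfolding q_def by (intro integral_nonneg_AE) auto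
  obtain T0 where "T0 \<in> Gamma_f \<Omega> f" "mass \<Omega> T0 < \<infinity>" using f by (auto simp: W_star_def)
  then have ifin: "i < \<infinity>" unfolding i_def by (meson INF_lower le_less_trans)
  have "sqrt (q + enn2real i) \<le> \<kappa>" using \<kappa> by (simp add: star_norm_def q_def i_def)
  then have le: "q + enn2real i \<le> \<kappa>\<^sup>2" by (rule sqrt_le_D)
  have "i = ennreal (enn2real i)" using ifin by simp
  also have "\<dots> \<le> ennreal (\<kappa>\<^sup>2)" using le q0 by (intro ennreal_leI) simp
  also have "\<dots> < ennreal (2 * \<kappa>\<^sup>2)" using \<kappa> by (intro ennreal_lessI) auto
  finally obtain T where "T \<in> Gamma_f \<Omega> f" "mass \<Omega> T < ennreal (2 * \<kappa>\<^sup>2)"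
    unfolding i_def INF_less_iff by blast
  then show ?thesis using le enn2real_nonneg[of i] by (intro that[of T]) (auto simp: q_def[symmetric] simp del: enn2real_nonneg)
qed

text \<open>The bound of \<open>radial_energy_bound\<close> at mass 2, which is what 2 \<kappa>^2
  becomes when f is divided by \<kappa>; \<open>local_const\<close> does the same for
  \<open>local_energy_bound\<close>.\<close>

definition radial_const :: "nat \<Rightarrow> real" where
  "radial_const n = 2 * pi * (2 * n * (pi / 2) ^ (n - 1) * 2)"

definition local_const :: "nat \<Rightarrow> real" where
  "local_const n = 2 * pi * ((pi / 2) ^ (n - 1) * 2)"

text \<open>Instantiates the locale at f / \<kappa>. In \<open>M\<close>, the term 1 plus the
  measure of \<open>\<Omega>\<close> bounds the L^1 norm through -u <= 1 + u^2. The quotient by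
  \<open>flat\<close> bounds the gradient on L: on a covering ball of radius \<open>\<rho>\<close>
  the cutoff of radius 2 \<open>\<rho>\<close> is at least that value. \<open>radial_const\<close>
  bounds the radial energy. Neither f nor \<kappa> occurs in \<open>M\<close>.\<close>

lemma radial_energy_W_star:
  fixes f :: "complex^'n::finite \<Rightarrow> real"
  assumes \<Omega>: "open \<Omega>" "bounded \<Omega>" and R: "0 < R" "R \<le> 1" and \<rho>: "0 < \<rho>"
    and C: "finite C" "\<And>c. c \<in> C \<Longrightarrow> cball c (2 * \<rho>) \<subseteq> \<Omega>" and L: "open L" "L \<subseteq> (\<Union>c\<in>C. ball c \<rho>)"
    and A: "\<And>a. a \<in> A \<Longrightarrow> ball a R \<subseteq> L" "\<And>a. a \<in> A \<Longrightarrow> cball a R \<subseteq> \<Omega>"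
    and f: "f \<in> W_star_nonpos \<Omega>" and \<kappa>: "0 < \<kappa>" "star_norm \<Omega> f \<le> \<kappa>"
  defines "M \<equiv> 1 + measure lebesgue \<Omega> + real (card C) * local_const CARD('n) / flat 0 ((2 * \<rho>) ^ (2 * CARD('n)) - \<rho> ^ (2 * CARD('n)))
      + radial_const CARD('n)"
  obtains F G where "radial_energy CARD('n) R M F G A L" "AE x in lborel. x \<in> \<Omega> \<longrightarrow> F x = f x / \<kappa>"
proof -
  let ?n = "CARD('n)"
  define b where "b = flat 0 ((2 * \<rho>) ^ (2 * ?n) - \<rho> ^ (2 * ?n))"
  have b0: "0 < b" unfolding b_def using \<rho> by (intro flat_pos) (auto intro!: power_strict_mono)
  have fW: "f \<in> W_star \<Omega>" and fae: "AE z in lebesgue_on \<Omega>. f z \<le> 0" using f by (auto simp: W_star_nonpos_def)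
  have f12: "f \<in> W12 \<Omega>" using fW by (simp add: W_star_def)
  have fL: "L2_on \<Omega> f" using f12 by (simp add: W12_def)
  have \<Omega>l: "\<Omega> \<in> sets lebesgue" using \<Omega> by simp
  obtain T where T: "T \<in> Gamma_f \<Omega> f" "mass \<Omega> T \<le> ennreal (2 * \<kappa>\<^sup>2)" "(LINT z|lebesgue_on \<Omega>. (f z)\<^sup>2) \<le> \<kappa>\<^sup>2"
    using star_norm_current[OF fW \<kappa>] by blast
  have m0: "0 \<le> 2 * \<kappa>\<^sup>2" by simp
  define \<gamma> where "\<gamma> b = wgrad \<Omega> f b" for b
  have \<gamma>L: "L2_on \<Omega> (\<gamma> b)" if "b \<in> Basis" for b unfolding \<gamma>_def by (rule L2_wgrad[OF f12 that])
  have fm: "f \<in> borel_measurable (lebesgue_on \<Omega>)" and \<gamma>m: "\<And>b. b \<in> Basis \<Longrightarrow> \<gamma> b \<in> borel_measurable (lebesgue_on \<Omega>)"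
    using fL \<gamma>L by (auto simp: L2_on_def)
  obtain f' where f': "f' \<in> borel_measurable borel" "AE x in lborel. x \<in> \<Omega> \<longrightarrow> f' x = f x"
    using lebesgue_on_borel_representative[OF \<Omega>(1) fm] by blast
  have "\<forall>b\<in>Basis. \<exists>v. v \<in> borel_measurable borel \<and> (AE x in lborel. x \<in> \<Omega> \<longrightarrow> v x = \<gamma> b x)"
    using lebesgue_on_borel_representative[OF \<Omega>(1) \<gamma>m] by blast
  from bchoice[OF this] obtain \<gamma>' where
    "\<forall>b\<in>Basis. \<gamma>' b \<in> borel_measurable borel \<and> (AE x in lborel. x \<in> \<Omega> \<longrightarrow> \<gamma>' b x = \<gamma> b x)"
    by (rule exE)
  then have \<gamma>': "\<And>b. b \<in> Basis \<Longrightarrow> \<gamma>' b \<in> borel_measurable borel"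
      "\<And>b. b \<in> Basis \<Longrightarrow> AE x in lborel. x \<in> \<Omega> \<longrightarrow> \<gamma>' b x = \<gamma> b x"
    by simp_all
  have [measurable]: "\<Omega> \<in> sets borel" "L \<in> sets borel" using \<Omega> L by auto
  have [measurable]: "f' \<in> borel_measurable borel" by (rule f')
  \<comment> \<open>The minimum with 0 is there because f <= 0 holds only almost everywhere, while
    the locale asks for F <= 0 at every point.\<close>
  define F where "F x = indicator \<Omega> x * min 0 (f' x) / \<kappa>" for x
  define G where "G x = (\<Sum>b\<in>Basis. (indicator \<Omega> x * \<gamma>' b x / \<kappa>) *\<^sub>R b)" for x
  have Fm [measurable]: "F \<in> borel_measurable borel" unfolding F_def by measurable
  have Gm [measurable]: "G \<in> borel_measurable borel" unfolding G_def
    using \<gamma>'(1) by (intro borel_measurable_sum borel_measurable_scaleR borel_measurable_divide borel_measurable_times) auto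
  have aef: "AE x in lborel. x \<in> \<Omega> \<longrightarrow> f x \<le> 0"
  proof -
    have "AE x in lebesgue. x \<in> \<Omega> \<longrightarrow> f x \<le> 0" using fae \<Omega>l by (subst (asm) AE_restrict_space_iff) auto
    then show ?thesis by (simp add: AE_completion_iff)
  qed
  have aeF: "AE x in lborel. x \<in> \<Omega> \<longrightarrow> F x = f x / \<kappa>"
    using f'(2) aef by eventually_elim (auto simp: F_def)
  have "AE x in lborel. \<forall>b\<in>Basis. x \<in> \<Omega> \<longrightarrow> \<gamma>' b x = \<gamma> b x"
    by (rule AE_finite_allI[OF finite_Basis]) (rule \<gamma>'(2))
  then have aeG: "AE x in lborel. x \<in> \<Omega> \<longrightarrow> G x = (\<Sum>b\<in>Basis. (\<gamma> b x / \<kappa>) *\<^sub>R b)"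
    by eventually_elim (auto simp: G_def)
  have Gin: "(\<Sum>b\<in>Basis. (\<gamma> b x / \<kappa>) *\<^sub>R b) \<bullet> y = (\<Sum>b\<in>Basis. \<gamma> b x * (y \<bullet> b)) / \<kappa>" for x y
    by (simp add: inner_sum_left sum_divide_distrib inner_commute[of y])
  have Gnorm: "(norm (\<Sum>b\<in>Basis. (\<gamma> b x / \<kappa>) *\<^sub>R b))\<^sup>2 = (\<Sum>b\<in>Basis. (\<gamma> b x)\<^sup>2) / \<kappa>\<^sup>2" for x
  proof -
    have "(\<Sum>b\<in>Basis. (\<gamma> b x / \<kappa>) *\<^sub>R b) \<bullet> c = \<gamma> c x / \<kappa>" if "c \<in> Basis" for c
      using that by (rule inner_sum_left_Basis)
    then have "(norm (\<Sum>b\<in>Basis. (\<gamma> b x / \<kappa>) *\<^sub>R b))\<^sup>2 = (\<Sum>c\<in>Basis. (\<gamma> c x / \<kappa>)\<^sup>2)"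
      unfolding power2_norm_eq_inner by (subst euclidean_inner) (simp add: power2_eq_square)
    then show ?thesis by (simp add: power_divide sum_divide_distrib)
  qed
  have Fout: "F x = 0" and Gout: "G x = 0" if "x \<notin> \<Omega>" for x using that by (auto simp: F_def G_def)
  have M1: "1 + measure lebesgue \<Omega> \<le> M" "real (card C) * local_const ?n / b \<le> M" "radial_const ?n \<le> M"
  proof -
    have "0 \<le> real (card C) * local_const ?n / b" "0 \<le> radial_const ?n"
      using b0 by (auto simp: local_const_def radial_const_def)
    then show "1 + measure lebesgue \<Omega> \<le> M" "real (card C) * local_const ?n / b \<le> M" "radial_const ?n \<le> M"
      unfolding M_def b_def[symmetric] using measure_nonneg[of lebesgue \<Omega>] by linarith+
  qed
  have one: "integrable (lebesgue_on \<Omega>) (\<lambda>_. 1::real)" using L2_const_one[OF \<Omega>] by (simp add: L2_on_def)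
  have f2: "integrable (lebesgue_on \<Omega>) (\<lambda>x. (f x)\<^sup>2)" using fL by (simp add: L2_on_def)
  have if': "integrable (lebesgue_on \<Omega>) (\<lambda>x. f x / \<kappa>)"
  proof (rule Bochner_Integration.integrable_bound)
    show "integrable (lebesgue_on \<Omega>) (\<lambda>x. (1 + (f x)\<^sup>2) / \<kappa>)" using one f2 by simp
    show "AE x in lebesgue_on \<Omega>. norm (f x / \<kappa>) \<le> norm ((1 + (f x)\<^sup>2) / \<kappa>)"
    proof (rule AE_I2)
      fix x
      have "0 \<le> (\<bar>f x\<bar> - 1)\<^sup>2" by simp
      then have "2 * \<bar>f x\<bar> \<le> 1 + (f x)\<^sup>2" by (simp add: power2_diff)
      then have "\<bar>f x\<bar> \<le> \<bar>1 + (f x)\<^sup>2\<bar>" by linarith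
      then show "norm (f x / \<kappa>) \<le> norm ((1 + (f x)\<^sup>2) / \<kappa>)"
        using \<kappa> by (simp add: divide_right_mono)
    qed
  qed (use fm in simp)
  note trF = lebesgue_on_transfer[OF \<Omega>(1) Fm if' aeF Fout]
  have "radial_energy ?n R M F G A L"
  proof
    show "DIM(complex^'n) = 2 * ?n" by simp
    show "0 < R" "R \<le> 1" by fact+
    show "F \<in> borel_measurable borel" "G \<in> borel_measurable borel" "L \<in> sets borel" by measurable
    show "F x \<le> 0" for x using \<kappa> by (auto simp: F_def indicator_def intro!: divide_nonpos_pos)
    show "integrable lborel F" by (rule trF(1))
    show "- (\<integral>x. F x \<partial>lborel) \<le> M"
    proof -
      have "- (\<integral>x. F x \<partial>lborel) = (LINT x|lebesgue_on \<Omega>. - (f x / \<kappa>))" using trF(2) by simp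
      also have "\<dots> \<le> (LINT x|lebesgue_on \<Omega>. 1 + (f x)\<^sup>2 / \<kappa>\<^sup>2)"
      proof (rule integral_mono)
        fix x
        have "0 \<le> (f x / \<kappa> + 1)\<^sup>2 + (f x / \<kappa>)\<^sup>2 + 1" by simp
        then show "- (f x / \<kappa>) \<le> 1 + (f x)\<^sup>2 / \<kappa>\<^sup>2" by (simp add: power2_sum power_divide)
      qed (use one f2 if' in auto)
      also have "\<dots> = (LINT x|lebesgue_on \<Omega>. 1) + (LINT x|lebesgue_on \<Omega>. (f x)\<^sup>2) / \<kappa>\<^sup>2"
        using one f2 by simp
      also have "(LINT x|lebesgue_on \<Omega>. 1) = measure lebesgue \<Omega>"
        using \<Omega>l by (simp add: measure_restrict_space)
      also have "(LINT x|lebesgue_on \<Omega>. (f x)\<^sup>2) / \<kappa>\<^sup>2 \<le> 1" using T(3) \<kappa> by simp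
      finally show ?thesis using M1(1) by linarith
    qed
    show "emeasure lborel L < \<infinity>"
    proof -
      have "L \<subseteq> \<Omega>"
      proof
        fix x assume "x \<in> L"
        then obtain c where "c \<in> C" "x \<in> ball c \<rho>" using L by blast
        then show "x \<in> \<Omega>" using C(2)[of c] \<rho> by auto
      qed
      then have "bounded L" using \<Omega> bounded_subset by blast
      then show ?thesis by (rule emeasure_bounded_finite)
    qed
    show "(\<integral>\<^sup>+x. ennreal (indicator L x * (norm (G x))\<^sup>2) \<partial>lborel) \<le> ennreal M"
    proof -
      let ?c = "\<lambda>c. cutoff ?n 0 (2 * \<rho>) c"
      have cb [measurable]: "?c c \<in> borel_measurable borel" for c :: "complex^'n"
        by (intro borel_measurable_continuous_onI smooth_continuous smooth_cutoff)
      have term1: "(\<integral>\<^sup>+x. ennreal ((norm (G x))\<^sup>2 * ?c c x) \<partial>lborel) \<le> ennreal (local_const ?n)" if c: "c \<in> C" for c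
      proof -
        note le = local_energy_bound[OF f12 T(1,2) m0 _ C(2)[OF c], folded \<gamma>_def]
        let ?p = "\<lambda>x. ((\<Sum>b\<in>Basis. (\<gamma> b x)\<^sup>2) * ?c c x) / \<kappa>\<^sup>2"
        have ip: "integrable (lebesgue_on \<Omega>) ?p" using le(1) \<rho> by simp
        have ae: "AE x in lborel. x \<in> \<Omega> \<longrightarrow> (norm (G x))\<^sup>2 * ?c c x = ?p x"
          using aeG by eventually_elim (auto simp: Gnorm)
        have "(norm (G x))\<^sup>2 * ?c c x = 0" if "x \<notin> \<Omega>" for x using Gout[OF that] by simp
        note tr = lebesgue_on_transfer[OF \<Omega>(1) _ ip ae this]
        have Pm: "(\<lambda>x. (norm (G x))\<^sup>2 * ?c c x) \<in> borel_measurable borel" by measurable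
        have "(\<integral>\<^sup>+x. ennreal ((norm (G x))\<^sup>2 * ?c c x) \<partial>lborel) = ennreal (\<integral>x. (norm (G x))\<^sup>2 * ?c c x \<partial>lborel)"
          using tr(1)[OF Pm] by (intro nn_integral_eq_integral AE_I2 mult_nonneg_nonneg cutoff_nonneg) auto
        also have "(\<integral>x. (norm (G x))\<^sup>2 * ?c c x \<partial>lborel) = (LINT x|lebesgue_on \<Omega>. (\<Sum>b\<in>Basis. (\<gamma> b x)\<^sup>2) * ?c c x) / \<kappa>\<^sup>2"
          using tr(2)[OF Pm] by simp
        also have "\<dots> \<le> (2 * pi * ((pi / 2) ^ (?n - 1) * (2 * \<kappa>\<^sup>2))) / \<kappa>\<^sup>2"
          using le(2) \<rho> by (intro divide_right_mono) auto
        also have "\<dots> = local_const ?n" using \<kappa> by (simp add: local_const_def)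
        finally show ?thesis by (simp add: ennreal_leI)
      qed
      have pt: "ennreal (indicator L x * (norm (G x))\<^sup>2) \<le> (\<Sum>c\<in>C. ennreal (1 / b) * ennreal ((norm (G x))\<^sup>2 * ?c c x))" for x
      proof (cases "x \<in> L")
        case True
        then obtain c where c: "c \<in> C" "x \<in> ball c \<rho>" using L by blast
        have "b \<le> ?c c x"
        proof -
          have "((x - c) \<bullet> (x - c)) ^ ?n \<le> \<rho> ^ (2 * ?n)"
            using c by (simp add: dot_square_norm power_mult[symmetric] power_mono dist_norm norm_minus_commute)
          then show ?thesis unfolding b_def cutoff_def by (intro flat_0_mono) simp
        qed
        then have "(norm (G x))\<^sup>2 * b \<le> (norm (G x))\<^sup>2 * ?c c x" by (intro mult_left_mono) auto
        then have "(norm (G x))\<^sup>2 \<le> 1 / b * ((norm (G x))\<^sup>2 * ?c c x)" using b0 by (simp add: field_simps)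
        then have "ennreal (indicator L x * (norm (G x))\<^sup>2) \<le> ennreal (1 / b) * ennreal ((norm (G x))\<^sup>2 * ?c c x)"
          using True b0 by (simp add: ennreal_mult'[symmetric] ennreal_leI)
        also have "\<dots> \<le> (\<Sum>c\<in>C. ennreal (1 / b) * ennreal ((norm (G x))\<^sup>2 * ?c c x))"
          using C(1) c(1) by (intro member_le_sum) auto
        finally show ?thesis .
      qed simp
      have "(\<integral>\<^sup>+x. ennreal (indicator L x * (norm (G x))\<^sup>2) \<partial>lborel)
        \<le> (\<integral>\<^sup>+x. (\<Sum>c\<in>C. ennreal (1 / b) * ennreal ((norm (G x))\<^sup>2 * ?c c x)) \<partial>lborel)"
        by (intro nn_integral_mono pt)
      also have "\<dots> = (\<Sum>c\<in>C. (\<integral>\<^sup>+x. ennreal (1 / b) * ennreal ((norm (G x))\<^sup>2 * ?c c x) \<partial>lborel))"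
        by (rule nn_integral_sum) measurable
      also have "\<dots> = (\<Sum>c\<in>C. ennreal (1 / b) * (\<integral>\<^sup>+x. ennreal ((norm (G x))\<^sup>2 * ?c c x) \<partial>lborel))"
        by (intro sum.cong refl nn_integral_cmult) measurable
      also have "\<dots> \<le> (\<Sum>c\<in>C. ennreal (1 / b) * ennreal (local_const ?n))"
        by (intro sum_mono mult_left_mono term1) auto
      also have "\<dots> = (\<Sum>c\<in>C. ennreal (1 / b * local_const ?n))"
        using b0 by (simp add: ennreal_mult'[symmetric])
      also have "\<dots> = ennreal (\<Sum>c\<in>C. 1 / b * local_const ?n)"
        using b0 by (intro sum_ennreal) (auto simp: local_const_def)
      also have "\<dots> \<le> ennreal M" using M1(2) by (intro ennreal_leI) simp
      finally show ?thesis .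
    qed
    fix a :: "complex^'n" assume a: "a \<in> A"
    show "x \<in> L" if "norm (x - a) < R" for x
      using A(1)[OF a] that by (auto simp: dist_norm norm_minus_commute)
    fix e :: real assume e: "0 < e"
    note A2 = A(2)[OF a]
    have [measurable]: "Wker ?n R e \<in> borel_measurable (borel :: (complex^'n) measure)"
      "Pker ?n R e \<in> borel_measurable (borel :: (complex^'n) measure)"
      "Qker ?n R e \<in> borel_measurable (borel :: (complex^'n) measure)"
      using borel_kernels[OF e] by blast+
    have kt: "Wker ?n R e (x - a) = inverse ((x - a) \<bullet> (x - a) + e) ^ ?n * cutoff ?n 0 R a x" for x
      by (simp add: Wker_def cutoff_def)
    note en = radial_energy_bound[OF f12 T(1,2) m0 R A2 e, folded \<gamma>_def kt]
    show "(\<integral>\<^sup>+x. ennreal ((G x \<bullet> (x - a))\<^sup>2 * Wker ?n R e (x - a)) \<partial>lborel) \<le> ennreal M"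
    proof -
      let ?p = "\<lambda>x. ((\<Sum>b\<in>Basis. \<gamma> b x * ((x - a) \<bullet> b))\<^sup>2 * Wker ?n R e (x - a)) / \<kappa>\<^sup>2"
      have ip: "integrable (lebesgue_on \<Omega>) ?p" using en(1) by simp
      have ae: "AE x in lborel. x \<in> \<Omega> \<longrightarrow> (G x \<bullet> (x - a))\<^sup>2 * Wker ?n R e (x - a) = ?p x"
        using aeG by eventually_elim (auto simp: Gin power_divide)
      have "(G x \<bullet> (x - a))\<^sup>2 * Wker ?n R e (x - a) = 0" if "x \<notin> \<Omega>" for x using Gout[OF that] by simp
      note tr = lebesgue_on_transfer[OF \<Omega>(1) _ ip ae this]
      have Pm: "(\<lambda>x. (G x \<bullet> (x - a))\<^sup>2 * Wker ?n R e (x - a)) \<in> borel_measurable borel" by measurable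
      have "(\<integral>\<^sup>+x. ennreal ((G x \<bullet> (x - a))\<^sup>2 * Wker ?n R e (x - a)) \<partial>lborel)
          = ennreal (\<integral>x. (G x \<bullet> (x - a))\<^sup>2 * Wker ?n R e (x - a) \<partial>lborel)"
        using tr(1)[OF Pm] e by (intro nn_integral_eq_integral AE_I2 mult_nonneg_nonneg kernels_nonneg) auto
      also have "(\<integral>x. (G x \<bullet> (x - a))\<^sup>2 * Wker ?n R e (x - a) \<partial>lborel)
          = (LINT x|lebesgue_on \<Omega>. (\<Sum>b\<in>Basis. \<gamma> b x * ((x - a) \<bullet> b))\<^sup>2 * Wker ?n R e (x - a)) / \<kappa>\<^sup>2"
        using tr(2)[OF Pm] by simp
      also have "\<dots> \<le> (2 * pi * (2 * ?n * (pi / 2) ^ (?n - 1) * (2 * \<kappa>\<^sup>2))) / \<kappa>\<^sup>2"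
        using en(2) by (intro divide_right_mono) auto
      also have "\<dots> = radial_const ?n" using \<kappa> by (simp add: radial_const_def)
      also have "\<dots> \<le> M" by (rule M1)
      finally show ?thesis by (simp add: ennreal_leI)
    qed
    show "(\<integral>x. F x * (Pker ?n R e (x - a) - Qker ?n R e (x - a)) \<partial>lborel)
        = - (\<integral>x. (G x \<bullet> (x - a)) * Wker ?n R e (x - a) \<partial>lborel)"
    proof -
      let ?k = "\<lambda>x. Pker ?n R e (x - a) - Qker ?n R e (x - a)"
      let ?w = "\<lambda>x. (\<Sum>b\<in>Basis. \<gamma> b x * ((x - a) \<bullet> b)) * Wker ?n R e (x - a)"
      have k: "\<bar>?k x\<bar> \<le> 2 * real ?n * e * inverse e ^ (?n + 1) + 4 * real ?n" for x
        using kernels_nonneg(2,3)[of e ?n R "x - a"] kernels_upper(2,3)[OF e, of ?n R "x - a"] e by linarith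
      have "integrable (lebesgue_on \<Omega>) (\<lambda>x. f x / \<kappa> * ?k x)"
      proof (rule Bochner_Integration.integrable_bound[OF integrable_mult_right[OF if']])
        show "AE x in lebesgue_on \<Omega>. norm (f x / \<kappa> * ?k x) \<le> norm ((2 * real ?n * e * inverse e ^ (?n + 1) + 4 * real ?n) * (f x / \<kappa>))"
        proof (rule AE_I2)
          fix x
          have "\<bar>f x / \<kappa>\<bar> * \<bar>?k x\<bar> \<le> \<bar>f x / \<kappa>\<bar> * (2 * real ?n * e * inverse e ^ (?n + 1) + 4 * real ?n)"
            by (intro mult_left_mono k) auto
          then show "norm (f x / \<kappa> * ?k x) \<le> norm ((2 * real ?n * e * inverse e ^ (?n + 1) + 4 * real ?n) * (f x / \<kappa>))"
            unfolding real_norm_def abs_mult mult.commute[of "\<bar>f x / \<kappa>\<bar>"] by (rule order_trans) (intro mult_right_mono, auto)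
        qed
        have "?k \<in> borel_measurable (lebesgue_on \<Omega>)" by (intro borel_imp_measurable_lebesgue_on) measurable
        then show "(\<lambda>x. f x / \<kappa> * ?k x) \<in> borel_measurable (lebesgue_on \<Omega>)" using fm by (intro borel_measurable_times) auto
      qed
      moreover have "AE x in lborel. x \<in> \<Omega> \<longrightarrow> F x * ?k x = f x / \<kappa> * ?k x" using aeF by eventually_elim auto
      ultimately have 1: "(\<integral>x. F x * ?k x \<partial>lborel) = (LINT x|lebesgue_on \<Omega>. f x / \<kappa> * ?k x)"
        using Fout by (intro lebesgue_on_transfer[OF \<Omega>(1)]) auto
      have tW: "(\<lambda>x. complex_of_real (((x - a) \<bullet> b) * Wker ?n R e (x - a))) \<in> test_fun \<Omega>" for b
      proof -
        have "(\<lambda>x. complex_of_real (Wker ?n R e (x - a))) \<in> test_fun \<Omega>"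
          using cutoff_nonneg_test[of R a \<Omega> "\<lambda>z. inverse ((z - a) \<bullet> (z - a) + e) ^ ?n" ?n 0] R A2 smooth_kernel[OF e, of a ?n] e
          unfolding kt nonneg_test_def by (auto intro!: zero_le_power add_nonneg_nonneg)
        from test_fun_mult[OF this, of "\<lambda>x. complex_of_real ((x - a) \<bullet> b)"]
        show ?thesis unfolding of_real_mult
          by (simp add: mult.commute smooth_of_real smooth_inner smooth_diff smooth_id)
      qed
      have iw: "integrable (lebesgue_on \<Omega>) ?w"
      proof -
        have "integrable (lebesgue_on \<Omega>) (\<lambda>x. \<Sum>b\<in>Basis. \<gamma> b x * (((x - a) \<bullet> b) * Wker ?n R e (x - a)))"
          by (intro Bochner_Integration.integrable_sum integrable_L2_test \<Omega> \<gamma>L tW)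
        then show ?thesis by (simp only: sum_distrib_right mult.assoc)
      qed
      then have "integrable (lebesgue_on \<Omega>) (\<lambda>x. ?w x / \<kappa>)" by simp
      moreover have "AE x in lborel. x \<in> \<Omega> \<longrightarrow> (G x \<bullet> (x - a)) * Wker ?n R e (x - a) = ?w x / \<kappa>"
        using aeG by eventually_elim (auto simp: Gin)
      ultimately have 2: "(\<integral>x. (G x \<bullet> (x - a)) * Wker ?n R e (x - a) \<partial>lborel) = (LINT x|lebesgue_on \<Omega>. ?w x / \<kappa>)"
        using Gout by (intro lebesgue_on_transfer[OF \<Omega>(1)]) auto
      have "DIM(complex^'n) = 2 * ?n" by simp
      from weak_divergence_radial[OF \<Omega> f12 this R(1) A2 e]
      show ?thesis unfolding 1 2 \<gamma>_def by simp
    qed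
  qed
  then show ?thesis by (rule that) (rule aeF)
qed

lemma sublevel_set_estimate:
  fixes \<Omega> K :: "(complex^'n::finite) set"
  assumes \<Omega>: "open \<Omega>" "bounded \<Omega>" and K: "compact K" "K \<subseteq> \<Omega>"
  obtains A1 \<alpha> where "0 < A1" "0 < \<alpha>"
    "\<And>\<kappa> f s. 0 < \<kappa> \<Longrightarrow> f \<in> W_star_nonpos \<Omega> \<Longrightarrow> star_norm \<Omega> f \<le> \<kappa> \<Longrightarrow> 0 < s \<Longrightarrow>
      measure lebesgue ({z\<in>\<Omega>. f z < - s} \<inter> K) \<le> A1 * exp (- \<alpha> * s\<^sup>2 / \<kappa>\<^sup>2)"
proof -
  let ?n = "CARD('n)"
  obtain \<epsilon> where \<epsilon>: "\<epsilon> > 0" "(\<Union>x\<in>K. ball x \<epsilon>) \<subseteq> \<Omega>"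
    using compact_subset_open_imp_ball_epsilon_subset[OF K(1) \<Omega>(1) K(2)] by blast
  \<comment> \<open>Room for all radii: centers lie within R of K, their balls within 2 R, and the
    covering balls of radius 3 R are doubled to 6 R, below 8 R <= \<open>\<epsilon>\<close>. The
    kernel bounds ask for R <= 1.\<close>
  define R where "R = min 1 (\<epsilon> / 8)"
  have R: "0 < R" "R \<le> 1" "8 * R \<le> \<epsilon>" using \<epsilon> by (auto simp: R_def)
  have inside: "cball a R \<subseteq> \<Omega>" if "x \<in> K" "dist x a < R" for x a
  proof
    fix y assume "y \<in> cball a R"
    then have "y \<in> ball x \<epsilon>" using that dist_triangle[of x y a] R \<epsilon> by auto
    then show "y \<in> \<Omega>" using \<epsilon>(2) that(1) by blast
  qed
  have "K \<subseteq> \<Union>((\<lambda>x. ball x R) ` K)" using R by auto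
  then obtain C where C: "C \<subseteq> K" "finite C" "K \<subseteq> \<Union>((\<lambda>x. ball x R) ` C)"
    using compactE_image[OF K(1), of K "\<lambda>x. ball x R"] by auto
  define A where "A = (\<Union>x\<in>K. ball x R)"
  define L where "L = (\<Union>x\<in>K. ball x (2 * R))"
  have Lo: "open L" unfolding L_def by auto
  have Lc: "L \<subseteq> (\<Union>c\<in>C. ball c (3 * R))"
  proof
    fix y assume "y \<in> L"
    then obtain x where x: "x \<in> K" "dist x y < 2 * R" by (auto simp: L_def)
    then obtain c where c: "c \<in> C" "dist c x < R" using C(3) by auto
    then have "dist c y < 3 * R" using dist_triangle[of c y x] x by linarith
    then show "y \<in> (\<Union>c\<in>C. ball c (3 * R))" using c by auto
  qed
  have Cc: "cball c (2 * (3 * R)) \<subseteq> \<Omega>" if "c \<in> C" for c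
  proof
    fix y assume "y \<in> cball c (2 * (3 * R))"
    then have "y \<in> ball c \<epsilon>" using R by auto
    then show "y \<in> \<Omega>" using \<epsilon>(2) C(1) that by blast
  qed
  have AL: "ball a R \<subseteq> L" if aA: "a \<in> A" for a
  proof
    obtain x where x: "x \<in> K" "dist x a < R" using aA by (auto simp: A_def)
    fix y assume "y \<in> ball a R"
    then have "dist x y < 2 * R" using x dist_triangle[of x y a] by auto
    then show "y \<in> L" using x by (auto simp: L_def)
  qed
  have A\<Omega>: "cball a R \<subseteq> \<Omega>" if "a \<in> A" for a
    using that inside by (auto simp: A_def)
  have R3: "0 < 3 * R" using R by simp
  define M where "M = 1 + measure lebesgue \<Omega> + real (card C) * local_const ?n / flat 0 ((2 * (3 * R)) ^ (2 * ?n) - (3 * R) ^ (2 * ?n))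
      + radial_const ?n"
  have RE: "\<exists>F G. radial_energy ?n R M F G A L \<and> (AE x in lborel. x \<in> \<Omega> \<longrightarrow> F x = f x / \<kappa>)"
    if h: "f \<in> W_star_nonpos \<Omega>" "0 < \<kappa>" "star_norm \<Omega> f \<le> \<kappa>" for f \<kappa>
    by (rule radial_energy_W_star[where A = A, OF \<Omega> R(1,2) R3 C(2) Cc Lo Lc AL A\<Omega>, folded M_def, OF _ _ _ h]) blast+
  define k where "k = radial_energy.level_const ?n R M"
  define A1 where "A1 = 1 + 3 * measure lborel K"
  have A1: "0 < A1" by (simp add: A1_def add_pos_nonneg)
  show thesis
  \<comment> \<open>Positivity of \<open>level_const\<close> is available only from an instance of
    the locale, hence from an admissible f. If k = 0 there is none, and any constants do.\<close>
  proof (cases "k = 0")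
    case True
    have False if h: "f \<in> W_star_nonpos \<Omega>" "0 < \<kappa>" "star_norm \<Omega> f \<le> \<kappa>" for f \<kappa>
    proof -
      obtain F G where "radial_energy ?n R M F G A L" using RE[OF h] by blast
      then have "0 < k" unfolding k_def by (rule radial_energy.level_const_pos)
      then show False using True by simp
    qed
    then show thesis using that[of 1 1] by fastforce
  next
    case False
    show thesis
    proof (rule that[OF A1, of "1 / (4 * k\<^sup>2)"])
      show "0 < 1 / (4 * k\<^sup>2)" using False by simp
      fix \<kappa> s :: real and f assume \<kappa>: "0 < \<kappa>" and f: "f \<in> W_star_nonpos \<Omega>" "star_norm \<Omega> f \<le> \<kappa>" and s: "0 < s"
      obtain F G where re: "radial_energy ?n R M F G A L" and ae: "AE x in lborel. x \<in> \<Omega> \<longrightarrow> F x = f x / \<kappa>"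
        using RE[OF f(1) \<kappa> f(2)] by blast
      have Fm [measurable]: "F \<in> borel_measurable borel" using re by (simp add: radial_energy_def)
      have [measurable]: "K \<in> sets borel" using K by (simp add: compact_imp_closed)
      let ?E = "{z\<in>\<Omega>. f z < - s} \<inter> K" and ?E' = "{x\<in>K. F x < - (s / \<kappa>)}"
      have fm: "f \<in> borel_measurable (lebesgue_on \<Omega>)"
        using f(1) by (auto simp: W_star_nonpos_def W_star_def W12_def L2_on_def)
      have El: "?E \<in> sets lebesgue"
      proof -
        have "{z \<in> space (lebesgue_on \<Omega>). f z < - s} \<in> sets (lebesgue_on \<Omega>)" using fm by measurable
        then have "{z\<in>\<Omega>. f z < - s} \<in> sets lebesgue"
          using \<Omega>(1) by (subst (asm) sets_restrict_space_iff) auto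
        then show ?thesis using K(1) by (intro sets.Int) (auto simp: compact_imp_closed)
      qed
      have E'b: "?E' \<in> sets borel" by measurable
      have "measure lebesgue ?E = measure lebesgue ?E'"
      proof (rule measure_eq_AE)
        have "AE x in lborel. (x \<in> ?E) = (x \<in> ?E')"
          using ae
        proof eventually_elim
          case (elim x)
          then show ?case using K(2) \<kappa> by (auto simp: field_simps)
        qed
        then show "AE x in lebesgue. (x \<in> ?E) = (x \<in> ?E')" by (rule AE_completion)
      qed (use El E'b in auto)
      also have "\<dots> = measure lborel ?E'" using E'b by simp
      also have "\<dots> \<le> A1 * exp (- (s / \<kappa>)\<^sup>2 / (4 * k\<^sup>2))"
        unfolding A1_def k_def using R s \<kappa>
        by (intro radial_energy.measure_sublevel_le_exp[OF re K(1) R(1)]) (auto simp: A_def)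
      also have "- (s / \<kappa>)\<^sup>2 / (4 * k\<^sup>2) = - (1 / (4 * k\<^sup>2)) * s\<^sup>2 / \<kappa>\<^sup>2" by (simp add: power_divide)
      finally show "measure lebesgue ?E \<le> A1 * exp (- (1 / (4 * k\<^sup>2)) * s\<^sup>2 / \<kappa>\<^sup>2)" .
    qed
  qed
qed

section \<open>Constant functions and the main theorem\<close>

text \<open>Difference quotients have integral 0 by translation invariance of Lebesgue measure, and
  they converge dominatedly to the derivative.\<close>

lemma integral_ddir_eq_0:
  fixes r :: "'a::euclidean_space \<Rightarrow> real"
  assumes r: "smooth r" and C: "compact C" "\<And>x. x \<notin> C \<Longrightarrow> r x = 0"
  shows "(\<integral>x. ddir v r x \<partial>lborel) = 0"
proof -
  have rc: "continuous_on UNIV r" and dc: "continuous_on UNIV (ddir v r)"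
    by (rule smooth_continuous[OF r], rule smooth_continuous[OF smooth_ddir[OF r]])
  have [measurable]: "r \<in> borel_measurable borel" "ddir v r \<in> borel_measurable borel"
    by (rule borel_measurable_continuous_onI[OF rc], rule borel_measurable_continuous_onI[OF dc])
  have "open (- C)" using C(1) by (simp add: compact_imp_closed open_Compl)
  have d0: "ddir v r x = 0" if x: "x \<notin> C" for x
  proof -
    have "(r has_derivative (\<lambda>v. 0)) (at x)"
      using \<open>open (- C)\<close> by (rule has_derivative_transform_within_open[OF has_derivative_const]) (simp_all add: x C(2))
    from ddir_eqI[OF this] show ?thesis .
  qed
  obtain B where B: "0 < B" "\<And>x. \<bar>ddir v r x\<bar> \<le> B"
  proof -
    have "compact (ddir v r ` C)" by (rule compact_continuous_image[OF continuous_on_subset[OF dc] C(1)]) simp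
    then obtain B where "0 < B" "\<forall>y\<in>ddir v r ` C. norm y \<le> B" using bounded_pos compact_imp_bounded by blast
    then have "\<bar>ddir v r x\<bar> \<le> B" for x using d0[of x] by (cases "x \<in> C") auto
    then show ?thesis using that \<open>0 < B\<close> by blast
  qed
  \<comment> \<open>Contains the supports of all difference quotients, as the steps are at most
    1.\<close>
  define D where "D = {x + y | x y. x \<in> C \<and> y \<in> cball 0 (norm v)}"
  have D: "compact D" unfolding D_def by (rule compact_sums[OF C(1) compact_cball])
  then have [measurable]: "D \<in> sets borel" by (simp add: compact_imp_closed)
  define h where "h k = inverse (real (Suc k))" for k
  have h: "0 < h k" "h k \<le> 1" for k by (auto simp: h_def field_simps)
  have DER: "((\<lambda>t. r (x + t *\<^sub>R v)) has_real_derivative ddir v r (x + t *\<^sub>R v)) (at t)" for x t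
  proof -
    have 1: "((\<lambda>t. x + t *\<^sub>R v) has_derivative (\<lambda>s. s *\<^sub>R v)) (at t)"
      by (auto intro!: derivative_eq_intros)
    have "((\<lambda>t. r (x + t *\<^sub>R v)) has_derivative (\<lambda>s. ddir (s *\<^sub>R v) r (x + t *\<^sub>R v))) (at t)"
      by (rule has_derivative_compose[OF 1 smooth_has_derivative[OF r]])
    moreover have "(\<lambda>s. ddir (s *\<^sub>R v) r (x + t *\<^sub>R v)) = (*) (ddir v r (x + t *\<^sub>R v))"
      using linear_scale[OF has_derivative_linear[OF smooth_has_derivative[OF r, of "x + t *\<^sub>R v"]]] by (auto simp: mult.commute)
    ultimately show ?thesis by (simp add: has_field_derivative_def)
  qed
  define s where "s k x = (r (x + h k *\<^sub>R v) - r x) / h k" for k x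
  have lim: "(\<lambda>k. s k x) \<longlonglongrightarrow> ddir v r x" for x
  proof -
    have "((\<lambda>t. (r (x + t *\<^sub>R v) - r x) / t) \<longlongrightarrow> ddir v r x) (at 0)"
      using DER[of x 0] by (simp add: DERIV_def)
    moreover have "filterlim h (at 0) sequentially"
      unfolding filterlim_at using h LIMSEQ_inverse_real_of_nat by (auto simp: h_def[abs_def])
    ultimately show ?thesis unfolding s_def by (rule filterlim_compose)
  qed
  have bd: "\<bar>s k x\<bar> \<le> B * indicator D x" for k x
  proof (cases "x \<in> D")
    case True
    have "norm (r (x + h k *\<^sub>R v) - r (x + 0 *\<^sub>R v)) \<le> B * norm (h k - 0)"
      by (rule field_differentiable_bound[of UNIV "\<lambda>t. r (x + t *\<^sub>R v)" "\<lambda>t. ddir v r (x + t *\<^sub>R v)" B "h k" 0])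
         (use DER B in auto)
    then show ?thesis using h[of k] True by (simp add: s_def field_simps)
  next
    case False
    have "x \<notin> C" using False unfolding D_def by force
    moreover have "x + h k *\<^sub>R v \<notin> C"
    proof
      assume "x + h k *\<^sub>R v \<in> C"
      moreover have "- (h k *\<^sub>R v) \<in> cball 0 (norm v)" using h[of k] by (auto simp: mult_left_le_one_le)
      moreover have "x = (x + h k *\<^sub>R v) + - (h k *\<^sub>R v)" by simp
      ultimately show False using False unfolding D_def by blast
    qed
    ultimately show ?thesis using C(2) False by (simp add: s_def)
  qed
  have ir: "integrable lborel r"
  proof -
    have e: "(\<lambda>x. indicator C x *\<^sub>R r x) = r"
    proof
      show "indicator C x *\<^sub>R r x = r x" for x using C(2)[of x] by (cases "x \<in> C") auto
    qed
    show ?thesis using borel_integrable_compact[OF C(1) continuous_on_subset[OF rc]] e by (simp add: set_integrable_def)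
  qed
  have tr: "integrable lborel (\<lambda>x. r (x + w))" "(\<integral>x. r (x + w) \<partial>lborel) = (\<integral>x. r x \<partial>lborel)" for w
  proof -
    have "integrable (distr lborel borel ((+) w)) r" by (simp add: lborel_distr_plus ir)
    then show "integrable lborel (\<lambda>x. r (x + w))" by (subst (asm) integrable_distr_eq) (auto simp: add.commute)
    have "(\<integral>x. r x \<partial>lborel) = (\<integral>x. r x \<partial>(distr lborel borel ((+) w)))" by (simp add: lborel_distr_plus)
    also have "\<dots> = (\<integral>x. r (w + x) \<partial>lborel)" by (rule integral_distr) auto
    finally show "(\<integral>x. r (x + w) \<partial>lborel) = (\<integral>x. r x \<partial>lborel)" by (simp add: add.commute)
  qed
  have z: "(\<integral>x. s k x \<partial>lborel) = 0" for k
    unfolding s_def using tr ir by simp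
  have "(\<lambda>k. \<integral>x. s k x \<partial>lborel) \<longlonglongrightarrow> (\<integral>x. ddir v r x \<partial>lborel)"
  proof (rule integral_dominated_convergence[where w = "\<lambda>x. B * indicator D x"])
    show "s k \<in> borel_measurable lborel" for k unfolding s_def by measurable
    show "integrable lborel (\<lambda>x. B * indicator D x)"
      using emeasure_compact_finite[OF D] by (intro integrable_mult_right integrable_real_indicator) auto
  qed (use lim bd in auto)
  then show ?thesis unfolding z by (simp add: LIMSEQ_const_iff)
qed

text \<open>The fundamental lemma of the calculus of variations by regularity of measures. The
  measures with densities G+ and G- agree on finite unions of balls whose closures lie in
  \<open>\<Omega>\<close>. The set where G > 0 is null for G-, so it has an open neighbourhood of
  small G- measure; a compact part of it is covered by such a union inside this neighbourhood, so
  its G+ measure is small too.\<close>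

lemma orthogonal_to_tests_le_0:
  fixes G :: "'a::euclidean_space \<Rightarrow> real"
  assumes \<Omega>: "open \<Omega>" and G: "integrable lborel G" and out: "\<And>x. x \<notin> \<Omega> \<Longrightarrow> G x = 0"
    and orth: "\<And>r. (\<lambda>x. complex_of_real (r x)) \<in> test_fun \<Omega> \<Longrightarrow> (\<integral>x. G x * r x \<partial>lborel) = 0"
  shows "AE x in lborel. G x \<le> 0"
proof -
  have [measurable]: "G \<in> borel_measurable borel" using G by (simp add: borel_measurable_integrable[of lborel G, simplified])
  define \<nu>p where "\<nu>p = density lborel (\<lambda>x. ennreal (G x))"
  define \<nu>m where "\<nu>m = density lborel (\<lambda>x. ennreal (- G x))"
  have nup: "emeasure \<nu>p S = (\<integral>\<^sup>+x. ennreal (G x) * indicator S x \<partial>lborel)" if "S \<in> sets borel" for S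
    unfolding \<nu>p_def using that by (intro emeasure_density) auto
  have num: "emeasure \<nu>m S = (\<integral>\<^sup>+x. ennreal (- G x) * indicator S x \<partial>lborel)" if "S \<in> sets borel" for S
    unfolding \<nu>m_def using that by (intro emeasure_density) auto
  have sets: "sets \<nu>p = sets borel" "sets \<nu>m = sets borel" by (simp_all add: \<nu>p_def \<nu>m_def)
  have fin: "emeasure \<nu>p (space \<nu>p) \<noteq> \<infinity>" "emeasure \<nu>m (space \<nu>m) \<noteq> \<infinity>"
    using G nup[of UNIV] num[of UNIV] by (auto simp: real_integrable_def \<nu>p_def \<nu>m_def)
  have balls: "emeasure \<nu>p V = emeasure \<nu>m V"
    if X: "finite X" "\<And>c. c \<in> X \<Longrightarrow> 0 < \<rho> c \<and> cball c (\<rho> c) \<subseteq> \<Omega>" and V: "V = (\<Union>c\<in>X. ball c (\<rho> c))" for X \<rho> V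
  proof -
    have Vb [measurable]: "V \<in> sets borel" unfolding V by (intro borel_open open_UN) auto
    define \<psi> where "\<psi> x = (\<Sum>c\<in>X. cutoff 1 0 (\<rho> c) c x)" for x
    have \<psi>0: "0 \<le> \<psi> x" for x unfolding \<psi>_def by (intro sum_nonneg cutoff_nonneg)
    have \<psi>out: "\<psi> x = 0" if "x \<notin> V" for x
    proof -
      have "cutoff 1 0 (\<rho> c) c x = 0" if c: "c \<in> X" for c
        using cutoff_support[of "\<rho> c" 1 0 c x] X(2)[OF c] \<open>x \<notin> V\<close> c unfolding V by (auto simp: dist_norm norm_minus_commute)
      then show ?thesis by (simp add: \<psi>_def)
    qed
    have \<psi>in: "0 < \<psi> x" if x: "x \<in> V" for x
    proof -
      obtain c where c: "c \<in> X" "x \<in> ball c (\<rho> c)" using x unfolding V by blast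
      have "norm (x - c) ^ 2 < \<rho> c ^ 2" using c by (intro power_strict_mono) (auto simp: dist_norm norm_minus_commute)
      then have "0 < cutoff 1 0 (\<rho> c) c x" by (simp add: cutoff_def flat_pos dot_square_norm)
      also have "\<dots> \<le> \<psi> x" unfolding \<psi>_def using X(1) c(1) cutoff_nonneg by (intro member_le_sum) auto
      finally show ?thesis .
    qed
    have sm: "smooth \<psi>" unfolding \<psi>_def by (intro smooth_sum smooth_cutoff)
    \<comment> \<open>\<open>\<psi>\<close> is positive on V and 0 elsewhere, so these smooth
      functions tend to the indicator of V.\<close>
    define r where "r k x = \<psi> x * inverse (\<psi> x + inverse (real (Suc k)))" for k x
    have pos: "0 < \<psi> x + inverse (real (Suc k))" for k x using \<psi>0[of x] by (simp add: add_nonneg_pos)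
    have smr: "smooth (r k)" for k
      unfolding r_def using pos[of _ k] by (intro smooth_mult smooth_inverse smooth_add sm smooth_const) (auto simp: less_imp_neq[symmetric])
    have [measurable]: "r k \<in> borel_measurable borel" for k
      by (rule borel_measurable_continuous_onI[OF smooth_continuous[OF smr]])
    have r01: "\<bar>r k x\<bar> \<le> 1" for k x
    proof -
      have "\<psi> x / (\<psi> x + inverse (real (Suc k))) \<le> 1" using pos[of x k] by (simp add: pos_divide_le_eq)
      moreover have "0 \<le> r k x" using \<psi>0[of x] pos[of x k] by (simp add: r_def)
      ultimately show ?thesis by (simp add: r_def divide_inverse)
    qed
    have lim: "(\<lambda>k. r k x) \<longlonglongrightarrow> indicator V x" for x
    proof (cases "x \<in> V")
      case True
      have "(\<lambda>k. r k x) \<longlonglongrightarrow> \<psi> x * inverse (\<psi> x + 0)" unfolding r_def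
        using \<psi>in[OF True] by (intro tendsto_intros LIMSEQ_inverse_real_of_nat) auto
      then show ?thesis using True \<psi>in[OF True] by simp
    next
      case False
      then show ?thesis by (simp add: r_def \<psi>out)
    qed
    have "(\<lambda>x. complex_of_real (r k x)) \<in> test_fun \<Omega>" for k
    proof (rule test_funI[of _ "\<Union>c\<in>X. cball c (\<rho> c)"])
      show "smooth (\<lambda>x. complex_of_real (r k x))" by (rule smooth_of_real[OF smr])
      show "compact (\<Union>c\<in>X. cball c (\<rho> c))" using X(1) by (intro compact_UN) auto
      show "(\<Union>c\<in>X. cball c (\<rho> c)) \<subseteq> \<Omega>" using X(2) by blast
      show "complex_of_real (r k x) = 0" if "x \<notin> (\<Union>c\<in>X. cball c (\<rho> c))" for x
      proof -
        have "x \<notin> V" using that unfolding V by force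
        then show ?thesis by (simp add: r_def \<psi>out)
      qed
    qed
    then have "(\<integral>x. G x * r k x \<partial>lborel) = 0" for k by (rule orth)
    moreover have "(\<lambda>k. \<integral>x. G x * r k x \<partial>lborel) \<longlonglongrightarrow> (\<integral>x. G x * indicator V x \<partial>lborel)"
    proof (rule integral_dominated_convergence[where w = "\<lambda>x. \<bar>G x\<bar>"])
      show "AE x in lborel. (\<lambda>k. G x * r k x) \<longlonglongrightarrow> G x * indicator V x"
        by (intro AE_I2 tendsto_mult tendsto_const lim)
      show "AE x in lborel. norm (G x * r k x) \<le> \<bar>G x\<bar>" for k
        using r01 by (intro AE_I2) (simp add: abs_mult mult_right_le_one_le)
    qed (use G in auto)
    ultimately have "(\<integral>x. G x * indicator V x \<partial>lborel) = 0" by (simp add: LIMSEQ_const_iff)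
    moreover have GV: "integrable lborel (\<lambda>x. G x * indicator V x)"
      by (rule integrable_real_mult_indicator[OF _ G]) simp
    ultimately have "enn2real (\<integral>\<^sup>+x. ennreal (G x * indicator V x) \<partial>lborel) = enn2real (\<integral>\<^sup>+x. ennreal (- (G x * indicator V x)) \<partial>lborel)"
      by (simp add: real_lebesgue_integral_def)
    then have "(\<integral>\<^sup>+x. ennreal (G x * indicator V x) \<partial>lborel) = (\<integral>\<^sup>+x. ennreal (- (G x * indicator V x)) \<partial>lborel)"
      using GV by (auto simp: real_integrable_def dest!: arg_cong[where f = ennreal] simp: less_top)
    moreover have "ennreal (G x * indicator V x) = ennreal (G x) * indicator V x"
      "ennreal (- (G x * indicator V x)) = ennreal (- G x) * indicator V x" for x
      by (auto simp: indicator_def)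
    ultimately show ?thesis by (simp add: nup num)
  qed
  let ?E = "{x. 0 < G x}"
  have Eb [measurable]: "?E \<in> sets borel" by measurable
  have m0: "emeasure \<nu>m ?E = 0"
    unfolding num[OF Eb] by (subst nn_integral_0_iff_AE) (auto simp: indicator_def ennreal_neg)
  have "emeasure \<nu>p ?E \<le> 0"
  proof (rule ennreal_le_epsilon)
    fix \<epsilon> :: real assume \<epsilon>: "0 < \<epsilon>"
    have "(INF U\<in>{U. ?E \<subseteq> U \<and> open U}. emeasure \<nu>m U) < ennreal \<epsilon>"
      using m0 \<epsilon> by (simp add: outer_regular[OF sets(2) fin(2) Eb, symmetric])
    then obtain U where U: "?E \<subseteq> U" "open U" "emeasure \<nu>m U < ennreal \<epsilon>" unfolding INF_less_iff by blast
    have "(SUP K\<in>{K. K \<subseteq> ?E \<and> compact K}. emeasure \<nu>p K) \<le> ennreal \<epsilon>"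
    proof (rule SUP_least)
      fix K assume "K \<in> {K. K \<subseteq> ?E \<and> compact K}"
      then have K: "K \<subseteq> ?E" "compact K" by auto
      have "K \<subseteq> U \<inter> \<Omega>" using K U out by force
      then have "\<forall>c\<in>K. \<exists>\<rho>>0. cball c \<rho> \<subseteq> U \<inter> \<Omega>"
        using open_contains_cball[of "U \<inter> \<Omega>"] U \<Omega> by blast
      then obtain \<rho> where \<rho>: "\<And>c. c \<in> K \<Longrightarrow> 0 < \<rho> c \<and> cball c (\<rho> c) \<subseteq> U \<inter> \<Omega>" by metis
      have "K \<subseteq> (\<Union>c\<in>K. ball c (\<rho> c))" using \<rho> by force
      then obtain X where X: "X \<subseteq> K" "finite X" "K \<subseteq> (\<Union>c\<in>X. ball c (\<rho> c))"
        using compactE_image[OF K(2), of K "\<lambda>c. ball c (\<rho> c)"] by auto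
      let ?V = "\<Union>c\<in>X. ball c (\<rho> c)"
      have "emeasure \<nu>p K \<le> emeasure \<nu>p ?V" using X by (intro emeasure_mono) (auto simp: sets)
      also have "\<dots> = emeasure \<nu>m ?V" by (rule balls[OF X(2), where \<rho> = \<rho>]) (use X(1) \<rho> in blast)+
      also have "\<dots> \<le> emeasure \<nu>m U"
      proof (rule emeasure_mono)
        show "?V \<subseteq> U" using X \<rho> ball_subset_cball by blast
      qed (use U in \<open>simp add: sets\<close>)
      finally show "emeasure \<nu>p K \<le> ennreal \<epsilon>" using U by simp
    qed
    then show "emeasure \<nu>p ?E \<le> 0 + ennreal \<epsilon>"
      by (simp add: inner_regular[OF sets(1) fin(1) Eb])
  qed
  then have "(\<integral>\<^sup>+x. ennreal (G x) * indicator ?E x \<partial>lborel) = 0" unfolding nup[OF Eb] by simp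
  then have "AE x in lborel. ennreal (G x) * indicator ?E x = 0" by (subst (asm) nn_integral_0_iff_AE) auto
  then show ?thesis by eventually_elim (auto simp: indicator_def ennreal_eq_0_iff split: if_splits)
qed

lemma orthogonal_to_tests_eq_0:
  fixes g :: "'a::euclidean_space \<Rightarrow> real"
  assumes \<Omega>: "open \<Omega>" "bounded \<Omega>" and g: "L2_on \<Omega> g"
    and orth: "\<And>r. (\<lambda>x. complex_of_real (r x)) \<in> test_fun \<Omega> \<Longrightarrow> (LINT x|lebesgue_on \<Omega>. g x * r x) = 0"
  shows "AE x in lebesgue_on \<Omega>. g x = 0"
proof -
  have gm: "g \<in> borel_measurable (lebesgue_on \<Omega>)" using g by (simp add: L2_on_def)
  obtain v where v: "v \<in> borel_measurable borel" "AE x in lborel. x \<in> \<Omega> \<longrightarrow> v x = g x"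
    using lebesgue_on_borel_representative[OF \<Omega>(1) gm] by blast
  have [measurable]: "\<Omega> \<in> sets borel" "v \<in> borel_measurable borel" using \<Omega> v by auto
  define G where "G x = indicator \<Omega> x * v x" for x
  have Gm [measurable]: "G \<in> borel_measurable borel" unfolding G_def by measurable
  have out: "G x = 0" if "x \<notin> \<Omega>" for x using that by (simp add: G_def)
  have ae: "AE x in lborel. x \<in> \<Omega> \<longrightarrow> G x = g x" using v(2) by eventually_elim (auto simp: G_def)
  have ig: "integrable (lebesgue_on \<Omega>) g"
  proof (rule Bochner_Integration.integrable_bound)
    show "integrable (lebesgue_on \<Omega>) (\<lambda>x. 1 + (g x)\<^sup>2)" using g L2_const_one[OF \<Omega>] by (simp add: L2_on_def)
    show "AE x in lebesgue_on \<Omega>. norm (g x) \<le> norm (1 + (g x)\<^sup>2)"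
    proof (rule AE_I2)
      fix x
      have "0 \<le> (\<bar>g x\<bar> - 1)\<^sup>2" by simp
      then have "2 * \<bar>g x\<bar> \<le> 1 + (g x)\<^sup>2" by (simp add: power2_diff)
      then show "norm (g x) \<le> norm (1 + (g x)\<^sup>2)" unfolding real_norm_def by linarith
    qed
  qed (rule gm)
  have iG: "integrable lborel G" by (rule lebesgue_on_transfer(1)[OF \<Omega>(1) Gm ig ae out])
  have orth': "(\<integral>x. G x * r x \<partial>lborel) = 0" if r: "(\<lambda>x. complex_of_real (r x)) \<in> test_fun \<Omega>" for r
  proof -
    have "r \<in> borel_measurable borel"
      using measurable_compose[OF test_fun_borel[OF r] borel_measurable_Re] by simp
    then have "(\<lambda>x. G x * r x) \<in> borel_measurable borel" by measurable
    moreover have "AE x in lborel. x \<in> \<Omega> \<longrightarrow> G x * r x = g x * r x" using ae by eventually_elim auto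
    ultimately have "(\<integral>x. G x * r x \<partial>lborel) = (LINT x|lebesgue_on \<Omega>. g x * r x)"
      using out by (intro lebesgue_on_transfer(2)[OF \<Omega>(1) _ integrable_L2_test[OF \<Omega> g r]]) auto
    then show ?thesis using orth[OF r] by simp
  qed
  have "AE x in lborel. G x \<le> 0"
    by (rule orthogonal_to_tests_le_0[OF \<Omega>(1) iG out orth'])
  moreover have "AE x in lborel. - G x \<le> 0"
    by (rule orthogonal_to_tests_le_0[OF \<Omega>(1)]) (use iG out orth' in auto)
  ultimately have "AE x in lborel. x \<in> \<Omega> \<longrightarrow> g x = 0" using ae by eventually_elim auto
  then have "AE x in lebesgue. x \<in> \<Omega> \<longrightarrow> g x = 0" by (rule AE_completion)
  then show ?thesis using \<Omega> by (subst AE_restrict_space_iff) auto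
qed

lemma const_weak_deriv:
  fixes \<Omega> :: "'a::euclidean_space set"
  assumes \<Omega>: "open \<Omega>" "bounded \<Omega>"
  shows "weak_deriv \<Omega> (\<lambda>_. c) v (\<lambda>_. 0)"
proof -
  have "(LINT x|lebesgue_on \<Omega>. complex_of_real c * ddir v \<phi> x) = 0" if \<phi>: "\<phi> \<in> test_fun \<Omega>" for \<phi>
  proof -
    obtain C where C: "compact C" "C \<subseteq> \<Omega>" "\<And>x. x \<notin> C \<Longrightarrow> \<phi> x = 0" using test_fun_support[OF \<phi>] by blast
    note t = test_fun_ddir[OF \<phi>, of v]
    have part: "(LINT x|lebesgue_on \<Omega>. L (ddir v \<phi> x)) = 0" and int: "integrable (lebesgue_on \<Omega>) (\<lambda>x. L (ddir v \<phi> x))"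
      if L: "bounded_linear L" for L :: "complex \<Rightarrow> real"
    proof -
      have sL: "smooth (\<lambda>x. L (\<phi> x))" by (rule smooth_linear[OF L test_fun_smooth[OF \<phi>]])
      have dL: "ddir v (\<lambda>x. L (\<phi> x)) x = L (ddir v \<phi> x)" for x
        by (rule ddir_eqI[OF bounded_linear.has_derivative[OF L smooth_has_derivative[OF test_fun_smooth[OF \<phi>]]]])
      have L0: "L 0 = 0" using L by (simp add: linear_0 bounded_linear.linear)
      obtain D where D: "compact D" "D \<subseteq> \<Omega>" "\<And>x. x \<notin> D \<Longrightarrow> ddir v \<phi> x = 0" using test_fun_support[OF t] by blast
      have "(\<lambda>x. complex_of_real (L (ddir v \<phi> x))) \<in> test_fun \<Omega>"
        using D L0 by (intro test_funI[of _ D] smooth_of_real smooth_linear[OF L] test_fun_smooth[OF t]) auto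
      from integrable_L2_test[OF \<Omega> L2_const_one[OF \<Omega>] this]
      show int: "integrable (lebesgue_on \<Omega>) (\<lambda>x. L (ddir v \<phi> x))" by simp
      have "(\<lambda>x. L (ddir v \<phi> x)) \<in> borel_measurable borel"
        by (intro borel_measurable_continuous_onI smooth_continuous smooth_linear[OF L] test_fun_smooth[OF t])
      from lebesgue_on_transfer(2)[OF \<Omega>(1) this int]
      have "(LINT x|lebesgue_on \<Omega>. L (ddir v \<phi> x)) = (\<integral>x. L (ddir v \<phi> x) \<partial>lborel)"
        using D L0 by (metis (no_types, lifting) AE_I2 subset_iff)
      also have "\<dots> = (\<integral>x. ddir v (\<lambda>x. L (\<phi> x)) x \<partial>lborel)" by (simp only: dL)
      also have "\<dots> = 0" using C L0 by (intro integral_ddir_eq_0[OF sL C(1)]) auto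
      finally show "(LINT x|lebesgue_on \<Omega>. L (ddir v \<phi> x)) = 0" .
    qed
    have i: "integrable (lebesgue_on \<Omega>) (ddir v \<phi>)"
      using integrable_L2_product_test[OF L2_const_one[OF \<Omega>] L2_const_one[OF \<Omega>] t] by simp
    have "(LINT x|lebesgue_on \<Omega>. ddir v \<phi> x) = 0"
      using part[OF bounded_linear_Re] part[OF bounded_linear_Im] integral_Re[OF i] integral_Im[OF i]
      by (simp add: complex_eq_iff)
    then show ?thesis by simp
  qed
  then show ?thesis by (simp add: weak_deriv_def L2_on_def)
qed

text \<open>The zero current does it once the current of f vanishes. Since \<open>wgrad\<close> is
  picked by \<open>SOME\<close>, this takes uniqueness of weak derivatives and not just the fact
  that 0 is one. The lemma serves to make the set in \<open>capacity\<close> nonempty.\<close>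

lemma const_in_W_star:
  fixes \<Omega> :: "(complex^'n::finite) set"
  assumes \<Omega>: "open \<Omega>" "bounded \<Omega>"
  shows "(\<lambda>_. c) \<in> W_star \<Omega>"
proof -
  let ?f = "\<lambda>_::complex^'n. c"
  have W: "?f \<in> W12 \<Omega>"
    using const_weak_deriv[OF \<Omega>] integrable_mult_left[of "c\<^sup>2" "lebesgue_on \<Omega>" "\<lambda>_. 1"] L2_const_one[OF \<Omega>]
    by (auto simp: W12_def L2_on_def)
  have "AE x in lebesgue_on \<Omega>. wgrad \<Omega> ?f b x = 0" if b: "b \<in> Basis" for b
  proof (rule orthogonal_to_tests_eq_0[OF \<Omega> L2_wgrad[OF W b]])
    fix r assume r: "(\<lambda>x. complex_of_real (r x)) \<in> test_fun \<Omega>"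
    have "(LINT x|lebesgue_on \<Omega>. complex_of_real c * ddir b (\<lambda>x. complex_of_real (r x)) x)
        = - (LINT x|lebesgue_on \<Omega>. of_real (wgrad \<Omega> ?f b x) * complex_of_real (r x))"
      using weak_deriv_wgrad[OF W b] r unfolding weak_deriv_def by blast
    moreover have "(LINT x|lebesgue_on \<Omega>. complex_of_real c * ddir b (\<lambda>x. complex_of_real (r x)) x) = 0"
      using const_weak_deriv[OF \<Omega>, of c b] r unfolding weak_deriv_def by auto
    ultimately show "(LINT x|lebesgue_on \<Omega>. wgrad \<Omega> ?f b x * r x) = 0"
      unfolding of_real_mult[symmetric] integral_complex_of_real by simp
  qed
  then have ae: "AE x in lebesgue_on \<Omega>. \<forall>b\<in>Basis. wgrad \<Omega> ?f b x = 0"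
    by (intro AE_finite_allI) auto
  have df0: "df_wedge_dcf \<Omega> ?f j k \<phi> = 0" for j k \<phi>
    unfolding df_wedge_dcf_def form_current_def
    by (rule integral_eq_zero_AE, rule AE_mp[OF ae], rule AE_I2)
      (simp add: wedge11_def dc_of_def wdiff_def axis_in_Basis_complex)
  have wt0: "wedge_top j0 (\<lambda>j k \<phi>. 0) \<gamma> = (\<lambda>\<phi>. 0)" for j0 :: 'n and \<gamma> by (auto simp: wedge_top_def)
  have "(\<lambda>j k \<phi>. 0) \<in> Gamma_f \<Omega> ?f"
    by (auto simp: Gamma_f_def is_current11_def distribution_def closed_current11_def positive_current11_def
        nonneg_distribution_def wt0 df0 intro!: exI[of _ 0])
  moreover have "mass \<Omega> (\<lambda>j k \<phi>. 0) < \<infinity>"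
    unfolding mass_def total_mass_def wt0 by (rule le_less_trans[OF SUP_least[of _ _ 0]]) auto
  ultimately show ?thesis using W by (auto simp: W_star_def)
qed

section \<open>Derivation of the four statements from the sublevel estimate\<close>

theorem theorem1p4:
  fixes \<Omega> K :: "(complex^'n::finite) set"
  assumes "open \<Omega>" and "bounded \<Omega>" and "compact K" and "K \<subseteq> \<Omega>"
  shows "(stmt_a \<Omega> K \<and> stmt_b \<Omega> K \<and> stmt_c \<Omega> K \<and> stmt_d \<Omega> K) \<and>
         (stmt_a \<Omega> K \<longleftrightarrow> stmt_b \<Omega> K) \<and> (stmt_b \<Omega> K \<longleftrightarrow> stmt_c \<Omega> K) \<and> (stmt_c \<Omega> K \<longleftrightarrow> stmt_d \<Omega> K)"
proof -
  obtain A1 \<alpha> where A1: "0 < A1" and \<alpha>: "0 < \<alpha>"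
    and est: "\<And>\<kappa> f s. 0 < \<kappa> \<Longrightarrow> f \<in> W_star_nonpos \<Omega> \<Longrightarrow> star_norm \<Omega> f \<le> \<kappa> \<Longrightarrow> 0 < s \<Longrightarrow>
      measure lebesgue ({z\<in>\<Omega>. f z < - s} \<inter> K) \<le> A1 * exp (- \<alpha> * s\<^sup>2 / \<kappa>\<^sup>2)"
    using sublevel_set_estimate[OF assms] by blast
  have norm0: "0 \<le> star_norm \<Omega> f" for f :: "complex^'n \<Rightarrow> real"
    unfolding star_norm_def by (intro real_sqrt_ge_zero add_nonneg_nonneg integral_nonneg_AE) auto
  have level: "measure lebesgue ({z\<in>\<Omega>. f z < - s} \<inter> K) \<le> A1 * exp_neg_div (\<alpha> * s\<^sup>2) ((star_norm \<Omega> f)\<^sup>2)"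
    if f: "f \<in> W_star_nonpos \<Omega>" and s: "0 < s" for f s
  proof (cases "star_norm \<Omega> f = 0")
    case True
    let ?m = "measure lebesgue ({z\<in>\<Omega>. f z < - s} \<inter> K)"
    \<comment> \<open>A function of norm 0 is admissible for every \<kappa> > 0. Along \<kappa> = 1
      / (k + 1) the bound tends to 0, the value that \<open>exp_neg_div\<close> takes at 0.\<close>
    have "(\<lambda>k. A1 * exp (- \<alpha> * s\<^sup>2 / (inverse (real (Suc k)))\<^sup>2)) \<longlonglongrightarrow> 0"
    proof -
      have "filterlim (\<lambda>k. (\<alpha> * s\<^sup>2) * real (Suc k) ^ 2) at_top sequentially"
        using \<alpha> s by (intro filterlim_tendsto_pos_mult_at_top[OF tendsto_const] filterlim_pow_at_top
            filterlim_compose[OF filterlim_real_sequentially filterlim_Suc]) auto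
      then have "(\<lambda>k. exp (- ((\<alpha> * s\<^sup>2) * real (Suc k) ^ 2))) \<longlonglongrightarrow> 0"
        by (intro filterlim_compose[OF exp_at_bot]) (simp add: filterlim_uminus_at_bot)
      from tendsto_mult_right_zero[OF this, of A1] show ?thesis by (simp add: power_inverse divide_inverse)
    qed
    then have "?m \<le> 0"
      by (rule LIMSEQ_le_const) (use est[OF _ f _ s] True in \<open>auto intro!: exI[of _ 0]\<close>)
    then show ?thesis using A1 by (simp add: exp_neg_div_def True)
  next
    case False
    then have "0 < star_norm \<Omega> f" using norm0[of f] by simp
    from est[OF this f order_refl s] show ?thesis using False by (simp add: exp_neg_div_def)
  qed
  have c: "stmt_c \<Omega> K" unfolding stmt_c_def using A1 \<alpha> est by blast
  have d: "stmt_d \<Omega> K"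
  proof -
    have "measure lebesgue ({z\<in>\<Omega>. f z < - s} \<inter> K) \<le> A1 * exp (- \<alpha> * s\<^sup>2)"
      if "f \<in> W_star_nonpos \<Omega>" "star_norm \<Omega> f \<le> 1" "0 < s" for f s
      using est[OF zero_less_one that] by simp
    then show ?thesis unfolding stmt_d_def using A1 \<alpha> by blast
  qed
  have b: "stmt_b \<Omega> K"
  proof -
    have "measure lebesgue ({z\<in>\<Omega>. f z < - 1} \<inter> K) \<le> A1 * exp_neg_div \<alpha> ((star_norm \<Omega> f)\<^sup>2)"
      if "f \<in> W_star_nonpos \<Omega>" for f
      using level[OF that zero_less_one] by simp
    then show ?thesis unfolding stmt_b_def using A1 \<alpha> by blast
  qed
  \<comment> \<open>A competitor satisfies v <= -1 near E, not v < -1, so the estimate is used at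
    level 1/2, which costs the factor 1/4 in the exponent. Adding the measure of
    \<open>\<Omega>\<close> to \<open>A1\<close> keeps the ratio in the logarithm above 1.\<close>
  have a: "measure lebesgue E \<le> (A1 + measure lebesgue \<Omega>) * exp_neg_div (\<alpha> / 4) (capacity \<Omega> E)"
    if E: "E \<in> sets borel \<and> E \<subseteq> K" for E
  proof -
    let ?S = "{(star_norm \<Omega> v)\<^sup>2 | v. v \<in> W_star_nonpos \<Omega> \<and>
     (\<exists>U. open U \<and> E \<subseteq> U \<and> U \<subseteq> \<Omega> \<and> (AE z in lebesgue_on U. v z \<le> - 1))}"
    let ?m = "measure lebesgue E" and ?A = "A1 + measure lebesgue \<Omega>"
    have \<Omega>l: "\<Omega> \<in> lmeasurable" using bounded_set_imp_lmeasurable[OF assms(2)] assms(1) by simp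
    have El: "E \<in> sets lebesgue" using E by (auto intro: sets_completionI_sets)
    have Kl: "K \<in> lmeasurable" using assms(3) by (rule lmeasurable_compact)
    show "?m \<le> ?A * exp_neg_div (\<alpha> / 4) (capacity \<Omega> E)"
    proof (cases "?m = 0")
      case True
      have "0 \<le> exp_neg_div (\<alpha> / 4) (capacity \<Omega> E)" by (simp add: exp_neg_div_def)
      then show ?thesis using True A1 measure_nonneg[of lebesgue \<Omega>] by simp
    next
      case False
      then have m: "0 < ?m" using measure_nonneg[of lebesgue E] by linarith
      have "?m \<le> measure lebesgue \<Omega>" using E assms(4) El \<Omega>l by (intro measure_mono_fmeasurable) auto
      then have mA: "?m < ?A" using A1 by simp
      \<comment> \<open>The value at which \<open>?A\<close> exp (-\<alpha> / (4 x)) equals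
        \<open>?m\<close>, so that every competitor has squared norm at least
        \<open>x\<close>.\<close>
      define x where "x = \<alpha> / 4 / ln (?A / ?m)"
      have l: "0 < ln (?A / ?m)" using m mA by (intro ln_gt_zero) (simp add: field_simps)
      have x: "0 < x" using l \<alpha> by (simp add: x_def)
      have "x \<le> (star_norm \<Omega> v)\<^sup>2"
        if v: "v \<in> W_star_nonpos \<Omega>" and U: "open U" "E \<subseteq> U" "U \<subseteq> \<Omega>" "AE z in lebesgue_on U. v z \<le> - 1" for v U
      proof -
        let ?B = "{z\<in>\<Omega>. v z < - (1/2)} \<inter> K"
        have Bl: "?B \<in> lmeasurable"
        proof (rule fmeasurableI2[OF Kl])
          have "v \<in> borel_measurable (lebesgue_on \<Omega>)"
            using v by (auto simp: W_star_nonpos_def W_star_def W12_def L2_on_def)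
          then have "{z \<in> space (lebesgue_on \<Omega>). v z < - (1/2)} \<in> sets (lebesgue_on \<Omega>)" by measurable
          then have "{z\<in>\<Omega>. v z < - (1/2)} \<in> sets lebesgue"
            using assms(1) by (subst (asm) sets_restrict_space_iff) auto
          then show "?B \<in> sets lebesgue" using Kl by (intro sets.Int) (auto simp: fmeasurable_def)
        qed auto
        have "AE z in lebesgue. z \<in> U \<longrightarrow> v z \<le> - 1"
          using U by (subst (asm) AE_restrict_space_iff) auto
        then have "AE z in lebesgue. z \<in> E \<longrightarrow> z \<in> ?B"
          by eventually_elim (use U E assms(4) in auto)
        then have "emeasure lebesgue E \<le> emeasure lebesgue ?B"
          using Bl by (intro emeasure_mono_AE) auto
        then have "?m \<le> measure lebesgue ?B"
          using Bl unfolding measure_def by (intro enn2real_mono) (auto simp: fmeasurable_def)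
        also have "\<dots> \<le> A1 * exp_neg_div (\<alpha> * (1/2)\<^sup>2) ((star_norm \<Omega> v)\<^sup>2)" by (rule level[OF v]) simp
        finally have le: "?m \<le> A1 * exp_neg_div (\<alpha> / 4) ((star_norm \<Omega> v)\<^sup>2)" by (simp add: power2_eq_square)
        define N where "N = (star_norm \<Omega> v)\<^sup>2"
        have N: "0 < N" using le m by (auto simp: exp_neg_div_def N_def split: if_splits)
        have "?m \<le> A1 * exp (- (\<alpha> / 4) / N)" using le N by (simp add: exp_neg_div_def N_def)
        also have "\<dots> \<le> ?A * exp (- (\<alpha> / 4) / N)" by (intro mult_right_mono) auto
        finally have "exp (\<alpha> / 4 / N) \<le> ?A / ?m" using m by (simp add: exp_minus field_simps)
        then have "\<alpha> / 4 / N \<le> ln (?A / ?m)" using m mA by (subst ln_ge_iff) auto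
        then show ?thesis using l N by (simp add: x_def N_def[symmetric] field_simps)
      qed
      \<comment> \<open>\<open>Inf\<close> of the empty set of reals is a default value that the
        lower bound \<open>x\<close> would not reach. The constant -1, with U =
        \<open>\<Omega>\<close>, is a competitor.\<close>
      moreover have "?S \<noteq> {}"
      proof -
        have "(\<lambda>_. - 1) \<in> W_star_nonpos \<Omega>" using const_in_W_star[OF assms(1,2)] by (simp add: W_star_nonpos_def)
        then show ?thesis using assms(1,4) E by fastforce
      qed
      ultimately have cx: "x \<le> capacity \<Omega> E" unfolding capacity_def by (intro cInf_greatest) auto
      then have c0: "0 < capacity \<Omega> E" using x by simp
      have "\<alpha> / 4 / capacity \<Omega> E \<le> \<alpha> / 4 / x" using cx x \<alpha> by (intro divide_left_mono) auto
      also have "\<dots> = ln (?A / ?m)" using \<alpha> l by (simp add: x_def)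
      finally have "exp (- ln (?A / ?m)) \<le> exp (- (\<alpha> / 4) / capacity \<Omega> E)" by simp
      moreover have "exp (- ln (?A / ?m)) = ?m / ?A" using m mA by (simp add: exp_minus)
      ultimately have "?m / ?A \<le> exp_neg_div (\<alpha> / 4) (capacity \<Omega> E)" using c0 by (simp add: exp_neg_div_def)
      then show ?thesis using m mA by (simp add: field_simps)
    qed
  qed
  moreover have "0 < A1 + measure lebesgue \<Omega>" "0 < \<alpha> / 4" using A1 \<alpha> by (simp_all add: add_pos_nonneg)
  ultimately have "stmt_a \<Omega> K" unfolding stmt_a_def by blast
  with b c d show ?thesis by blast
qed

end
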